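(* Let $n\ge2$ and let $\Omega\subset\mathbb R^n$ be an admissible domain with $\partial\Omega=\mathcal F\cup\mathcal B$ which is a subset of the infinite cylinder $\mathcal F\times(-\infty,0]$. Let $\eta_1\le\eta_2\le\cdots$ be the mixed Steklov--Dirichlet eigenvalues of $\Omega$. Then for every $\gamma\ge1$ and every $z>0$ $$R^\Omega_\gamma(z,\mathcal D_D)=\sum_j(z-\eta_j)_+^\gamma\ \le\ C_{n,\gamma}\,|\mathcal F|\,z^{n+\gamma-1}.$$
   Context: Admissible domain in $\mathbb R^n$: a bounded domain $\Omega\subset\mathbb R^n$ with Lipschitz, piecewise smooth boundary $\partial\Omega=\mathcal F\cup\mathcal B$, $\mathcal F\subset\{x_n=0\}$, $\mathcal B\subset\{x_n<0\}$, where $\mathcal F$ (the free part of the boundary) has positive $(n-1)$-dimensional measure $|\mathcal F|$. $\mathcal F$ is identified with a subset of $\mathbb R^{n-1}$. Steklov--Dirichlet eigenvalues of $\Omega$: the numbers $0<\eta_1\le\eta_2\le\cdots\nearrow\infty$ (counted with multiplicity) for which $\Delta f=0$ in $\Omega$, $f=0$ on $\mathcal B$, $\partial f/\partial x_n=\eta f$ on $\mathcal F$ has a nontrivial (weak) solution; equivalently, the eigenvalues given by min-max for $\int_\Omega|\nabla f|^2dx/\int_{\mathcal F}|f|^2ds$ over $f\in H^1(\Omega)$ with $f=0$ on $\mathcal B$. They are the eigenvalues of the Dirichlet-to-Neumann operator $\mathcal D_D$ on $L^2(\mathcal F)$. $(t)_+=\max\{0,t\}$. $C_{n,\gamma}=\frac{1}{(4\pi)^{\frac{n-1}{2}}}\frac{\Gamma(\gamma+1)\Gamma(n)}{\Gamma(\frac{n+1}{2})\Gamma(n+\gamma)}$.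 *)

theory Defs
  imports "HOL-Analysis.Analysis"
begin

text \<open>
  The ambient space $\mathbb R^n$ is \<^typ>\<open>(real ^ 'm) \<times> real\<close>, so that $n = m + 1 \ge 2$; a point is
  $(x', x_n)$, and the free part of the boundary is a set \<open>F\<close> in $\mathbb R^{n-1}$, placed in
  $\{x_n = 0\}$ as \<open>F \<times> {0}\<close>.
\<close>

section \<open>Smooth functions and Sobolev functions\<close>

text \<open>All iterated directional derivatives exist and are Frechet differentiable; in finite
  dimension this is $C^\infty(\mathbb R^n)$.\<close>

coinductive smooth :: "('a::euclidean_space \<Rightarrow> real) \<Rightarrow> bool" where
  "(\<And>x. f differentiable (at x)) \<Longrightarrow>
   (\<And>v. smooth (\<lambda>x. frechet_derivative f (at x) v)) \<Longrightarrow> smooth f"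

definition grad :: "('a::euclidean_space \<Rightarrow> real) \<Rightarrow> 'a \<Rightarrow> 'a" where
  "grad f x = (THE D. GDERIV f x :> D)"

definition test_function :: "'a::euclidean_space set \<Rightarrow> ('a \<Rightarrow> real) \<Rightarrow> bool" where
  "test_function \<Omega> \<phi> \<longleftrightarrow>
     smooth \<phi> \<and> compact (closure {x. \<phi> x \<noteq> 0}) \<and> closure {x. \<phi> x \<noteq> 0} \<subseteq> \<Omega>"

definition L2_on :: "'a::euclidean_space set \<Rightarrow> ('a \<Rightarrow> 'b::euclidean_space) \<Rightarrow> bool" where
  "L2_on S f \<longleftrightarrow> f \<in> borel_measurable (lebesgue_on S) \<and>
     integrable (lebesgue_on S) (\<lambda>x. (norm (f x))\<^sup>2)"

definition L2_converges_on ::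
  "'a::euclidean_space set \<Rightarrow> (nat \<Rightarrow> 'a \<Rightarrow> 'b::euclidean_space) \<Rightarrow> ('a \<Rightarrow> 'b) \<Rightarrow> bool" where
  "L2_converges_on S u f \<longleftrightarrow> (\<forall>k. L2_on S (u k)) \<and> L2_on S f \<and>
     (\<lambda>k. \<integral>x. (norm (u k x - f x))\<^sup>2 \<partial>lebesgue_on S) \<longlonglongrightarrow> 0"

text \<open>\<open>f \<in> H\<^sup>1(\<Omega>)\<close> with weak gradient \<open>g\<close>.\<close>

definition H1_weak_gradient ::
  "'a::euclidean_space set \<Rightarrow> ('a \<Rightarrow> real) \<Rightarrow> ('a \<Rightarrow> 'a) \<Rightarrow> bool" where
  "H1_weak_gradient \<Omega> f g \<longleftrightarrow> L2_on \<Omega> f \<and> L2_on \<Omega> g \<and>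
     (\<forall>\<phi>. test_function \<Omega> \<phi> \<longrightarrow>
        (\<integral>x. f x *\<^sub>R grad \<phi> x \<partial>lebesgue_on \<Omega>) = - (\<integral>x. \<phi> x *\<^sub>R g x \<partial>lebesgue_on \<Omega>))"

section \<open>Admissible domains\<close>

text \<open>After a rotation, \<open>\<Omega>\<close> is locally the region below the graph of a Lipschitz function.\<close>

definition lipschitz_boundary :: "((real ^ 'm) \<times> real) set \<Rightarrow> bool" where
  "lipschitz_boundary \<Omega> \<longleftrightarrow>
     (\<forall>p\<in>frontier \<Omega>. \<exists>U T (h :: real ^ 'm \<Rightarrow> real) L.
        open U \<and> p \<in> U \<and> orthogonal_transformation T \<and> L-lipschitz_on UNIV h \<and>
        \<Omega> \<inter> U = {x \<in> U. snd (T x) < h (fst (T x))})"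

definition smooth_hypersurface :: "'a::euclidean_space set \<Rightarrow> bool" where
  "smooth_hypersurface S \<longleftrightarrow>
     (\<forall>p\<in>S. \<exists>U \<rho>. open U \<and> p \<in> U \<and> smooth \<rho> \<and> (\<forall>x\<in>U. grad \<rho> x \<noteq> 0) \<and>
        S \<inter> U = {x \<in> U. \<rho> x = 0})"

text \<open>Contained in finitely many Lipschitz images of bounded subsets of $\mathbb R^{n-2}$, the
  latter realised as a coordinate hyperplane of $\mathbb R^{n-1}$ (a single point if $n = 2$).\<close>

definition codim_two_set :: "((real ^ 'm) \<times> real) set \<Rightarrow> bool" where
  "codim_two_set E \<longleftrightarrow>
     (\<exists>\<A>. finite \<A> \<and> E \<subseteq> \<Union>\<A> \<and>
        (\<forall>A\<in>\<A>. \<exists>K i (g :: real ^ 'm \<Rightarrow> (real ^ 'm) \<times> real) L.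
           bounded K \<and> K \<subseteq> {y. y $ i = 0} \<and> L-lipschitz_on K g \<and> A = g ` K))"

text \<open>Apart from edges, the boundary consists of finitely many smooth pieces, each belonging
  either to the free part or to the Dirichlet part.\<close>

definition piecewise_smooth_boundary ::
  "((real ^ 'm) \<times> real) set \<Rightarrow> (real ^ 'm) set \<Rightarrow> ((real ^ 'm) \<times> real) set \<Rightarrow> bool" where
  "piecewise_smooth_boundary \<Omega> F B \<longleftrightarrow>
     (\<exists>\<P>. finite \<P> \<and>
        (\<forall>S\<in>\<P>. openin (top_of_set (frontier \<Omega>)) S \<and> smooth_hypersurface S \<and>
               (S \<subseteq> F \<times> {0} \<or> S \<subseteq> B)) \<and>
        codim_two_set (frontier \<Omega> - \<Union>\<P>))"

text \<open>Since \<open>\<partial>\<Omega>\<close> is compact, \<open>F\<close> is automatically compact here, namely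
  $F \times \{0\} = \partial\Omega \cap \{x_n = 0\}$.\<close>

definition admissible_domain ::
  "((real ^ 'm) \<times> real) set \<Rightarrow> (real ^ 'm) set \<Rightarrow> ((real ^ 'm) \<times> real) set \<Rightarrow> bool" where
  "admissible_domain \<Omega> F B \<longleftrightarrow>
     open \<Omega> \<and> connected \<Omega> \<and> bounded \<Omega> \<and>
     lipschitz_boundary \<Omega> \<and> piecewise_smooth_boundary \<Omega> F B \<and>
     frontier \<Omega> = F \<times> {0} \<union> B \<and> B \<subseteq> {x. snd x < 0} \<and>
     measure lebesgue F > 0"

section \<open>The mixed Steklov--Dirichlet problem\<close>

text \<open>
  \<open>f\<close> is in $H^1(\Omega)$ with weak gradient \<open>g\<close>, vanishes on \<open>B\<close>, and has trace \<open>t\<close> on \<open>F\<close>. As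
  usual, $\{f \in H^1(\Omega) : f = 0 \mbox{ on } B\}$ is the $H^1$-closure of the functions smooth up
  to the boundary that vanish on \<open>B\<close>, and the trace on \<open>F\<close> is the continuous extension of
  restriction, that is, the $L^2(F)$-limit of the restrictions of the approximating functions.
\<close>

definition H1_dirichlet ::
  "((real ^ 'm) \<times> real) set \<Rightarrow> (real ^ 'm) set \<Rightarrow> ((real ^ 'm) \<times> real) set \<Rightarrow>
   ((real ^ 'm) \<times> real \<Rightarrow> real) \<Rightarrow> ((real ^ 'm) \<times> real \<Rightarrow> (real ^ 'm) \<times> real) \<Rightarrow>
   (real ^ 'm \<Rightarrow> real) \<Rightarrow> bool" where
  "H1_dirichlet \<Omega> F B f g t \<longleftrightarrow> H1_weak_gradient \<Omega> f g \<and>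
     (\<exists>\<phi>. (\<forall>k. smooth (\<phi> k) \<and> (\<forall>x\<in>B. \<phi> k x = 0)) \<and>
          L2_converges_on \<Omega> \<phi> f \<and>
          L2_converges_on \<Omega> (\<lambda>k. grad (\<phi> k)) g \<and>
          L2_converges_on F (\<lambda>k x. \<phi> k (x, 0)) t)"

text \<open>
  The weak form of $\Delta f = 0$ in $\Omega$, $f = 0$ on $B$, $\partial f/\partial x_n = \eta f$ on
  $F$, the outward normal on $F$ being $e_n$. The zero function is a member.
\<close>

definition steklov_dirichlet_eigenspace ::
  "((real ^ 'm) \<times> real) set \<Rightarrow> (real ^ 'm) set \<Rightarrow> ((real ^ 'm) \<times> real) set \<Rightarrow> real \<Rightarrow>
   ((real ^ 'm) \<times> real \<Rightarrow> real) set" where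
  "steklov_dirichlet_eigenspace \<Omega> F B \<eta> =
     {f. \<exists>g t. H1_dirichlet \<Omega> F B f g t \<and>
        (\<forall>u v s. H1_dirichlet \<Omega> F B u v s \<longrightarrow>
           (\<integral>x. g x \<bullet> v x \<partial>lebesgue_on \<Omega>) = \<eta> * (\<integral>x. t x * s x \<partial>lebesgue_on F))}"

text \<open>Linear independence modulo almost everywhere equality.\<close>

definition independent_ae ::
  "'a::euclidean_space set \<Rightarrow> nat \<Rightarrow> (nat \<Rightarrow> 'a \<Rightarrow> real) \<Rightarrow> bool" where
  "independent_ae S k f \<longleftrightarrow>
     (\<forall>c. (AE x in lebesgue_on S. (\<Sum>i<k. c i * f i x) = 0) \<longrightarrow> (\<forall>i<k. c i = 0))"

text \<open>The dimension of the eigenspace; it is 0 if \<open>\<eta>\<close> is not an eigenvalue.\<close>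

definition steklov_dirichlet_multiplicity ::
  "((real ^ 'm) \<times> real) set \<Rightarrow> (real ^ 'm) set \<Rightarrow> ((real ^ 'm) \<times> real) set \<Rightarrow> real \<Rightarrow> enat" where
  "steklov_dirichlet_multiplicity \<Omega> F B \<eta> =
     (SUP k \<in> {k. \<exists>f. (\<forall>i<k. f i \<in> steklov_dirichlet_eigenspace \<Omega> F B \<eta>) \<and> independent_ae \<Omega> k f}.
        enat k)"

text \<open>\<open>\<eta> 0 \<le> \<eta> 1 \<le> \<dots>\<close> lists all eigenvalues, each as often as its multiplicity.\<close>

definition steklov_dirichlet_eigenvalues ::
  "((real ^ 'm) \<times> real) set \<Rightarrow> (real ^ 'm) set \<Rightarrow> ((real ^ 'm) \<times> real) set \<Rightarrow>
   (nat \<Rightarrow> real) \<Rightarrow> bool" where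
  "steklov_dirichlet_eigenvalues \<Omega> F B \<eta> \<longleftrightarrow> incseq \<eta> \<and>
     (\<forall>l. finite {j. \<eta> j = l} \<and>
          enat (card {j. \<eta> j = l}) = steklov_dirichlet_multiplicity \<Omega> F B l)"

section \<open>Riesz means\<close>

text \<open>A sum in \<open>[0, \<infinity>]\<close>, so that a finite upper bound includes convergence.\<close>

definition riesz_mean :: "real \<Rightarrow> real \<Rightarrow> (nat \<Rightarrow> real) \<Rightarrow> ennreal" where
  "riesz_mean \<gamma> z \<eta> = (\<Sum>j. ennreal (max 0 (z - \<eta> j) powr \<gamma>))"

definition riesz_const :: "nat \<Rightarrow> real \<Rightarrow> real" where
  "riesz_const n \<gamma> = 1 / (4 * pi) powr ((real n - 1) / 2) *
     (Gamma (\<gamma> + 1) * Gamma (real n) / (Gamma ((real n + 1) / 2) * Gamma (real n + \<gamma>)))"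

end

theory Submission
  imports Defs
begin

text \<open>
  Let $f_j$ be eigenfunctions whose traces $t_j$ are orthonormal in $L^2(\mathcal F)$; then
  $\int_\Omega |\nabla f_j|^2 = \eta_j$. Enclose \<open>\<Omega>\<close> in $Q \times (-\infty, 0]$ for a cube $Q$ of side
  $2R$ containing \<open>F\<close> in its interior, and let $a_j(\xi) = \int_{\mathcal F} t_j e^{i \xi \cdot x}$
  for $\xi$ in the dual lattice of $Q$.
  Testing $\nabla f_j$ against the gradient of the harmonic function
  $\sum_\xi |Q|^{-1} \overline{a_j(\xi)} e^{i \xi \cdot x + |\xi| x_n}$, whose Dirichlet integral over
  $Q \times (-\infty, 0]$ is explicit, gives $\eta_j \ge |Q|^{-1} \sum_\xi |\xi| |a_j(\xi)|^2$.
  By Parseval the weights $|Q|^{-1} |a_j(\xi)|^2$ have sum 1, so Jensen's inequality for the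
  convex decreasing function $(z - s)_+^\gamma$ and Bessel's inequality
  $\sum_j |a_j(\xi)|^2 \le |\mathcal F|$ yield
  $\sum_j (z - \eta_j)_+^\gamma \le |\mathcal F| |Q|^{-1} \sum_\xi (z - |\xi|)_+^\gamma$. As
  $R \to \infty$ the lattice sum becomes $(2\pi)^{1-n} \int (z - |\xi|)_+^\gamma d\xi$.
\<close>

section \<open>The divergence theorem for fields vanishing on the Dirichlet boundary\<close>

text \<open>Two points shape the proof. The first is integration by parts: the functions concerned
  are limits of functions vanishing on \<open>B\<close>, and such a function times a vector field,
  extended by zero, is continuous in x_n < 0 but in general not differentiable across
  \<open>B\<close>. The identities are therefore proved on lines parallel to the axes, where a slice
  of \<open>\<Omega>\<close> may have infinitely many components. The second is the use of Fourier
  series on a cube: on a compact torus Stone--Weierstrass makes trigonometric polynomials dense, and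
  every test field is a finite sum. The price is that finitely many frequencies carry only mass 1 -
  \<epsilon>. This is why Jensen's inequality enters through supporting lines of nonnegative slope:
  they tolerate a small deficit of mass and need the mean frequency only from above. The
  coefficients of the test field are chosen so that its pairing with the gradient and the bound for
  its own energy are the same number S; then 2 S is at most S plus the energy of the
  eigenfunction.\<close>

lemma countable_simple_zeros:
  fixes v v' :: "real \<Rightarrow> real"
  assumes "\<And>x. (v has_real_derivative v' x) (at x)"
  shows "countable {x. v x = 0 \<and> v' x \<noteq> 0}"
proof -
  let ?S = "{x. v x = 0 \<and> v' x \<noteq> 0}"
  \<comment> \<open>A zero with nonzero derivative is isolated among all zeros of \<open>v\<close>,
    so an interval with rational endpoints singles it out, and there are countably many such
    intervals.\<close>
  have "\<exists>p q. p \<in> \<rat> \<and> q \<in> \<rat> \<and> ?S \<inter> {p<..<q} = {x}" if x: "x \<in> ?S" for x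
  proof -
    have "((\<lambda>y. (v y - v x) / (y - x)) \<longlongrightarrow> v' x) (at x)"
      using assms[of x] by (simp add: has_field_derivative_iff)
    then have "eventually (\<lambda>y. (v y - v x) / (y - x) \<noteq> 0) (at x)"
      using x by (intro tendsto_imp_eventually_ne) auto
    then obtain d where d: "d > 0" "\<And>y. y \<noteq> x \<Longrightarrow> dist y x < d \<Longrightarrow> v y \<noteq> 0"
      using x by (auto simp: eventually_at)
    obtain p q where pq: "p \<in> \<rat>" "x - d < p" "p < x" "q \<in> \<rat>" "x < q" "q < x + d"
      by (meson Rats_dense_in_real diff_less_eq \<open>d > 0\<close> less_add_same_cancel1)
    have "?S \<inter> {p<..<q} = {x}"
    proof
      show "?S \<inter> {p<..<q} \<subseteq> {x}"
      proof
        fix y assume y: "y \<in> ?S \<inter> {p<..<q}"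
        then have "dist y x < d" using pq by (auto simp: dist_real_def abs_if)
        then show "y \<in> {x}" using d(2)[of y] y by auto
      qed
    qed (use x pq in auto)
    then show ?thesis using pq by blast
  qed
  then have ex: "\<exists>I. fst I \<in> \<rat> \<and> snd I \<in> \<rat> \<and> ?S \<inter> {fst I<..<snd I} = {x}"
    if "x \<in> ?S" for x using that by fastforce
  define I where "I x = (SOME I. fst I \<in> \<rat> \<and> snd I \<in> \<rat> \<and> ?S \<inter> {fst I<..<snd I} = {x})" for x
  have I: "fst (I x) \<in> \<rat> \<and> snd (I x) \<in> \<rat> \<and> ?S \<inter> {fst (I x)<..<snd (I x)} = {x}" if "x \<in> ?S" for x
    unfolding I_def by (rule someI_ex) (rule ex[OF that])
  have "inj_on I ?S"
  proof (rule inj_onI)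
    fix x y assume x: "x \<in> ?S" and y: "y \<in> ?S" and "I x = I y"
    then have "{x} = {y}" using I[OF x] I[OF y] by argo
    then show "x = y" by simp
  qed
  moreover have "I ` ?S \<subseteq> \<rat> \<times> \<rat>"
    using I by (simp add: image_subset_iff mem_Times_iff)
  moreover have "countable (\<rat> \<times> \<rat> :: (real \<times> real) set)" by (simp add: countable_rat)
  ultimately show ?thesis by (meson countable_image_inj_on countable_subset)
qed

text \<open>The function \<open>h\<close> need not be differentiable where \<open>v\<close> vanishes. Composing it with
  \<open>s\<^sup>3 / (s\<^sup>2 + \<epsilon>)\<close>, which is flat at 0, repairs this, and \<open>\<epsilon> \<rightarrow> 0\<close> only loses the
  simple zeros of \<open>v\<close>, a countable set.\<close>

lemma has_integral_derivative_restrict: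
  fixes v v' h :: "real \<Rightarrow> real"
  assumes "a \<le> b" and v: "\<And>x. (v has_real_derivative v' x) (at x)"
    and v': "continuous_on UNIV v'" and U: "open U" and h: "continuous_on {a..b} h"
    and hv: "\<And>x. x \<in> {a<..<b} \<Longrightarrow> h x = (if x \<in> U then v x else 0)"
  shows "((\<lambda>x. if x \<in> U then v' x else 0) has_integral (h b - h a)) {a..b}"
proof -
  define \<psi> where "\<psi> e s = s ^ 3 / (s\<^sup>2 + e)" for e s :: real
  define \<psi>' where "\<psi>' e s = s\<^sup>2 * (s\<^sup>2 + 3 * e) / (s\<^sup>2 + e)\<^sup>2" for e s :: real
  have pos: "s\<^sup>2 + e > 0" if "e > 0" for e s :: real
    using that by (simp add: add_nonneg_pos)
  have d\<psi>: "(\<psi> e has_real_derivative \<psi>' e s) (at s)" if "e > 0" for e s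
  proof -
    have ne: "s\<^sup>2 + e \<noteq> 0" using pos[OF that, of s] by simp
    have "((\<lambda>s. s ^ 3 / (s\<^sup>2 + e)) has_real_derivative
        (3 * s\<^sup>2 * (s\<^sup>2 + e) - s ^ 3 * (2 * s)) / ((s\<^sup>2 + e) * (s\<^sup>2 + e))) (at s)"
      by (rule derivative_eq_intros refl ne | simp add: ne)+
    also have "3 * s\<^sup>2 * (s\<^sup>2 + e) - s ^ 3 * (2 * s) = s\<^sup>2 * (s\<^sup>2 + 3 * e)"
      by (simp add: algebra_simps power2_eq_square power3_eq_cube)
    finally show ?thesis by (simp add: \<psi>_def[abs_def] \<psi>'_def power2_eq_square)
  qed
  \<comment> \<open>The bound is independent of \<open>e\<close>, which gives the majorant for
    dominated convergence as \<open>e\<close> tends to 0.\<close>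
  have \<psi>'_bound: "\<bar>\<psi>' e s\<bar> \<le> 3" if "e > 0" for e s
  proof -
    have "3 * (s\<^sup>2 + e)\<^sup>2 - s\<^sup>2 * (s\<^sup>2 + 3 * e) = 2 * (s\<^sup>2)\<^sup>2 + 3 * e * s\<^sup>2 + 3 * e\<^sup>2" by algebra
    moreover have "\<dots> \<ge> 0" using that by simp
    moreover have "(s\<^sup>2 + e)\<^sup>2 > 0" using pos[OF that, of s] by (intro zero_less_power)
    ultimately have "\<psi>' e s \<le> 3" unfolding \<psi>'_def
      by (subst pos_divide_le_eq) linarith+
    moreover have "\<psi>' e s \<ge> 0" using that by (simp add: \<psi>'_def)
    ultimately show ?thesis by simp
  qed
  define D where "D e x = (if x \<in> U then \<psi>' e (v x) * v' x else 0)" for e x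
  have ch: "isCont h x" if "x \<in> {a<..<b}" for x
    using continuous_on_interior[OF h] that by simp
  have cv: "isCont v x" for x using v DERIV_isCont by blast
  have near: "eventually (\<lambda>y. y \<in> {a<..<b}) (nhds x)" if "x \<in> {a<..<b}" for x
    using that eventually_nhds_in_open open_greaterThanLessThan by blast
  have der: "((\<lambda>x. \<psi> e (h x)) has_real_derivative D e x) (at x)" 
    if e: "e > 0" and x: "x \<in> {a<..<b}" for e x
  proof (cases "v x = 0")
    case True
    have hx: "h x = 0" using hv[OF x] True by auto
    have D0: "D e x = 0" using True by (simp add: D_def \<psi>'_def)
    \<comment> \<open>\<open>\<psi> e\<close> is cubic at 0, and \<open>h y\<close> is
      \<open>v y\<close> or 0 whatever \<open>U\<close> looks like near \<open>x\<close>. Hence the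
      difference quotient is at most that of \<open>v\<close> times
      \<open>(v y)\<^sup>2 / e\<close>, which tends to 0.\<close>
    have "\<bar>\<psi> e s\<bar> \<le> \<bar>s\<bar> * (s\<^sup>2 / e)" for s
    proof -
      have "\<bar>\<psi> e s\<bar> = \<bar>s\<bar> * s\<^sup>2 / (s\<^sup>2 + e)"
        using pos[OF e, of s] by (simp add: \<psi>_def power3_eq_cube power2_eq_square abs_mult)
      also have "\<dots> \<le> \<bar>s\<bar> * s\<^sup>2 / e" using e by (intro divide_left_mono) (auto intro: mult_pos_pos pos)
      finally show ?thesis by simp
    qed
    note \<psi>b = this
    have lim: "((\<lambda>y. \<bar>(v y - v x) / (y - x)\<bar> * ((v y)\<^sup>2 / e)) \<longlongrightarrow> \<bar>v' x\<bar> * ((v x)\<^sup>2 / e)) (at x)"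
      by (intro tendsto_intros v[unfolded has_field_derivative_iff] cv[unfolded isCont_def]) (use e in auto)
    have "((\<lambda>y. (\<psi> e (h y) - \<psi> e (h x)) / (y - x)) \<longlongrightarrow> 0) (at x)"
    proof (rule Lim_null_comparison)
      show "eventually (\<lambda>y. norm ((\<psi> e (h y) - \<psi> e (h x)) / (y - x)) \<le> \<bar>(v y - v x) / (y - x)\<bar> * ((v y)\<^sup>2 / e)) (at x)"
        using near[OF x] unfolding eventually_at_filter
      proof eventually_elim
        case (elim y)
        have "\<bar>h y\<bar> * ((h y)\<^sup>2 / e) \<le> \<bar>v y\<bar> * ((v y)\<^sup>2 / e)" using hv[OF elim] e by auto
        then have "\<bar>\<psi> e (h y)\<bar> \<le> \<bar>v y\<bar> * ((v y)\<^sup>2 / e)" using \<psi>b[of "h y"] by linarith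
        then have "\<bar>\<psi> e (h y)\<bar> / \<bar>y - x\<bar> \<le> \<bar>v y\<bar> * ((v y)\<^sup>2 / e) / \<bar>y - x\<bar>"
          by (rule divide_right_mono) simp
        moreover have "\<psi> e (h x) = 0" by (simp add: hx \<psi>_def)
          ultimately show ?case by (simp add: True mult.commute)
      qed
      show "((\<lambda>y. \<bar>(v y - v x) / (y - x)\<bar> * ((v y)\<^sup>2 / e)) \<longlongrightarrow> 0) (at x)"
        using lim True by simp
    qed
    then show ?thesis by (simp add: has_field_derivative_iff D0)
  next
    case False
    show ?thesis
    proof (cases "x \<in> U")
      case True
      have 1: "((\<lambda>y. \<psi> e (v y)) has_real_derivative \<psi>' e (v x) * v' x) (at x)"
        by (rule DERIV_chain2[OF d\<psi>[OF e] v])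
      have "eventually (\<lambda>y. y \<in> U) (nhds x)" using U True eventually_nhds_in_open by blast
      with near[OF x] have "eventually (\<lambda>y. \<psi> e (h y) = \<psi> e (v y)) (nhds x)"
        by eventually_elim (simp add: hv)
      then show ?thesis using 1 True by (subst DERIV_cong_ev[OF refl]) (auto simp: D_def)
    next
      \<comment> \<open>Near \<open>x\<close> each value of \<open>h\<close> is that of
        \<open>v\<close> or 0; since \<open>h\<close> is continuous with \<open>h x = 0\<close>
        while \<open>v x\<close> is nonzero, only the value 0 remains.\<close>
      case nU: False
      have hx: "h x = 0" using hv[OF x] nU by simp
      have "((\<lambda>y. \<bar>h y\<bar> - \<bar>v y\<bar>) \<longlongrightarrow> \<bar>h x\<bar> - \<bar>v x\<bar>) (nhds x)"
        using ch[OF x] cv[of x] by (intro tendsto_intros) (auto simp: continuous_within tendsto_at_iff_tendsto_nhds)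
      then have "eventually (\<lambda>y. \<bar>h y\<bar> - \<bar>v y\<bar> < 0) (nhds x)"
        using hx False by (intro order_tendstoD) auto
      with near[OF x] have "eventually (\<lambda>y. \<psi> e (h y) = 0) (nhds x)"
        by eventually_elim (auto simp: hv \<psi>_def split: if_splits)
      then have "((\<lambda>x. \<psi> e (h x)) has_real_derivative 0) (at x)"
        by (subst DERIV_cong_ev[OF refl]) auto
      then show ?thesis using nU by (simp add: D_def)
    qed
  qed
  define I where "I k = \<psi> (1 / Suc k) (h b) - \<psi> (1 / Suc k) (h a)" for k :: nat
  have int: "(D (1 / Suc k) has_integral I k) {a..b}" for k :: nat
    unfolding I_def
  proof (rule fundamental_theorem_of_calculus_interior)
    show "continuous_on {a..b} (\<lambda>x. \<psi> (1 / Suc k) (h x))"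
      unfolding \<psi>_def using pos[of "1 / Suc k"] by (intro continuous_intros h) (auto simp: less_imp_neq[symmetric])
    fix x assume "x \<in> {a<..<b}"
    then show "((\<lambda>x. \<psi> (1 / Suc k) (h x)) has_vector_derivative D (1 / Suc k) x) (at x)"
      using der[of "1 / Suc k" x] by (simp add: has_real_derivative_iff_has_vector_derivative)
  qed (use \<open>a \<le> b\<close> in simp)
  have "bounded (v' ` {a..b})"
    by (intro compact_imp_bounded compact_continuous_image continuous_on_subset[OF v']) auto
  then obtain M where M: "\<And>x. x \<in> {a..b} \<Longrightarrow> \<bar>v' x\<bar> \<le> M" unfolding bounded_iff by force
  have \<psi>lim: "(\<lambda>k. \<psi> (1 / Suc k) s) \<longlonglongrightarrow> s" for s
  proof (cases "s = 0")
    case False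
    have "(\<lambda>k. s ^ 3 / (s\<^sup>2 + 1 / Suc k)) \<longlonglongrightarrow> s ^ 3 / (s\<^sup>2 + 0)"
      using False by (intro tendsto_intros LIMSEQ_Suc lim_1_over_n) auto
    then show ?thesis using False by (simp add: \<psi>_def power3_eq_cube power2_eq_square)
  qed (simp add: \<psi>_def)
  have \<psi>'lim: "(\<lambda>k. \<psi>' (1 / Suc k) s) \<longlonglongrightarrow> (if s = 0 then 0 else 1)" for s
  proof (cases "s = 0")
    case False
    have "(\<lambda>k. s\<^sup>2 * (s\<^sup>2 + 3 * (1 / Suc k)) / (s\<^sup>2 + 1 / Suc k)\<^sup>2) \<longlonglongrightarrow> s\<^sup>2 * (s\<^sup>2 + 3 * 0) / (s\<^sup>2 + 0)\<^sup>2"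
      using False by (intro tendsto_intros LIMSEQ_Suc lim_1_over_n) auto
    then show ?thesis using False by (simp add: \<psi>'_def power2_eq_square)
  qed (simp add: \<psi>'_def)
  define G where "G x = (if x \<in> U \<and> v x \<noteq> 0 then v' x else 0)" for x
  have lim: "(\<lambda>k. D (1 / Suc k) x) \<longlonglongrightarrow> G x" for x
  proof (cases "x \<in> U")
    case True
    then show ?thesis using tendsto_mult[OF \<psi>'lim[of "v x"] tendsto_const[of "v' x"]]
      by (auto simp: D_def G_def)
  qed (simp add: D_def G_def)
  have bd: "norm (D (1 / Suc k) x) \<le> 3 * M" if "x \<in> {a..b}" for k x
    using M[OF that] \<psi>'_bound[of "1 / Suc k" "v x"]
    by (auto simp: D_def abs_mult intro!: mult_mono order_trans[OF _ M[OF that]])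
  have G: "G integrable_on {a..b}" "(\<lambda>k. integral {a..b} (D (1 / Suc k))) \<longlonglongrightarrow> integral {a..b} G"
    using dominated_convergence[of "\<lambda>k. D (1 / Suc k)" "{a..b}" "\<lambda>_. 3 * M" G] int bd lim
    by (auto simp: has_integral_integrable_integral)
  have "(\<lambda>k. integral {a..b} (D (1 / Suc k))) \<longlonglongrightarrow> h b - h a"
    using tendsto_diff[OF \<psi>lim[of "h b"] \<psi>lim[of "h a"]] by (simp only: integral_unique[OF int] I_def)
  with G have "(G has_integral (h b - h a)) {a..b}"
    using LIMSEQ_unique by (metis integrable_integral)
  moreover have "negligible {x. v x = 0 \<and> v' x \<noteq> 0}"
    using countable_simple_zeros[OF v] 
    by (simp add: negligible_iff_null_sets countable_imp_null_set_lborel null_sets_completionI)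
  ultimately show ?thesis
    by (rule has_integral_spike[rotated 2]) (auto simp: G_def)
qed

text \<open>Gluing along the two relatively closed pieces \<open>S \<inter> closure \<Omega>\<close>
  and \<open>S - \<Omega>\<close>: they overlap only in the frontier, where both formulas give
  0.\<close>

lemma continuous_on_restrict_vanishing_frontier:
  fixes V :: "'a::euclidean_space \<Rightarrow> real"
  assumes "open \<Omega>" "continuous_on UNIV V" "\<And>x. x \<in> frontier \<Omega> \<inter> S \<Longrightarrow> V x = 0"
  shows "continuous_on S (\<lambda>x. if x \<in> \<Omega> then V x else 0)"
proof -
  have S: "S = (S \<inter> closure \<Omega>) \<union> (S - \<Omega>)" using closure_subset[of \<Omega>] by auto
  have cl: "closedin (top_of_set S) (S \<inter> closure \<Omega>)" "closedin (top_of_set S) (S - \<Omega>)"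
    using \<open>open \<Omega>\<close> by (auto simp: closedin_closed_Int Diff_eq closed_Compl)
  have "continuous_on ((S \<inter> closure \<Omega>) \<union> (S - \<Omega>)) (\<lambda>x. if x \<in> \<Omega> then V x else 0)"
  proof (rule continuous_on_cases_local)
    show "continuous_on (S \<inter> closure \<Omega>) V" using assms(2) continuous_on_subset by blast
    fix x assume "x \<in> S \<inter> closure \<Omega> \<and> x \<notin> \<Omega> \<or> x \<in> S - \<Omega> \<and> x \<in> \<Omega>"
    then have "x \<in> frontier \<Omega> \<inter> S" using \<open>open \<Omega>\<close> by (auto simp: frontier_def interior_open)
    then show "V x = 0" by (rule assms(3))
  qed (use cl S in auto)
  then show ?thesis using S by simp
qed

section \<open>Integrability on bounded sets, and passage between \<open>lebesgue_on\<close> and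
  \<open>lborel\<close>\<close>

lemma integrable_bounded_support:
  fixes f :: "'a::euclidean_space \<Rightarrow> 'b::{banach, second_countable_topology}"
  assumes "f \<in> borel_measurable borel" "bounded S" "\<And>x. x \<notin> S \<Longrightarrow> f x = 0" "\<And>x. norm (f x) \<le> M"
  shows "integrable lborel f"
proof -
  obtain r where r: "\<And>x. x \<in> S \<Longrightarrow> norm x \<le> r" using \<open>bounded S\<close> unfolding bounded_iff by blast
  show ?thesis
  proof (rule integrableI_bounded_set[where A = "cball 0 r" and B = M])
    show "emeasure lborel (cball (0::'a) r) < \<infinity>" by (rule emeasure_bounded_finite) simp
    show "AE x in lborel. x \<in> cball 0 r \<longrightarrow> norm (f x) \<le> M" using assms(4) by simp
    have "x \<notin> cball 0 r \<longrightarrow> f x = 0" for x using r[of x] assms(3)[of x] by auto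
    then show "AE x in lborel. x \<notin> cball 0 r \<longrightarrow> f x = 0" by simp
  qed (use assms in auto)
qed

text \<open>The problem is posed with \<open>lebesgue_on\<close>, while Fubini and translation
  invariance are applied to \<open>lborel\<close>; for Borel functions completion does not change
  the integral.\<close>

lemma integral_lebesgue_on_eq_lborel:
  fixes f :: "'a::euclidean_space \<Rightarrow> 'b::euclidean_space"
  assumes "S \<in> sets borel" "f \<in> borel_measurable borel"
  shows "(\<integral>x. f x \<partial>lebesgue_on S) = (\<integral>x. indicator S x *\<^sub>R f x \<partial>lborel)"
proof -
  have "(\<integral>x. f x \<partial>lebesgue_on S) = (\<integral>x. indicator S x *\<^sub>R f x \<partial>lebesgue)"
    using assms by (subst integral_restrict_space) auto
  also have "\<dots> = (\<integral>x. indicator S x *\<^sub>R f x \<partial>lborel)"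
    using assms by (intro integral_completion) auto
  finally show ?thesis .
qed

lemma integrable_lebesgue_on_iff_lborel:
  fixes f :: "'a::euclidean_space \<Rightarrow> 'b::euclidean_space"
  assumes "S \<in> sets borel" "f \<in> borel_measurable borel"
  shows "integrable (lebesgue_on S) f \<longleftrightarrow> integrable lborel (\<lambda>x. indicator S x *\<^sub>R f x)"
proof -
  have "integrable (lebesgue_on S) f \<longleftrightarrow> integrable lebesgue (\<lambda>x. indicator S x *\<^sub>R f x)"
    using assms by (subst integrable_restrict_space) auto
  also have "\<dots> \<longleftrightarrow> integrable lborel (\<lambda>x. indicator S x *\<^sub>R f x)"
    using assms by (intro integrable_completion) auto
  finally show ?thesis .
qed

lemma continuous_bounded_on_bounded:
  fixes f :: "'a::euclidean_space \<Rightarrow> 'b::euclidean_space"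
  assumes "bounded S" "continuous_on UNIV f"
  obtains M where "M \<ge> 0" "\<And>x. x \<in> S \<Longrightarrow> norm (f x) \<le> M"
proof -
  have "bounded (f ` closure S)"
    using assms by (intro compact_imp_bounded compact_continuous_image) (auto intro: continuous_on_subset)
  then obtain M where "\<forall>x\<in>f ` closure S. norm x \<le> M" "M > 0" unfolding bounded_pos by blast
  then show thesis using closure_subset[of S] by (intro that[of M]) auto
qed

lemma lborel_integral_translate:
  fixes f :: "'a::euclidean_space \<Rightarrow> real"
  assumes "f \<in> borel_measurable borel"
  shows "(\<integral>x. f (x + c) \<partial>lborel) = (\<integral>x. f x \<partial>lborel)"
proof -
  have "(\<integral>x. f x \<partial>lborel) = (\<integral>x. f x \<partial>distr lborel borel ((+) c))" by (simp add: lborel_distr_plus)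
  also have "\<dots> = (\<integral>x. f (c + x) \<partial>lborel)" using assms by (subst integral_distr) auto
  finally show ?thesis by (simp add: add.commute)
qed

text \<open>Averaging over the translations by \<open>s *\<^sub>R e\<close>, \<open>0 \<le> s \<le> 1\<close>, turns the integral of the
  derivative into that of a difference of two translates.\<close>

lemma integral_directional_derivative_eq_0:
  fixes V V' :: "'a::euclidean_space \<Rightarrow> real"
  assumes \<Omega>: "open \<Omega>" "bounded \<Omega>" "\<Omega> \<subseteq> S" and S: "\<And>x s. x \<in> S \<Longrightarrow> x + s *\<^sub>R e \<in> S"
    and V: "continuous_on UNIV V" "continuous_on UNIV V'"
    and der: "\<And>x s. ((\<lambda>s. V (x + s *\<^sub>R e)) has_real_derivative V' (x + s *\<^sub>R e)) (at s)"
    and fr: "\<And>x. x \<in> frontier \<Omega> \<inter> S \<Longrightarrow> V x = 0"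
  shows "(\<integral>x. V' x \<partial>lebesgue_on \<Omega>) = 0"
proof -
  define h where "h x = (if x \<in> \<Omega> then V x else 0)" for x
  define D where "D x = (if x \<in> \<Omega> then V' x else 0)" for x
  have [measurable]: "\<Omega> \<in> sets borel" using \<Omega> by simp
  have [measurable]: "V \<in> borel_measurable borel" "V' \<in> borel_measurable borel"
    using V by (auto intro: borel_measurable_continuous_onI)
  have hm [measurable]: "h \<in> borel_measurable borel" and Dm [measurable]: "D \<in> borel_measurable borel"
    unfolding h_def D_def by measurable
  obtain M where M: "M \<ge> 0" "\<And>x. x \<in> \<Omega> \<Longrightarrow> norm (V x) \<le> M"
    using continuous_bounded_on_bounded[OF \<Omega>(2) V(1)] by blast
  obtain M' where M': "M' \<ge> 0" "\<And>x. x \<in> \<Omega> \<Longrightarrow> norm (V' x) \<le> M'"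
    using continuous_bounded_on_bounded[OF \<Omega>(2) V(2)] by blast
  have hi: "integrable lborel h"
    by (rule integrable_bounded_support[OF hm \<Omega>(2), of M]) (use M in \<open>auto simp: h_def\<close>)
  have hi': "integrable lborel (\<lambda>x. h (x + e))"
  proof (rule integrable_bounded_support[of _ "(\<lambda>x. x - e) ` \<Omega>" M])
    show "bounded ((\<lambda>x. x - e) ` \<Omega>)" using \<Omega>(2) by (rule bounded_translation_minus)
    fix x show "x \<notin> (\<lambda>x. x - e) ` \<Omega> \<Longrightarrow> h (x + e) = 0"
      unfolding h_def by (auto simp: image_iff)
  qed (use M in \<open>auto simp: h_def\<close>)
  \<comment> \<open>\<open>S\<close> is a union of lines parallel to \<open>e\<close>: a line either
    lies in \<open>S\<close>, where \<open>h\<close> is continuous, or misses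
    \<open>\<Omega>\<close> altogether.\<close>
  have slice: "(\<integral>s. indicator {0..1} s * D (x + s *\<^sub>R e) \<partial>lborel) = h (x + e) - h x" for x
  proof -
    have "((\<lambda>s. D (x + s *\<^sub>R e)) has_integral h (x + e) - h x) {0..1}" (is ?I)
    proof (cases "x \<in> S")
      case True
      define U where "U = {s. x + s *\<^sub>R e \<in> \<Omega>}"
      have "open U" unfolding U_def
        using \<Omega>(1) by (intro open_vimage[of \<Omega> "\<lambda>s. x + s *\<^sub>R e", unfolded vimage_def]) (auto intro!: continuous_intros)
      have hS: "continuous_on S h" unfolding h_def
        by (rule continuous_on_restrict_vanishing_frontier[OF \<Omega>(1) V(1) fr])
      have "((\<lambda>s. if s \<in> U then V' (x + s *\<^sub>R e) else 0) has_integral h (x + 1 *\<^sub>R e) - h (x + 0 *\<^sub>R e)) {0..1}"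
      proof (rule has_integral_derivative_restrict[OF _ der])
        show "continuous_on UNIV (\<lambda>s. V' (x + s *\<^sub>R e))"
          by (rule continuous_on_compose2[OF V(2)]) (auto intro!: continuous_intros)
        show "continuous_on {0..1} (\<lambda>s. h (x + s *\<^sub>R e))"
          by (rule continuous_on_compose2[OF hS]) (use S True in \<open>auto intro!: continuous_intros\<close>)
      qed (use \<open>open U\<close> in \<open>auto simp: U_def h_def\<close>)
      then show ?thesis by (simp add: U_def D_def)
    next
      case False
      have "x + s *\<^sub>R e \<notin> \<Omega>" for s
        using False S[of "x + s *\<^sub>R e" "- s"] \<Omega>(3) by auto
      from this this[of 0] this[of 1] show ?thesis by (simp add: D_def h_def)
    qed
    have "integrable lborel (\<lambda>s. indicator {0..1} s * D (x + s *\<^sub>R e))"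
      by (rule integrable_bounded_support[of _ "{0..1}" M']) (use M' in \<open>auto simp: D_def indicator_def\<close>)
    then have "((\<lambda>s. indicator {0..1} s * D (x + s *\<^sub>R e)) has_integral (\<integral>s. indicator {0..1} s * D (x + s *\<^sub>R e) \<partial>lborel)) UNIV"
      by (rule has_integral_integral_lborel)
    moreover have "(\<lambda>s. indicator {0..1} s * D (x + s *\<^sub>R e)) = (\<lambda>s. if s \<in> {0..1} then D (x + s *\<^sub>R e) else 0)"
      by (auto simp: indicator_def)
    ultimately have "((\<lambda>s. D (x + s *\<^sub>R e)) has_integral (\<integral>s. indicator {0..1} s * D (x + s *\<^sub>R e) \<partial>lborel)) {0..1}"
      by (simp only: has_integral_restrict_UNIV)
    with \<open>?I\<close> show ?thesis using has_integral_unique by blast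
  qed
  obtain r where r: "\<And>x. x \<in> \<Omega> \<Longrightarrow> norm x \<le> r" using \<Omega>(2) bounded_iff by metis
  \<comment> \<open>Translations by at most \<open>norm e\<close> keep the support in the ball of
    radius \<open>r + norm e\<close>, which gives the joint integrability needed for Fubini.\<close>
  have "integrable lborel (\<lambda>p. indicator {0..1} (snd p) * D (fst p + snd p *\<^sub>R e))"
  proof (rule integrable_bounded_support[of _ "cball 0 (r + norm e) \<times> {0..1}" M'])
    show "bounded (cball 0 (r + norm e) \<times> {0..1::real} :: ('a \<times> real) set)" by (intro bounded_Times) auto
    show "(\<lambda>p. indicator {0..1} (snd p) * D (fst p + snd p *\<^sub>R e)) \<in> borel_measurable borel"
      unfolding borel_prod[symmetric] by measurable
    fix p :: "'a \<times> real" assume p: "p \<notin> cball 0 (r + norm e) \<times> {0..1}"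
    show "indicator {0..1} (snd p) * D (fst p + snd p *\<^sub>R e) = 0"
    proof (cases "snd p \<in> {0..1}")
      case True
      then have n: "norm (fst p) > r + norm e" using p by (auto simp: mem_Times_iff)
      have "norm (snd p *\<^sub>R e) \<le> norm e" using True by (auto intro: mult_left_le_one_le)
      then have "norm (fst p + snd p *\<^sub>R e) > r" using n norm_diff_ineq[of "fst p" "snd p *\<^sub>R e"] by linarith
      then show ?thesis using r by (force simp: D_def)
    qed simp
  qed (use M' in \<open>auto simp: D_def indicator_def\<close>)
  then have int: "integrable (lborel \<Otimes>\<^sub>M lborel) (\<lambda>(x, s). indicator {0..1} s * D (x + s *\<^sub>R e))"
    by (simp add: lborel_prod case_prod_unfold)
  have "(\<integral>x. D x \<partial>lborel) = (\<integral>s. indicator {0..1::real} s * (\<integral>x. D x \<partial>lborel) \<partial>lborel)"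
    by simp
  also have "\<dots> = (\<integral>s. (\<integral>x. indicator {0..1} s * D (x + s *\<^sub>R e) \<partial>lborel) \<partial>lborel)"
    by (simp add: lborel_integral_translate)
  also have "\<dots> = (\<integral>x. (\<integral>s. indicator {0..1} s * D (x + s *\<^sub>R e) \<partial>lborel) \<partial>lborel)"
    by (rule lborel_pair.Fubini_integral[OF int])
  also have "\<dots> = (\<integral>x. h (x + e) - h x \<partial>lborel)" by (simp add: slice)
  also have "\<dots> = 0" using hi hi' by (simp add: lborel_integral_translate)
  finally have "(\<integral>x. D x \<partial>lborel) = 0" .
  moreover have "(\<lambda>x. indicator \<Omega> x *\<^sub>R V' x) = D" by (auto simp: D_def)
  ultimately show ?thesis by (subst integral_lebesgue_on_eq_lborel) auto
qed

text \<open>On each vertical line the extension of \<open>V\<close> by zero is continuous up to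
  height 0 once it is given the trace there, so the fundamental theorem leaves only the value at the
  top. \<open>F1\<close> excludes a jump at height 0 where the trace is nonzero.\<close>

lemma integral_vertical_derivative:
  fixes V V' :: "'a::euclidean_space \<times> real \<Rightarrow> real"
  assumes \<Omega>: "open \<Omega>" "bounded \<Omega>" "\<Omega> \<subseteq> {x. snd x < 0}" and F: "F \<in> sets borel"
    and V: "continuous_on UNIV V" "continuous_on UNIV V'"
    and der: "\<And>x s. ((\<lambda>s. V (x, s)) has_real_derivative V' (x, s)) (at s)"
    and fr: "\<And>x. x \<in> frontier \<Omega> \<Longrightarrow> snd x < 0 \<Longrightarrow> V x = 0"
    and F0: "\<And>x. x \<notin> F \<Longrightarrow> (x, 0) \<notin> closure \<Omega>"
    and F1: "\<And>x. x \<in> F \<Longrightarrow> V (x, 0) \<noteq> 0 \<Longrightarrow> \<exists>\<delta>>0. ball (x, 0) \<delta> \<inter> {y. snd y < 0} \<subseteq> \<Omega>"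
  shows "(\<integral>x. V' x \<partial>lebesgue_on \<Omega>) = (\<integral>x. V (x, 0) \<partial>lebesgue_on F)"
proof -
  define D where "D x = (if x \<in> \<Omega> then V' x else 0)" for x
  have [measurable]: "\<Omega> \<in> sets borel" using \<Omega> by simp
  have V'm [measurable]: "V' \<in> borel_measurable borel"
    using V by (auto intro: borel_measurable_continuous_onI)
  have Dm [measurable]: "D \<in> borel_measurable borel"
    unfolding D_def by measurable
  obtain M' where M': "M' \<ge> 0" "\<And>x. x \<in> \<Omega> \<Longrightarrow> norm (V' x) \<le> M'"
    using continuous_bounded_on_bounded[OF \<Omega>(2) V(2)] by blast
  obtain r where r: "r > 0" "\<And>x. x \<in> \<Omega> \<Longrightarrow> norm x \<le> r" using \<Omega>(2) bounded_pos by metis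
  have low: "\<bar>s\<bar> \<le> r" if "(x, s) \<in> \<Omega>" for x s
    using r(2)[OF that] norm_snd_le[of s x] by simp
  \<comment> \<open>Strictly below \<open>\<Omega>\<close>, so that the lower boundary term
    \<open>h c\<close> is 0.\<close>
  define c where "c = - r - 1"
  have slice: "(\<integral>s. D (x, s) \<partial>lborel) = (if x \<in> F then V (x, 0) else 0)" for x
  proof -
    define U where "U = {s. (x, s) \<in> \<Omega>}"
    have oU: "open U" unfolding U_def
      using \<Omega>(1) by (intro open_vimage[of \<Omega> "\<lambda>s. (x, s)", unfolded vimage_def]) (auto intro!: continuous_intros)
    have U0: "s < 0" "s > c" if "s \<in> U" for s using that \<Omega>(3) low by (force simp: U_def c_def)+
    \<comment> \<open>Height 0 lies outside \<open>U\<close>, so the value there is prescribed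
      separately, as the expected one-sided limit.\<close>
    define h where "h s = (if s = 0 then (if x \<in> F then V (x, 0) else 0) else if s \<in> U then V (x, s) else 0)" for s
    have cVs: "continuous_on UNIV (\<lambda>s. V (x, s))"
      by (rule continuous_on_compose2[OF V(1)]) (auto intro!: continuous_intros)
    have "((\<lambda>s. if s \<in> U then V' (x, s) else 0) has_integral h 0 - h c) {c..0}"
    proof (rule has_integral_derivative_restrict[OF _ der _ oU])
      show "continuous_on UNIV (\<lambda>s. V' (x, s))"
        by (rule continuous_on_compose2[OF V(2)]) (auto intro!: continuous_intros)
      have "continuous_on {x. snd x < 0} (\<lambda>p. if p \<in> \<Omega> then V p else 0)"
        by (rule continuous_on_restrict_vanishing_frontier[OF \<Omega>(1) V(1)]) (use fr in auto)
      then have "continuous_on {..<0} (\<lambda>s. if (x, s) \<in> \<Omega> then V (x, s) else 0)"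
        by (rule continuous_on_compose2) (auto intro!: continuous_intros)
      then have "continuous_on {..<0} h"
        by (rule continuous_on_eq) (auto simp: h_def U_def)
      then have neg: "isCont h s" if "s < 0" for s
        using that by (auto simp: continuous_on_eq_continuous_at)
      have Vlim: "((\<lambda>s. V (x, s)) \<longlongrightarrow> V (x, 0)) (at 0 within {c..0})"
        using cVs by (auto simp: continuous_on_def intro: tendsto_within_subset)
      have bnd: "eventually (\<lambda>s. s \<in> {c..0} \<and> s \<noteq> 0) (at 0 within {c..0})"
        by (auto simp: eventually_at_filter)
      \<comment> \<open>Off \<open>F\<close> the points just below height 0 are outside
        \<open>\<Omega>\<close>; where the trace vanishes, \<open>h\<close> is squeezed by the
        absolute value of \<open>V\<close>; elsewhere \<open>F1\<close> puts the end of the slice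
        inside \<open>\<Omega>\<close>, so that \<open>h\<close> agrees with
        \<open>V\<close>.\<close>
      have zero: "(h \<longlongrightarrow> h 0) (at 0 within {c..0})"
      proof (cases "x \<in> F")
        case False
        then have "(x, 0) \<in> - closure \<Omega>" using F0 by auto
        then obtain \<delta> where \<delta>: "\<delta> > 0" "ball (x, 0) \<delta> \<subseteq> - closure \<Omega>"
          using open_contains_ball[of "- closure \<Omega>"] by auto
        have "eventually (\<lambda>s. dist s 0 < \<delta>) (at 0 within {c..0})"
          using \<delta>(1) by (auto simp: eventually_at)
        then have "eventually (\<lambda>s. h s = h 0) (at 0 within {c..0})"
        proof eventually_elim
          case (elim s)
          then have "(x, s) \<in> ball (x, 0) \<delta>" by (simp add: dist_Pair_Pair dist_commute)
          then have "s \<notin> U" using \<delta>(2) closure_subset[of \<Omega>] by (auto simp: U_def)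
          then show ?case using False by (simp add: h_def)
        qed
        then show ?thesis by (rule tendsto_eventually)
      next
        case True
        show ?thesis
        proof (cases "V (x, 0) = 0")
          case z: True
          have "(h \<longlongrightarrow> 0) (at 0 within {c..0})"
            by (rule tendsto_rabs_zero_cancel, rule tendsto_sandwich[OF _ _ tendsto_const])
               (use tendsto_rabs[OF Vlim] z True in \<open>auto simp: h_def\<close>)
          then show ?thesis using z by (simp add: h_def)
        next
          case False
          then obtain \<delta> where \<delta>: "\<delta> > 0" "ball (x, 0) \<delta> \<inter> {y. snd y < 0} \<subseteq> \<Omega>"
            using F1 True by blast
          have "eventually (\<lambda>s. dist s 0 < \<delta>) (at 0 within {c..0})"
            using \<delta>(1) by (auto simp: eventually_at)
          with bnd have "eventually (\<lambda>s. V (x, s) = h s) (at 0 within {c..0})"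
          proof eventually_elim
            case (elim s)
            then have "(x, s) \<in> ball (x, 0) \<delta>" by (simp add: dist_Pair_Pair dist_commute)
            then have "s \<in> U" using \<delta>(2) elim by (auto simp: U_def)
            then show ?case using elim by (simp add: h_def)
          qed
          then have "(h \<longlongrightarrow> V (x, 0)) (at 0 within {c..0})"
            by (rule Lim_transform_eventually[OF Vlim])
          then show ?thesis using True by (simp add: h_def)
        qed
      qed
      show "continuous_on {c..0} h"
        unfolding continuous_on_def
      proof
        fix s assume "s \<in> {c..0}"
        then consider "s < 0" | "s = 0" by force
        then show "(h \<longlongrightarrow> h s) (at s within {c..0})"
          by cases (use zero neg[of s] in \<open>auto simp: isCont_def intro: tendsto_within_subset\<close>)
      qed
    qed (use r in \<open>auto simp: h_def c_def\<close>)
    moreover have "h c = 0" using r U0(2)[of c] by (auto simp: h_def c_def)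
    ultimately have "((\<lambda>s. D (x, s)) has_integral h 0) {c..0}" by (simp add: D_def U_def)
    then have "((\<lambda>s. D (x, s)) has_integral h 0) UNIV"
      by (rule has_integral_on_superset) (use U0 in \<open>auto simp: D_def U_def, (meson less_imp_le)+\<close>)
    moreover have "integrable lborel (\<lambda>s. D (x, s))"
    proof (rule integrable_bounded_support[of _ "{c..0}" M'])
      fix s show "s \<notin> {c..0} \<Longrightarrow> D (x, s) = 0" using U0[of s] by (auto simp: D_def U_def)
    qed (use M' in \<open>auto simp: D_def\<close>)
    ultimately have "(\<integral>s. D (x, s) \<partial>lborel) = h 0"
      using has_integral_integral_lborel has_integral_unique by blast
    then show ?thesis by (simp add: h_def)
  qed
  have Dint: "integrable lborel D"
    by (rule integrable_bounded_support[OF Dm \<Omega>(2), of M']) (use M' in \<open>auto simp: D_def\<close>)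
  have "(\<integral>x. V' x \<partial>lebesgue_on \<Omega>) = (\<integral>p. D p \<partial>lborel)"
    by (subst integral_lebesgue_on_eq_lborel) (auto simp: D_def intro!: Bochner_Integration.integral_cong)
  also have "\<dots> = (\<integral>x. (\<integral>s. D (x, s) \<partial>lborel) \<partial>lborel)"
    using Dint lborel_pair.integral_fst'[of D] by (simp add: lborel_prod)
  also have "\<dots> = (\<integral>x. indicator F x *\<^sub>R V (x, 0) \<partial>lborel)"
    by (auto simp: slice intro!: Bochner_Integration.integral_cong)
  also have "\<dots> = (\<integral>x. V (x, 0) \<partial>lebesgue_on F)"
  proof (rule integral_lebesgue_on_eq_lborel[symmetric, OF F])
    show "(\<lambda>x. V (x, 0)) \<in> borel_measurable borel"
      by (intro borel_measurable_continuous_onI continuous_on_compose2[OF V(1)]) (auto intro!: continuous_intros)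
  qed
  finally show ?thesis .
qed


text \<open>A lower half ball on which \<open>\<phi>\<close> is nonzero contains no frontier point,
  yet meets \<open>\<Omega>\<close> because its centre is in the closure. Being connected, it lies
  in \<open>\<Omega>\<close>.\<close>

lemma half_ball_subset:
  fixes \<Omega> :: "('a::euclidean_space \<times> real) set"
  assumes \<Omega>: "\<Omega> \<subseteq> {x. snd x < 0}" "(x, 0) \<in> closure \<Omega>" and \<phi>: "continuous_on UNIV (\<phi> :: _ \<Rightarrow> real)"
    and fr: "\<And>y. y \<in> frontier \<Omega> \<Longrightarrow> snd y < 0 \<Longrightarrow> \<phi> y = 0" and nz: "\<phi> (x, 0) \<noteq> 0"
  obtains \<delta> where "\<delta> > 0" "ball (x, 0) \<delta> \<inter> {y. snd y < 0} \<subseteq> \<Omega>"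
proof -
  have "open {y. \<phi> y \<noteq> 0}" using \<phi> by (simp add: open_Collect_neq continuous_on_const)
  then obtain \<delta> where \<delta>: "\<delta> > 0" "ball (x, 0) \<delta> \<subseteq> {y. \<phi> y \<noteq> 0}"
    using nz open_contains_ball by (metis (mono_tags, lifting) mem_Collect_eq)
  let ?H = "ball (x, 0::real) \<delta> \<inter> {y. snd y < 0}"
  have "convex {y :: 'a \<times> real. snd y < 0}"
    using convex_linear_vimage[of snd "{..<0::real}"] by (simp add: vimage_def linear_snd)
  from convex_connected[OF convex_Int[OF convex_ball this]] have "connected ?H" .
  moreover have "?H \<inter> \<Omega> \<noteq> {}"
  proof -
    obtain y where "y \<in> \<Omega>" "dist y (x, 0) < \<delta>"
      using \<Omega>(2) \<delta>(1) by (meson closure_approachable)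
    then have "y \<in> ?H \<inter> \<Omega>" using \<Omega>(1) by (auto simp: dist_commute)
    then show ?thesis by blast
  qed
  moreover have "?H \<inter> frontier \<Omega> = {}" using fr \<delta>(2) by blast
  ultimately have "?H \<subseteq> \<Omega>" using connected_Int_frontier[of ?H \<Omega>] by blast
  then show thesis using \<delta>(1) that by blast
qed

section \<open>Radial integrals and lattice sums\<close>

text \<open>The substitution \<open>s = a * t\<close> in Euler's Beta integral: the two powers
  contribute \<open>a powr (p + q - 2)\<close> and the differential one more factor
  \<open>a\<close>.\<close>

lemma has_integral_Beta_scaled:
  fixes a p q :: real
  assumes "a > 0" "p > 0" "q > 0"
  shows "((\<lambda>s. s powr (p - 1) * (a - s) powr (q - 1)) has_integral a powr (p + q - 1) * Beta p q) {0..a}"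
proof -
  let ?f = "\<lambda>t. t powr (p - 1) * (1 - t) powr (q - 1)"
  have "((\<lambda>s. ?f (1 / a * s)) has_integral (1 / \<bar>1 / a\<bar>) *\<^sub>R Beta p q) ((\<lambda>x. x / (1 / a)) ` {0..1})"
    using assms by (intro has_integral_stretch_real has_integral_Beta_real) auto
  moreover have "(\<lambda>x. x / (1 / a)) ` {0..1} = {0..a}"
    using assms image_mult_atLeastAtMost[of a 0 1] by (simp add: mult.commute)
  ultimately have "((\<lambda>s. ?f (1 / a * s)) has_integral a * Beta p q) {0..a}" using assms by simp
  then have "((\<lambda>s. a powr (p + q - 2) * ?f (1 / a * s)) has_integral a powr (p + q - 2) * (a * Beta p q)) {0..a}"
    by (rule has_integral_mult_right)
  then have "((\<lambda>s. s powr (p - 1) * (a - s) powr (q - 1)) has_integral a powr (p + q - 2) * (a * Beta p q)) {0..a}"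
  proof (rule has_integral_eq[rotated])
    fix s assume that: "s \<in> {0..a}"
    show "a powr (p + q - 2) * ?f (1 / a * s) = s powr (p - 1) * (a - s) powr (q - 1)"
    proof -
    have "(1 - 1 / a * s) = (a - s) / a" using assms by (simp add: field_simps)
    then show ?thesis using that assms
      by (simp add: powr_divide) (simp add: powr_add[symmetric] field_simps)
    qed
  qed
  moreover have "a powr (p + q - 2) * (a * Beta p q) = a powr (p + q - 1) * Beta p q"
    using assms powr_add[of a "p + q - 2" 1] by (simp add: mult.assoc)
  ultimately show ?thesis by simp
qed

text \<open>Layer-cake: \<open>t\<^sup>\<gamma>\<close> is the integral of \<open>\<gamma> s\<^sup>\<gamma>\<^sup>-\<^sup>1\<close> over \<open>0 \<le> s \<le> t\<close>, and
  \<open>{x. s \<le> a - \<bar>x\<bar>}\<close> is a ball.\<close>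

lemma nn_integral_radial_power:
  fixes a \<gamma> :: real
  assumes "a > 0" "\<gamma> > 0"
  shows "(\<integral>\<^sup>+x. ennreal (max 0 (a - norm (x::'a::euclidean_space)) powr \<gamma>) \<partial>lborel)
    = ennreal (unit_ball_vol (DIM('a)) * \<gamma> * Beta \<gamma> (DIM('a) + 1) * a powr (\<gamma> + DIM('a)))"
proof -
  let ?d = "DIM('a)"
  define k where "k s = \<gamma> * s powr (\<gamma> - 1)" for s :: real
  have [measurable]: "k \<in> borel_measurable borel" unfolding k_def by measurable
  have k: "k s \<ge> 0" for s using assms by (simp add: k_def)
  have layer: "ennreal (max 0 t powr \<gamma>) = (\<integral>\<^sup>+s. ennreal (k s) * indicator {0..} s * indicator {..t} s \<partial>lborel)" for t
  proof (cases "t \<ge> 0")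
    case True
    have "(k has_integral \<gamma> * (t powr (\<gamma> - 1 + 1) / (\<gamma> - 1 + 1))) {0..t}"
      unfolding k_def using True assms by (intro has_integral_mult_right has_integral_powr_from_0) auto
    then have "(\<integral>\<^sup>+s. ennreal (k s) * indicator {0..t} s \<partial>lborel) = ennreal (\<gamma> * (t powr (\<gamma> - 1 + 1) / (\<gamma> - 1 + 1)))"
      by (intro nn_integral_has_integral_lebesgue' k)
    moreover have "ennreal (k s) * indicator {0..t} s = ennreal (k s) * indicator {0..} s * indicator {..t} s" for s
      by (auto simp: indicator_def)
    ultimately show ?thesis using True assms by simp
  next
    case False
    have "ennreal (k s) * indicator {0..} s * indicator {..t} s = 0" for s
      using False by (auto simp: indicator_def)
    then have "(\<integral>\<^sup>+s. ennreal (k s) * indicator {0..} s * indicator {..t} s \<partial>lborel) = (\<integral>\<^sup>+(s::real). 0 \<partial>lborel)"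
      by (intro nn_integral_cong)
    then show ?thesis using False by simp
  qed
  have "(\<integral>\<^sup>+x. ennreal (max 0 (a - norm (x::'a)) powr \<gamma>) \<partial>lborel)
      = (\<integral>\<^sup>+x. (\<integral>\<^sup>+s. ennreal (k s) * indicator {0..} s * indicator {..a - norm (x::'a)} s \<partial>lborel) \<partial>lborel)"
    by (simp add: layer)
  also have "\<dots> = (\<integral>\<^sup>+s. (\<integral>\<^sup>+x. ennreal (k s) * indicator {0..} s * indicator {p. snd p \<le> a - norm (fst p)} (x::'a, s) \<partial>lborel) \<partial>lborel)"
    by (subst lborel_pair.Fubini') (auto intro!: nn_integral_cong simp: indicator_def)
  also have "\<dots> = (\<integral>\<^sup>+s. ennreal (k s) * indicator {0..} s * (\<integral>\<^sup>+x. indicator (cball (0::'a) (a - s)) x \<partial>lborel) \<partial>lborel)"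
    by (intro nn_integral_cong, subst nn_integral_cmult[symmetric])
       (auto intro!: nn_integral_cong borel_measurable_indicator simp: indicator_def[of "{p. snd p \<le> a - norm (fst p)}"] indicator_def[of "cball _ _"])
  also have "\<dots> = (\<integral>\<^sup>+s. ennreal (unit_ball_vol ?d * \<gamma> * (s powr (\<gamma> - 1) * (a - s) powr ((?d + 1) - 1))) * indicator {0..a} s \<partial>lborel)"
  proof (rule nn_integral_cong_AE)
    \<comment> \<open>The endpoint is discarded because rewriting \<open>powr\<close> as an ordinary
      power is done for a positive base.\<close>
    have "AE s in lborel. s \<noteq> a" by (rule AE_lborel_singleton)
    then show "AE s in lborel. ennreal (k s) * indicator {0..} s * (\<integral>\<^sup>+x. indicator (cball (0::'a) (a - s)) x \<partial>lborel)
      = ennreal (unit_ball_vol ?d * \<gamma> * (s powr (\<gamma> - 1) * (a - s) powr ((?d + 1) - 1))) * indicator {0..a} s"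
    proof eventually_elim
      case (elim s)
      show ?case
      proof (cases "s \<in> {0..a}")
        case True
        then have "(\<integral>\<^sup>+x. indicator (cball (0::'a) (a - s)) x \<partial>lborel) = ennreal (unit_ball_vol ?d * (a - s) ^ ?d)"
          by (simp add: emeasure_cball)
        moreover have "(a - s) powr real ?d = (a - s) ^ ?d" using True elim by (simp add: powr_realpow)
        ultimately show ?thesis using True assms
          by (simp add: k_def ennreal_mult'[symmetric] mult_ac)
      next
        case False
        then consider "s < 0" | "s > a" by fastforce
        then show ?thesis by cases (use False in simp_all)
      qed
    qed
  qed
  also have "\<dots> = ennreal (unit_ball_vol ?d * \<gamma> * (a powr (\<gamma> + (?d + 1) - 1) * Beta \<gamma> (?d + 1)))"
    using assms has_integral_Beta_scaled[of a \<gamma> "?d + 1"]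
    by (intro nn_integral_has_integral_lebesgue' has_integral_mult_right) auto
  finally show ?thesis by (simp add: mult_ac add_ac)
qed

text \<open>Since \<open>(2 * pi) ^ d\<close> over \<open>(4 * pi) powr (d / 2)\<close> is
  \<open>pi powr (d / 2)\<close>, the numerator of the volume of the unit ball appears; its
  denominator is the factor \<open>Gamma (d / 2 + 1)\<close>, and the remaining Gamma values form
  \<open>\<gamma> * Beta \<gamma> (d + 1)\<close>.\<close>

lemma riesz_const_eq:
  assumes "\<gamma> > 0"
  shows "riesz_const (d + 1) \<gamma> * (2 * pi) ^ d = unit_ball_vol d * \<gamma> * Beta \<gamma> (d + 1)"
proof -
  have 1: "(4 * pi) powr (d / 2) = 2 ^ d * pi powr (d / 2)"
  proof -
    have "(4::real) powr (d / 2) = (2 powr 2) powr (d / 2)" by simp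
    also have "\<dots> = 2 ^ d" by (simp only: powr_powr) (simp add: powr_realpow)
    finally show ?thesis by (simp add: powr_mult)
  qed
  have 2: "pi ^ d = pi powr (d / 2) * pi powr (d / 2)"
    by (simp add: powr_add[symmetric] powr_realpow)
  have 3: "Gamma (\<gamma> + 1) = \<gamma> * Gamma \<gamma>"
    using Gamma_plus1[of \<gamma>] assms nonpos_Ints_nonpos[of \<gamma>] by force
  have p: "pi powr (d / 2) > 0" by simp
  have g: "Gamma (d / 2 + 1) > 0" "Gamma (d + 1 + \<gamma>) > 0" using assms by (auto intro!: Gamma_real_pos)
  have e: "(real (d + 1) - 1) / 2 = d / 2" "(real (d + 1) + 1) / 2 = d / 2 + 1" by (auto simp: field_simps)
  show ?thesis
    unfolding riesz_const_def unit_ball_vol_def Beta_def e 1 3 power_mult_distrib 2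
    using p g by (simp add: field_simps add_ac)
qed

section \<open>Comparing lattice sums with integrals\<close>

definition lattice :: "real \<Rightarrow> 'a::euclidean_space set" where
  "lattice h = {\<xi>. \<forall>b\<in>Basis. \<exists>k::int. \<xi> \<bullet> b = h * k}"

text \<open>Each lattice point is charged to the open cell having it as lower corner. The cells are
  disjoint, and on the cell of \<open>\<xi>\<close> the norm exceeds \<open>norm \<xi>\<close> by at
  most \<open>h * DIM('a)\<close> (the sum of the coordinate offsets), so raising \<open>z\<close>
  by this amount makes the integrand dominate.\<close>

lemma lattice_sum_le_nn_integral:
  fixes K :: "'a::euclidean_space set"
  assumes "h > 0" "finite K" "K \<subseteq> lattice h" "\<gamma> \<ge> 0"
  shows "(\<Sum>\<xi>\<in>K. ennreal (h ^ DIM('a) * max 0 (z - norm \<xi>) powr \<gamma>))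
    \<le> (\<integral>\<^sup>+x. ennreal (max 0 (z + h * DIM('a) - norm (x::'a)) powr \<gamma>) \<partial>lborel)"
proof -
  define cell where "cell \<xi> = box \<xi> (\<xi> + h *\<^sub>R One)" for \<xi> :: 'a
  have vol: "emeasure lborel (cell \<xi>) = ennreal (h ^ DIM('a))" for \<xi>
  proof -
    have "(\<Prod>b\<in>Basis. (\<xi> + h *\<^sub>R One - \<xi>) \<bullet> b) = (\<Prod>b\<in>(Basis::'a set). h)"
      by (intro prod.cong) auto
    then show ?thesis using \<open>h > 0\<close> unfolding cell_def by (subst emeasure_lborel_box) (auto simp: inner_add_left)
  qed
  have near: "norm x \<le> norm \<xi> + h * DIM('a)" if "x \<in> cell \<xi>" for x \<xi>
  proof -
    have "norm (x - \<xi>) \<le> (\<Sum>b\<in>Basis. \<bar>(x - \<xi>) \<bullet> b\<bar>)" by (rule norm_le_l1)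
    also have "\<dots> \<le> (\<Sum>b\<in>(Basis::'a set). h)"
      using that by (intro sum_mono) (auto simp: cell_def mem_box inner_diff_left inner_add_left)
    finally show ?thesis using norm_triangle_sub[of x \<xi>] by (simp add: mult.commute)
  qed
  have uniq: "\<xi> = \<zeta>" if "\<xi> \<in> K" "\<zeta> \<in> K" "x \<in> cell \<xi>" "x \<in> cell \<zeta>" for x \<xi> \<zeta>
  proof (rule euclidean_eqI)
    fix b :: 'a assume b: "b \<in> Basis"
    have "\<xi> \<in> lattice h" "\<zeta> \<in> lattice h" using that \<open>K \<subseteq> lattice h\<close> by auto
    then obtain k l :: int where kl: "\<xi> \<bullet> b = h * k" "\<zeta> \<bullet> b = h * l"
      using b unfolding lattice_def by blast
    have "h * k < x \<bullet> b" "x \<bullet> b < h * (k + 1)" "h * l < x \<bullet> b" "x \<bullet> b < h * (l + 1)"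
      using that b kl by (auto simp: cell_def mem_box inner_add_left algebra_simps)
    then have "h * k < h * (l + 1)" "h * l < h * (k + 1)" by linarith+
    then have "real_of_int k < l + 1" "real_of_int l < k + 1" using \<open>h > 0\<close> by auto
    then have "k = l" by linarith
    then show "\<xi> \<bullet> b = \<zeta> \<bullet> b" using kl by simp
  qed
  have [measurable]: "cell \<xi> \<in> sets borel" for \<xi> by (simp add: cell_def)
  have "(\<Sum>\<xi>\<in>K. ennreal (h ^ DIM('a) * max 0 (z - norm \<xi>) powr \<gamma>))
      = (\<Sum>\<xi>\<in>K. \<integral>\<^sup>+x. ennreal (max 0 (z - norm \<xi>) powr \<gamma>) * indicator (cell \<xi>) x \<partial>lborel)"
    by (intro sum.cong refl) (subst nn_integral_cmult_indicator, auto simp: vol ennreal_mult' \<open>h > 0\<close> less_imp_le mult.commute)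
  also have "\<dots> = (\<integral>\<^sup>+x. (\<Sum>\<xi>\<in>K. ennreal (max 0 (z - norm \<xi>) powr \<gamma>) * indicator (cell \<xi>) x) \<partial>lborel)"
    by (rule nn_integral_sum[symmetric]) measurable
  also have "\<dots> \<le> (\<integral>\<^sup>+x. ennreal (max 0 (z + h * DIM('a) - norm (x::'a)) powr \<gamma>) \<partial>lborel)"
  proof (rule nn_integral_mono)
    fix x :: 'a
    show "(\<Sum>\<xi>\<in>K. ennreal (max 0 (z - norm \<xi>) powr \<gamma>) * indicator (cell \<xi>) x)
        \<le> ennreal (max 0 (z + h * DIM('a) - norm x) powr \<gamma>)"
    proof (cases "\<exists>\<zeta>\<in>K. x \<in> cell \<zeta>")
      case True
      then obtain \<zeta> where \<zeta>: "\<zeta> \<in> K" "x \<in> cell \<zeta>" by blast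
      have "(\<Sum>\<xi>\<in>K. ennreal (max 0 (z - norm \<xi>) powr \<gamma>) * indicator (cell \<xi>) x)
          = (\<Sum>\<xi>\<in>K. if \<xi> = \<zeta> then ennreal (max 0 (z - norm \<zeta>) powr \<gamma>) else 0)"
        using \<zeta> uniq by (intro sum.cong refl) (auto simp: indicator_def)
      also have "\<dots> = ennreal (max 0 (z - norm \<zeta>) powr \<gamma>)" using \<zeta> \<open>finite K\<close> by simp
      also have "\<dots> \<le> ennreal (max 0 (z + h * DIM('a) - norm x) powr \<gamma>)"
        using near[OF \<zeta>(2)] \<open>\<gamma> \<ge> 0\<close> by (intro ennreal_leI powr_mono2) auto
      finally show ?thesis .
    next
      case False
      then have "(\<Sum>\<xi>\<in>K. ennreal (max 0 (z - norm \<xi>) powr \<gamma>) * indicator (cell \<xi>) x) = 0"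
        by (intro sum.neutral) auto
      then show ?thesis by simp
    qed
  qed
  finally show ?thesis .
qed

section \<open>Trigonometric polynomials on a cube\<close>

lemma lborel_integral_prod:
  fixes f :: "'a::euclidean_space \<Rightarrow> real \<Rightarrow> complex"
  assumes "\<And>b. b \<in> Basis \<Longrightarrow> integrable lborel (f b)" "\<And>b. b \<in> Basis \<Longrightarrow> f b \<in> borel_measurable borel"
  shows "(\<integral>x. (\<Prod>b\<in>Basis. f b (x \<bullet> b)) \<partial>lborel) = (\<Prod>b\<in>Basis. \<integral>s. f b s \<partial>lborel)"
proof -
  interpret product_sigma_finite "\<lambda>b::'a. lborel :: real measure" ..
  have "(\<integral>x. (\<Prod>b\<in>Basis. f b (x \<bullet> b)) \<partial>lborel)
      = (\<integral>y. (\<Prod>b\<in>Basis. f b ((\<Sum>c\<in>Basis. y c *\<^sub>R c) \<bullet> b)) \<partial>(\<Pi>\<^sub>M b\<in>Basis. lborel))"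
    unfolding lborel_eq[where 'a='a] using assms(2)
    by (subst integral_distr) (auto intro!: borel_measurable_prod measurable_compose[OF _ assms(2)])
  also have "\<dots> = (\<integral>y. (\<Prod>b\<in>Basis. f b (y b)) \<partial>(\<Pi>\<^sub>M b\<in>(Basis::'a set). lborel))"
    by (intro Bochner_Integration.integral_cong prod.cong refl) (simp add: inner_sum_left_Basis)
  also have "\<dots> = (\<Prod>b\<in>Basis. \<integral>s. f b s \<partial>lborel)"
    using assms(1) by (intro product_integral_prod) auto
  finally show ?thesis .
qed

text \<open>For nonzero \<open>c\<close> the antiderivative \<open>cis (c * s) / (\<i> * c)\<close>
  takes equal values at \<open>R\<close> and \<open>-R\<close>, because \<open>2 * c * R\<close> is
  a multiple of \<open>2 * pi\<close>.\<close>

lemma integral_cis_period: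
  fixes R c :: real
  assumes "R > 0" "c = pi / R * of_int k"
  shows "(\<integral>s. indicator {-R..R} s *\<^sub>R cis (c * s) \<partial>lborel) = (if c = 0 then of_real (2 * R) else 0)"
proof (cases "c = 0")
  case True
  then show ?thesis using \<open>R > 0\<close> by (simp add: scaleR_conv_of_real)
next
  case False
  have "((\<lambda>s. cis (c * s)) has_integral (cis (c * R) / (\<i> * c) - cis (c * (-R)) / (\<i> * c))) {-R..R}"
  proof (rule fundamental_theorem_of_calculus)
    fix s
    have "((\<lambda>s. cis (c * s)) has_vector_derivative c *\<^sub>R (\<i> * cis (c * s))) (at s within {-R..R})"
    proof -
      have "((\<lambda>z. exp (\<i> * (of_real c * z))) has_field_derivative exp (\<i> * (of_real c * of_real s)) * (\<i> * of_real c)) (at (of_real s))"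
        by (auto intro!: derivative_eq_intros)
      from has_vector_derivative_real_field[OF this] show ?thesis
        by (simp add: cis_conv_exp scaleR_conv_of_real mult_ac)
    qed
    then have "((\<lambda>s. cis (c * s) / (\<i> * c)) has_vector_derivative c *\<^sub>R (\<i> * cis (c * s)) / (\<i> * c)) (at s within {-R..R})"
      by (rule has_vector_derivative_divide)
    then show "((\<lambda>s. cis (c * s) / (\<i> * c)) has_vector_derivative cis (c * s)) (at s within {-R..R})"
      using False by (simp add: scaleR_conv_of_real)
  qed (use assms in simp)
  moreover have "cis (c * R) = cis (c * (-R))"
  proof -
    have "c * R = c * (-R) + 2 * pi * of_int k" using assms by (simp add: field_simps)
    then show ?thesis using sin_cos_eq_iff[of "c * R" "c * (-R)"] by (metis cis.ctr)
  qed
  ultimately have "((\<lambda>s. cis (c * s)) has_integral 0) {-R..R}" by simp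
  then have "integral {-R..R} (\<lambda>s. cis (c * s)) = 0" by (rule integral_unique)
  moreover have "set_integrable lborel {-R..R} (\<lambda>s. cis (c * s))"
    by (rule borel_integrable_atLeastAtMost') (auto intro!: continuous_intros)
  ultimately show ?thesis
    using False set_borel_integral_eq_integral(2)[of "{-R..R}" "\<lambda>s. cis (c * s)"]
    by (simp add: set_lebesgue_integral_def)
qed

lemma cis_sum: "cis (\<Sum>i\<in>A. f i) = (\<Prod>i\<in>A. cis (f i))"
  by (induction A rule: infinite_finite_induct) (auto simp: cis_mult[symmetric])

abbreviation cube :: "real \<Rightarrow> 'a::euclidean_space set" where
  "cube R \<equiv> cbox (- R *\<^sub>R One) (R *\<^sub>R One)"

text \<open>Orthogonality of characters: the integral factors over the coordinates, and a nonzero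
  frequency has a nonzero coordinate whose factor is 0.\<close>

lemma integral_cis_cube:
  fixes \<zeta> :: "'a::euclidean_space"
  assumes "R > 0" "\<zeta> \<in> lattice (pi / R)"
  shows "(\<integral>x. indicator (cube R) x *\<^sub>R cis (\<zeta> \<bullet> x) \<partial>lborel) = (if \<zeta> = 0 then of_real ((2 * R) ^ DIM('a)) else 0)"
proof -
  define f where "f b s = indicator {-R..R} s *\<^sub>R cis ((\<zeta> \<bullet> b) * s)" for b s
  have m: "f b \<in> borel_measurable borel" for b
    unfolding f_def by (intro borel_measurable_scaleR borel_measurable_indicator borel_measurable_continuous_onI continuous_intros) auto
  have i: "integrable lborel (f b)" for b
  proof -
    have "set_integrable lborel {-R..R} (\<lambda>s. cis ((\<zeta> \<bullet> b) * s))"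
      by (rule borel_integrable_atLeastAtMost') (auto intro!: continuous_intros)
    then show ?thesis by (simp add: set_integrable_def f_def[abs_def])
  qed
  have "indicator (cube R) x *\<^sub>R cis (\<zeta> \<bullet> x) = (\<Prod>b\<in>Basis. f b (x \<bullet> b))" for x :: 'a
  proof -
    have "indicator (cube R) x = (\<Prod>b\<in>(Basis::'a set). indicator {-R..R} (x \<bullet> b) :: real)"
      by (auto simp: indicator_def mem_box prod.If_cases subset_eq)
    moreover have "cis (\<zeta> \<bullet> x) = (\<Prod>b\<in>Basis. cis ((\<zeta> \<bullet> b) * (x \<bullet> b)))"
      by (subst euclidean_inner) (simp add: cis_sum)
    ultimately show ?thesis by (simp add: f_def scaleR_conv_of_real prod.distrib)
  qed
  then have "(\<integral>x. indicator (cube R) x *\<^sub>R cis (\<zeta> \<bullet> x) \<partial>lborel) = (\<Prod>b\<in>Basis. \<integral>s. f b s \<partial>lborel)"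
    using lborel_integral_prod[of f] i m by simp
  also have "\<dots> = (\<Prod>b\<in>(Basis::'a set). if \<zeta> \<bullet> b = 0 then of_real (2 * R) else 0)"
  proof (rule prod.cong[OF refl])
    fix b :: 'a assume "b \<in> Basis"
    then obtain k :: int where "\<zeta> \<bullet> b = pi / R * k" using assms(2) by (auto simp: lattice_def)
    then show "(\<integral>s. f b s \<partial>lborel) = (if \<zeta> \<bullet> b = 0 then of_real (2 * R) else 0)"
      unfolding f_def by (intro integral_cis_period[OF \<open>R > 0\<close>])
  qed
  also have "\<dots> = (if \<zeta> = 0 then of_real ((2 * R) ^ DIM('a)) else 0)"
  proof (cases "\<zeta> = 0")
    case False
    then obtain b where "b \<in> Basis" "\<zeta> \<bullet> b \<noteq> 0" using euclidean_eqI[of \<zeta> 0] by auto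
    then show ?thesis using False by (auto intro!: prod_zero)
  qed simp
  finally show ?thesis .
qed

lemma lattice_diff: "\<xi> \<in> lattice h \<Longrightarrow> \<zeta> \<in> lattice h \<Longrightarrow> \<xi> - \<zeta> \<in> lattice h"
  unfolding lattice_def
proof safe
  fix b :: 'a
  assume "\<forall>b\<in>Basis. \<exists>k::int. \<xi> \<bullet> b = h * k" "\<forall>b\<in>Basis. \<exists>k::int. \<zeta> \<bullet> b = h * k" "b \<in> Basis"
  then obtain k l :: int where "\<xi> \<bullet> b = h * k" "\<zeta> \<bullet> b = h * l" by meson
  then have "(\<xi> - \<zeta>) \<bullet> b = h * of_int (k - l)" by (simp add: inner_diff_left algebra_simps)
  then show "\<exists>k::int. (\<xi> - \<zeta>) \<bullet> b = h * k" by blast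
qed

lemma lattice_add: "\<xi> \<in> lattice h \<Longrightarrow> \<zeta> \<in> lattice h \<Longrightarrow> \<xi> + \<zeta> \<in> lattice h"
  using lattice_diff[of \<xi> h "0 - \<zeta>"] lattice_diff[of 0 h \<zeta>] by (simp add: lattice_def)

lemma integrable_cube_continuous:
  fixes f :: "'a::euclidean_space \<Rightarrow> 'b::euclidean_space"
  assumes "continuous_on UNIV f"
  shows "integrable lborel (\<lambda>x. indicator (cube R) x *\<^sub>R f x)"
proof -
  have "set_integrable lborel (cube R) f"
    unfolding set_integrable_def using assms
    by (intro borel_integrable_compact) (auto intro: continuous_on_subset)
  then show ?thesis by (simp add: set_integrable_def)
qed

definition trig :: "'a::euclidean_space set \<Rightarrow> ('a \<Rightarrow> complex) \<Rightarrow> 'a \<Rightarrow> complex" where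
  "trig K c x = (\<Sum>\<xi>\<in>K. c \<xi> * cis (\<xi> \<bullet> x))"

lemma continuous_trig: "continuous_on UNIV (trig K c)"
  unfolding trig_def[abs_def] by (intro continuous_intros)

text \<open>Parseval for finite sums: in the expanded square the frequencies are differences of
  lattice points, so only the diagonal survives integration.\<close>

lemma integral_trig_cube:
  fixes K :: "'a::euclidean_space set"
  assumes "R > 0" "finite K" "K \<subseteq> lattice (pi / R)"
  shows "(\<integral>x. indicator (cube R) x * (cmod (trig K c x))\<^sup>2 \<partial>lborel) = (2 * R) ^ DIM('a) * (\<Sum>\<xi>\<in>K. (cmod (c \<xi>))\<^sup>2)"
proof -
  let ?V = "of_real ((2 * R) ^ DIM('a)) :: complex"
  have e: "complex_of_real (indicator (cube R) x * (cmod (trig K c x))\<^sup>2)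
     = (\<Sum>\<xi>\<in>K. \<Sum>\<zeta>\<in>K. (c \<xi> * cnj (c \<zeta>)) * (indicator (cube R) x *\<^sub>R cis ((\<xi> - \<zeta>) \<bullet> x)))" for x
  proof -
    have "complex_of_real ((cmod (trig K c x))\<^sup>2) = trig K c x * cnj (trig K c x)"
      by (rule complex_norm_square)
    also have "\<dots> = (\<Sum>\<xi>\<in>K. \<Sum>\<zeta>\<in>K. (c \<xi> * cnj (c \<zeta>)) * cis ((\<xi> - \<zeta>) \<bullet> x))"
      unfolding trig_def cnj_sum sum_product
      by (intro sum.cong refl) (simp add: cis_cnj inner_diff_left cis_divide[symmetric] cis_inverse[symmetric] field_simps)
    finally show ?thesis by (simp add: sum_distrib_left sum_distrib_right scaleR_conv_of_real mult_ac)
  qed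
  have i: "integrable lborel (\<lambda>x. indicator (cube R) x *\<^sub>R cis (\<xi> \<bullet> x))" for \<xi> :: 'a
    by (intro integrable_cube_continuous continuous_intros)
  have "complex_of_real (\<integral>x. indicator (cube R) x * (cmod (trig K c x))\<^sup>2 \<partial>lborel)
      = (\<integral>x. (\<Sum>\<xi>\<in>K. \<Sum>\<zeta>\<in>K. (c \<xi> * cnj (c \<zeta>)) * (indicator (cube R) x *\<^sub>R cis ((\<xi> - \<zeta>) \<bullet> x))) \<partial>lborel)"
    unfolding e[symmetric] by (rule integral_complex_of_real[symmetric])
  also have "\<dots> = (\<Sum>\<xi>\<in>K. \<Sum>\<zeta>\<in>K. (c \<xi> * cnj (c \<zeta>)) * (\<integral>x. indicator (cube R) x *\<^sub>R cis ((\<xi> - \<zeta>) \<bullet> x) \<partial>lborel))"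
    by (simp only: Bochner_Integration.integral_sum Bochner_Integration.integrable_sum
        integrable_mult_right[OF i] integral_mult_right_zero)
  also have "\<dots> = (\<Sum>\<xi>\<in>K. \<Sum>\<zeta>\<in>K. if \<zeta> = \<xi> then (c \<xi> * cnj (c \<xi>)) * ?V else 0)"
  proof (intro sum.cong refl)
    fix \<xi> \<zeta> assume "\<xi> \<in> K" "\<zeta> \<in> K"
    then have "\<xi> - \<zeta> \<in> lattice (pi / R)" using assms(3) by (auto intro: lattice_diff)
    then show "(c \<xi> * cnj (c \<zeta>)) * (\<integral>x. indicator (cube R) x *\<^sub>R cis ((\<xi> - \<zeta>) \<bullet> x) \<partial>lborel)
        = (if \<zeta> = \<xi> then (c \<xi> * cnj (c \<xi>)) * ?V else 0)"
      by (subst integral_cis_cube[OF assms(1)]) auto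
  qed
  also have "\<dots> = (\<Sum>\<xi>\<in>K. (c \<xi> * cnj (c \<xi>)) * ?V)" using assms(2) by simp
  also have "\<dots> = complex_of_real ((2 * R) ^ DIM('a) * (\<Sum>\<xi>\<in>K. (cmod (c \<xi>))\<^sup>2))"
    by (simp only: of_real_mult of_real_sum complex_norm_square sum_distrib_left mult_ac)
  finally show ?thesis by (simp only: of_real_eq_iff)
qed

text \<open>These functions form an algebra, so every polynomial in the sines and cosines of the
  coordinates is again a trigonometric sum over the lattice.\<close>

definition trig_polynomials :: "real \<Rightarrow> ('a::euclidean_space \<Rightarrow> complex) set" where
  "trig_polynomials h = {f. \<exists>K c. finite K \<and> K \<subseteq> lattice h \<and> f = trig K c}"

lemma trig_polynomials_cis: "\<xi> \<in> lattice h \<Longrightarrow> (\<lambda>x. a * cis (\<xi> \<bullet> x)) \<in> trig_polynomials h"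
  unfolding trig_polynomials_def by (intro CollectI exI[of _ "{\<xi>}"] exI[of _ "\<lambda>_. a"]) (auto simp: trig_def)

lemma trig_polynomials_const: "(\<lambda>x. a) \<in> trig_polynomials h"
  using trig_polynomials_cis[of 0 h a] by (simp add: lattice_def)

lemma trig_polynomials_add:
  assumes "f \<in> trig_polynomials h" "g \<in> trig_polynomials h"
  shows "(\<lambda>x. f x + g x) \<in> trig_polynomials h"
proof -
  obtain K c L d where KL: "finite K" "K \<subseteq> lattice h" "f = trig K c" "finite L" "L \<subseteq> lattice h" "g = trig L d"
    using assms by (auto simp: trig_polynomials_def)
  define e where "e \<xi> = (if \<xi> \<in> K then c \<xi> else 0) + (if \<xi> \<in> L then d \<xi> else 0)" for \<xi>
  have "f x + g x = trig (K \<union> L) e x" for x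
  proof -
    have "trig (K \<union> L) e x = (\<Sum>\<xi>\<in>K \<union> L. if \<xi> \<in> K then c \<xi> * cis (\<xi> \<bullet> x) else 0)
        + (\<Sum>\<xi>\<in>K \<union> L. if \<xi> \<in> L then d \<xi> * cis (\<xi> \<bullet> x) else 0)"
      unfolding trig_def e_def sum.distrib[symmetric] by (intro sum.cong) (auto simp: algebra_simps)
    also have "(\<Sum>\<xi>\<in>K \<union> L. if \<xi> \<in> K then c \<xi> * cis (\<xi> \<bullet> x) else 0) = f x"
      using KL by (simp add: sum.If_cases trig_def Int_absorb1)
    also have "(\<Sum>\<xi>\<in>K \<union> L. if \<xi> \<in> L then d \<xi> * cis (\<xi> \<bullet> x) else 0) = g x"
      using KL by (simp add: sum.If_cases trig_def Int_absorb1)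
    finally show ?thesis by simp
  qed
  then show ?thesis using KL unfolding trig_polynomials_def
    by (intro CollectI exI[of _ "K \<union> L"] exI[of _ e]) auto
qed

lemma trig_polynomials_sum:
  assumes "\<And>i. i \<in> I \<Longrightarrow> f i \<in> trig_polynomials h"
  shows "(\<lambda>x. \<Sum>i\<in>I. f i x) \<in> trig_polynomials h"
  using assms
  by (induction I rule: infinite_finite_induct) (auto intro: trig_polynomials_add trig_polynomials_const)

lemma trig_polynomials_mult:
  assumes "f \<in> trig_polynomials h" "g \<in> trig_polynomials h"
  shows "(\<lambda>x. f x * g x) \<in> trig_polynomials h"
proof -
  obtain K c L d where KL: "finite K" "K \<subseteq> lattice h" "f = trig K c" "finite L" "L \<subseteq> lattice h" "g = trig L d"
    using assms by (auto simp: trig_polynomials_def)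
  have "(\<lambda>x. f x * g x) = (\<lambda>x. \<Sum>\<xi>\<in>K. \<Sum>\<zeta>\<in>L. (c \<xi> * d \<zeta>) * cis ((\<xi> + \<zeta>) \<bullet> x))"
    unfolding KL trig_def[abs_def] sum_product
    by (intro ext sum.cong refl) (simp add: inner_add_left cis_mult[symmetric] mult_ac)
  moreover have "\<dots> \<in> trig_polynomials h"
    using KL by (intro trig_polynomials_sum trig_polynomials_cis lattice_add) auto
  ultimately show ?thesis by simp
qed

text \<open>The map \<open>E\<close> wraps the cube onto a torus, identifying opposite faces; a function that
  vanishes on the boundary of the cube descends to the torus, where Stone--Weierstrass applies.\<close>

lemma trig_polynomials_dense:
  fixes u :: "'a::euclidean_space \<Rightarrow> real"
  assumes "R > 0" and u: "continuous_on UNIV u" and u0: "\<And>x. x \<notin> box (- R *\<^sub>R One) (R *\<^sub>R One) \<Longrightarrow> u x = 0"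
    and "e > 0"
  obtains K c where "finite K" "K \<subseteq> lattice (pi / R)" "\<And>x. x \<in> cube R \<Longrightarrow> cmod (u x - trig K c x) < e"
proof -
  define h where "h = pi / R"
  have "h > 0" using \<open>R > 0\<close> by (simp add: h_def)
  define E where "E x = ((\<Sum>b\<in>Basis. cos (h * (x \<bullet> b)) *\<^sub>R b), (\<Sum>b\<in>Basis. sin (h * (x \<bullet> b)) *\<^sub>R b))" for x :: 'a
  have cE: "continuous_on S E" for S unfolding E_def by (intro continuous_intros)
  \<comment> \<open>Angles with equal sine and cosine make coordinates differ by a multiple of
    \<open>2 * R\<close>. Inside the cube a nonzero multiple puts the two points on opposite faces,
    where \<open>u\<close> vanishes.\<close>
  have same: "u x = u y" if "x \<in> cube R" "y \<in> cube R" "E x = E y" for x y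
  proof (cases "x = y")
    case False
    then obtain b where b: "b \<in> Basis" "x \<bullet> b \<noteq> y \<bullet> b" using euclidean_eqI[of x y] by auto
    have "fst (E x) \<bullet> b = fst (E y) \<bullet> b" "snd (E x) \<bullet> b = snd (E y) \<bullet> b" using that by auto
    then have "cos (h * (x \<bullet> b)) = cos (h * (y \<bullet> b))" "sin (h * (x \<bullet> b)) = sin (h * (y \<bullet> b))"
      using b by (simp_all add: E_def inner_sum_left_Basis)
    then obtain n :: int where n: "h * (x \<bullet> b) = h * (y \<bullet> b) + 2 * pi * n"
      using sin_cos_eq_iff by metis
    have "h * (x \<bullet> b) = h * (y \<bullet> b + 2 * R * n)" using n \<open>R > 0\<close> by (simp add: h_def field_simps)
    then have n': "x \<bullet> b = y \<bullet> b + 2 * R * n" using \<open>h > 0\<close> by simp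
    have bd: "\<bar>x \<bullet> b\<bar> \<le> R" "\<bar>y \<bullet> b\<bar> \<le> R" using that(1,2) b by (auto simp: mem_box abs_le_iff)
    have "n \<noteq> 0" using n' b by auto
    then consider "real_of_int n \<ge> 1" | "real_of_int n \<le> -1" by linarith
    then have "\<bar>x \<bullet> b\<bar> = R \<and> \<bar>y \<bullet> b\<bar> = R"
    proof cases
      case 1
      then have "2 * R * n \<ge> 2 * R" using \<open>R > 0\<close> by simp
      then show ?thesis using n' bd by linarith
    next
      case 2
      then have "2 * R * n \<le> 2 * R * (-1)" using \<open>R > 0\<close> by (intro mult_left_mono) auto
      then show ?thesis using n' bd by linarith
    qed
    then have "x \<notin> box (- R *\<^sub>R One) (R *\<^sub>R One)" "y \<notin> box (- R *\<^sub>R One) (R *\<^sub>R One)"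
      using b by (auto simp: mem_box intro!: bexI[of _ b])
    then show ?thesis using u0 by simp
  qed simp
  let ?Q = "cube R :: 'a set" and ?T = "E ` cube R"
  have "compact ?T" by (intro compact_continuous_image cE compact_cbox)
  define g where "g t = u (SOME x. x \<in> ?Q \<and> E x = t)" for t
  have g: "g (E x) = u x" if "x \<in> ?Q" for x
    using someI_ex[of "\<lambda>y. y \<in> ?Q \<and> E y = E x"] that same[of "SOME y. y \<in> ?Q \<and> E y = E x" x] unfolding g_def by blast
  \<comment> \<open>As the cube is compact, \<open>E\<close> maps its closed subsets to closed sets;
    the preimage of a closed set under \<open>g\<close> is the image under \<open>E\<close> of its
    preimage under \<open>u\<close>.\<close>
  have "continuous_on ?T g"
    unfolding continuous_on_closed_vimage[OF compact_imp_closed[OF \<open>compact ?T\<close>]]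
  proof safe
    fix B :: "real set" assume "closed B"
    then have "closed (u -` B)" using u continuous_on_closed_vimage[of UNIV u] by auto
    then have "compact (E ` (u -` B \<inter> ?Q))"
      by (intro compact_continuous_image cE closed_Int_compact compact_cbox)
    moreover have "g -` B \<inter> ?T = E ` (u -` B \<inter> ?Q)" using g by (auto simp: image_iff)
    ultimately show "closed (g -` B \<inter> ?T)" by (simp add: compact_imp_closed)
  qed
  then obtain p where p: "real_polynomial_function p" "\<And>t. t \<in> ?T \<Longrightarrow> \<bar>g t - p t\<bar> < e"
    using Stone_Weierstrass_real_polynomial_function[OF \<open>compact ?T\<close> _ \<open>e > 0\<close>] by blast
  \<comment> \<open>Induction over the structure of the polynomial: linear functionals of
    \<open>E x\<close> become characters by Euler's formulas, and sums and products stay in the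
    algebra.\<close>
  have "(\<lambda>x. complex_of_real (p (E x))) \<in> trig_polynomials h"
    using p(1)
  proof induction
    case (linear f)
    then interpret bounded_linear f .
    have lat: "s *\<^sub>R h *\<^sub>R b \<in> lattice h" if "b \<in> Basis" "s \<in> {-1, 1}" for b :: 'a and s
    proof -
      have "\<exists>k::int. (s *\<^sub>R h *\<^sub>R b) \<bullet> c = h * k" if "c \<in> Basis" for c
        using \<open>b \<in> Basis\<close> \<open>s \<in> {-1, 1}\<close> that
        by (intro exI[of _ "if b = c then \<lfloor>s\<rfloor> else 0"]) (auto simp: inner_Basis)
      then show ?thesis by (simp add: lattice_def)
    qed
    have E': "E x = (\<Sum>b\<in>Basis. cos (h * (x \<bullet> b)) *\<^sub>R (b, 0) + sin (h * (x \<bullet> b)) *\<^sub>R (0, b))" for x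
      by (simp add: E_def prod_eq_iff fst_sum snd_sum)
    have c: "complex_of_real (cos t) = 1/2 * cis t + 1/2 * cis (-t)" "complex_of_real (sin t) = -\<i>/2 * cis t + \<i>/2 * cis (-t)" for t
      by (auto simp: complex_eq_iff)
    have "(\<lambda>x. complex_of_real (f (E x))) = (\<lambda>x. \<Sum>b\<in>Basis.
        ((f (b, 0) / 2 - \<i> * f (0, b) / 2) * cis ((1 *\<^sub>R h *\<^sub>R b) \<bullet> x) + (f (b, 0) / 2 + \<i> * f (0, b) / 2) * cis (((-1) *\<^sub>R h *\<^sub>R b) \<bullet> x)))"
      unfolding E' sum add scale of_real_sum
      by (intro ext sum.cong refl) (simp add: c inner_commute algebra_simps)
    moreover have "\<dots> \<in> trig_polynomials h"
      by (intro trig_polynomials_sum trig_polynomials_add trig_polynomials_cis lat) auto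
    ultimately show ?case by simp
  next
    case (const c)
    then show ?case by (rule trig_polynomials_const)
  next
    case (add f g)
    then show ?case using trig_polynomials_add by auto
  next
    case (mult f g)
    then show ?case using trig_polynomials_mult by auto
  qed
  then obtain K c where K: "finite K" "K \<subseteq> lattice h" "\<And>x. complex_of_real (p (E x)) = trig K c x"
    unfolding trig_polynomials_def by (auto dest: fun_cong)
  show thesis
  proof (rule that)
    fix x assume x: "x \<in> ?Q"
    have "u x - trig K c x = of_real (u x - p (E x))" by (simp add: K(3)[symmetric])
    then have "cmod (u x - trig K c x) = \<bar>u x - p (E x)\<bar>" by (simp only: norm_of_real)
    then show "cmod (u x - trig K c x) < e" using p(2)[of "E x"] g x by simp
  qed (use K in \<open>auto simp: h_def\<close>)
qed

section \<open>Square-integrable functions and gradients\<close>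

lemma L2_onD: "L2_on S f \<Longrightarrow> f \<in> borel_measurable (lebesgue_on S)"
  "L2_on S f \<Longrightarrow> integrable (lebesgue_on S) (\<lambda>x. (norm (f x))\<^sup>2)"
  by (simp_all add: L2_on_def)

lemma power2_norm_add_le:
  fixes x y :: "'a::real_inner"
  shows "(norm (x + y))\<^sup>2 \<le> 2 * (norm x)\<^sup>2 + 2 * (norm y)\<^sup>2"
proof -
  have "(norm (x + y))\<^sup>2 + (norm (x - y))\<^sup>2 = 2 * (norm x)\<^sup>2 + 2 * (norm y)\<^sup>2"
    by (simp add: power2_norm_eq_inner inner_add_left inner_add_right inner_diff_left inner_diff_right)
  then show ?thesis by (smt (verit) zero_le_power2)
qed

lemma L2_on_add:
  assumes f: "L2_on S f" and g: "L2_on S g"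
  shows "L2_on S (\<lambda>x. f x + g x)"
  unfolding L2_on_def
proof
  show m: "(\<lambda>x. f x + g x) \<in> borel_measurable (lebesgue_on S)"
    using L2_onD(1)[OF f] L2_onD(1)[OF g] by measurable
  have "integrable (lebesgue_on S) (\<lambda>x. 2 * (norm (f x))\<^sup>2 + 2 * (norm (g x))\<^sup>2)"
    using L2_onD(2)[OF f] L2_onD(2)[OF g] by simp
  then show "integrable (lebesgue_on S) (\<lambda>x. (norm (f x + g x))\<^sup>2)"
    using m power2_norm_add_le by (elim Bochner_Integration.integrable_bound) auto
qed

lemma L2_on_scaleR:
  assumes f: "L2_on S f"
  shows "L2_on S (\<lambda>x. a *\<^sub>R f x)"
proof -
  have "(\<lambda>x. a *\<^sub>R f x) \<in> borel_measurable (lebesgue_on S)" using L2_onD(1)[OF f] by measurable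
  then show ?thesis using L2_onD(2)[OF f] by (simp add: L2_on_def power_mult_distrib)
qed

lemma L2_on_minus: "L2_on S f \<Longrightarrow> L2_on S g \<Longrightarrow> L2_on S (\<lambda>x. f x - g x)"
  using L2_on_add[of S f "\<lambda>x. (-1) *\<^sub>R g x"] L2_on_scaleR[of S g "-1"] by simp

lemma L2_on_zero: "L2_on S (\<lambda>x. 0)"
  by (simp add: L2_on_def)

lemma L2_on_sum: "(\<And>i. i \<in> I \<Longrightarrow> L2_on S (f i)) \<Longrightarrow> L2_on S (\<lambda>x. \<Sum>i\<in>I. f i x)"
  by (induction I rule: infinite_finite_induct) (simp_all add: L2_on_add L2_on_zero)

lemma integrable_inner_L2:
  assumes f: "L2_on S f" and g: "L2_on S g"
  shows "integrable (lebesgue_on S) (\<lambda>x. f x \<bullet> g x)"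
proof (rule Bochner_Integration.integrable_bound)
  show "integrable (lebesgue_on S) (\<lambda>x. (norm (f x))\<^sup>2 + (norm (g x))\<^sup>2)"
    using L2_onD(2)[OF f] L2_onD(2)[OF g] by simp
  show "(\<lambda>x. f x \<bullet> g x) \<in> borel_measurable (lebesgue_on S)"
    using L2_onD(1)[OF f] L2_onD(1)[OF g] by measurable
  have "\<bar>x \<bullet> y\<bar> \<le> (norm x)\<^sup>2 + (norm y)\<^sup>2" for x y :: 'b
  proof -
    have "\<bar>x \<bullet> y\<bar> \<le> norm x * norm y" by (rule Cauchy_Schwarz_ineq2)
    moreover have "2 * (norm x * norm y) \<le> (norm x)\<^sup>2 + (norm y)\<^sup>2"
      using sum_squares_bound[of "norm x" "norm y"] by simp
    moreover have "norm x * norm y \<ge> 0" by simp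
    ultimately show ?thesis by linarith
  qed
  then show "AE x in lebesgue_on S. norm (f x \<bullet> g x) \<le> norm ((norm (f x))\<^sup>2 + (norm (g x))\<^sup>2)" by simp
qed

lemma L2_on_continuous:
  fixes w :: "'a::euclidean_space \<Rightarrow> 'b::euclidean_space"
  assumes "continuous_on UNIV w" "bounded S" "S \<in> sets borel"
  shows "L2_on S w"
proof -
  have [measurable]: "w \<in> borel_measurable borel" using assms(1) by (rule borel_measurable_continuous_onI)
  have [measurable]: "S \<in> sets borel" by fact
  have "continuous_on UNIV (\<lambda>x. (norm (w x))\<^sup>2)" using assms(1) by (intro continuous_intros)
  then obtain M where M: "\<And>x. x \<in> S \<Longrightarrow> norm ((norm (w x))\<^sup>2) \<le> M" "M \<ge> 0"
    using continuous_bounded_on_bounded[OF assms(2)] by blast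
  have "integrable lborel (\<lambda>x. indicator S x *\<^sub>R (norm (w x))\<^sup>2)"
    by (rule integrable_bounded_support[of _ S M]) (use M assms in \<open>auto simp: indicator_def\<close>)
  then have "integrable (lebesgue_on S) (\<lambda>x. (norm (w x))\<^sup>2)"
    by (subst integrable_lebesgue_on_iff_lborel) auto
  moreover have "w \<in> borel_measurable (lebesgue_on S)"
    by (intro measurable_restrict_space1 measurable_completion) simp
  ultimately show ?thesis by (simp add: L2_on_def)
qed

lemma L2_converges_onD:
  assumes "L2_converges_on S u f"
  shows "L2_on S (u k)" "L2_on S f" "(\<lambda>k. \<integral>x. (norm (u k x - f x))\<^sup>2 \<partial>lebesgue_on S) \<longlonglongrightarrow> 0"
  using assms by (simp_all add: L2_converges_on_def)

lemma L2_converges_on_add: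
  assumes u: "L2_converges_on S u f" and v: "L2_converges_on S v g"
  shows "L2_converges_on S (\<lambda>k x. u k x + v k x) (\<lambda>x. f x + g x)"
  unfolding L2_converges_on_def
proof (intro conjI allI)
  note u = L2_converges_onD[OF u] and v = L2_converges_onD[OF v]
  show "L2_on S (\<lambda>x. u k x + v k x)" for k using u v by (intro L2_on_add)
  show "L2_on S (\<lambda>x. f x + g x)" using u v by (intro L2_on_add)
  let ?A = "\<lambda>k. \<integral>x. (norm (u k x - f x))\<^sup>2 \<partial>lebesgue_on S" and ?B = "\<lambda>k. \<integral>x. (norm (v k x - g x))\<^sup>2 \<partial>lebesgue_on S"
  have i: "integrable (lebesgue_on S) (\<lambda>x. (norm (u k x - f x))\<^sup>2)" "integrable (lebesgue_on S) (\<lambda>x. (norm (v k x - g x))\<^sup>2)" for k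
    using u v by (auto intro!: L2_onD(2) L2_on_minus)
  have "(\<integral>x. (norm (u k x + v k x - (f x + g x)))\<^sup>2 \<partial>lebesgue_on S) \<le> 2 * ?A k + 2 * ?B k" for k
  proof -
    have "(\<integral>x. (norm (u k x + v k x - (f x + g x)))\<^sup>2 \<partial>lebesgue_on S)
        \<le> (\<integral>x. 2 * (norm (u k x - f x))\<^sup>2 + 2 * (norm (v k x - g x))\<^sup>2 \<partial>lebesgue_on S)"
    proof (rule integral_mono)
      show "integrable (lebesgue_on S) (\<lambda>x. (norm (u k x + v k x - (f x + g x)))\<^sup>2)"
        using u v by (intro L2_onD(2) L2_on_minus L2_on_add)
      show "integrable (lebesgue_on S) (\<lambda>x. 2 * (norm (u k x - f x))\<^sup>2 + 2 * (norm (v k x - g x))\<^sup>2)"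
        using i by simp
      fix x
      show "(norm (u k x + v k x - (f x + g x)))\<^sup>2 \<le> 2 * (norm (u k x - f x))\<^sup>2 + 2 * (norm (v k x - g x))\<^sup>2"
        using power2_norm_add_le[of "u k x - f x" "v k x - g x"] by (simp add: algebra_simps)
    qed
    also have "\<dots> = 2 * ?A k + 2 * ?B k" using i by simp
    finally show ?thesis .
  qed
  note le = this
  have lim: "(\<lambda>k. 2 * ?A k + 2 * ?B k) \<longlonglongrightarrow> 0"
    using tendsto_add[OF tendsto_mult_left[OF u(3)] tendsto_mult_left[OF v(3)], of 2 2] by simp
  show "(\<lambda>k. \<integral>x. (norm (u k x + v k x - (f x + g x)))\<^sup>2 \<partial>lebesgue_on S) \<longlonglongrightarrow> 0"
    by (rule tendsto_sandwich[OF _ _ tendsto_const lim]) (use le in \<open>auto intro!: always_eventually\<close>)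
qed

lemma L2_converges_on_scaleR:
  assumes u: "L2_converges_on S u f"
  shows "L2_converges_on S (\<lambda>k x. a *\<^sub>R u k x) (\<lambda>x. a *\<^sub>R f x)"
proof -
  note u = L2_converges_onD[OF u]
  have "(\<lambda>k. a\<^sup>2 * (\<integral>x. (norm (u k x - f x))\<^sup>2 \<partial>lebesgue_on S)) \<longlonglongrightarrow> a\<^sup>2 * 0"
    using u by (intro tendsto_intros)
  then show ?thesis using u unfolding L2_converges_on_def
    by (auto intro: L2_on_scaleR simp: scaleR_diff_right[symmetric] power_mult_distrib)
qed

lemma L2_converges_on_sum:
  assumes "finite I" "\<And>i. i \<in> I \<Longrightarrow> L2_converges_on S (u i) (f i)"
  shows "L2_converges_on S (\<lambda>k x. \<Sum>i\<in>I. u i k x) (\<lambda>x. \<Sum>i\<in>I. f i x)"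
  using assms
proof (induction I rule: finite_induct)
  case empty
  then show ?case by (simp add: L2_converges_on_def L2_on_def)
next
  case (insert i I)
  then show ?case using L2_converges_on_add[of S "u i" "f i"] by simp
qed

text \<open>Young's inequality with a free weight: \<open>\<delta> = 1\<close> serves the energy
  estimate, a weight tending to 0 the convergence of pairings.\<close>

lemma integral_inner_le_half_norms:
  assumes f: "L2_on S f" and g: "L2_on S g" and "\<delta> > 0"
  shows "\<bar>\<integral>x. f x \<bullet> g x \<partial>lebesgue_on S\<bar>
    \<le> ((\<integral>x. (norm (f x))\<^sup>2 \<partial>lebesgue_on S) / \<delta> + \<delta> * (\<integral>x. (norm (g x))\<^sup>2 \<partial>lebesgue_on S)) / 2"
proof -
  have pt: "\<bar>x \<bullet> y\<bar> \<le> ((norm x)\<^sup>2 / \<delta> + \<delta> * (norm y)\<^sup>2) / 2" for x y :: 'b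
  proof -
    have "\<bar>x \<bullet> y\<bar> \<le> norm x * norm y" by (rule Cauchy_Schwarz_ineq2)
    moreover have "2 * \<delta> * (norm x * norm y) \<le> (norm x)\<^sup>2 + \<delta>\<^sup>2 * (norm y)\<^sup>2"
      using sum_squares_bound[of "norm x" "\<delta> * norm y"] by (simp add: power_mult_distrib mult_ac)
    then have "2 * (norm x * norm y) \<le> (norm x)\<^sup>2 / \<delta> + \<delta> * (norm y)\<^sup>2"
      using \<open>\<delta> > 0\<close> by (simp add: field_simps power2_eq_square)
    then have "norm x * norm y \<le> ((norm x)\<^sup>2 / \<delta> + \<delta> * (norm y)\<^sup>2) / 2" by (simp only: mult.commute[of 2] le_divide_eq_numeral1)
    ultimately show ?thesis by (rule order_trans)
  qed
  have "\<bar>\<integral>x. f x \<bullet> g x \<partial>lebesgue_on S\<bar> \<le> (\<integral>x. \<bar>f x \<bullet> g x\<bar> \<partial>lebesgue_on S)"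
    using integral_norm_bound[of "lebesgue_on S" "\<lambda>x. f x \<bullet> g x"] by simp
  also have "\<dots> \<le> (\<integral>x. ((norm (f x))\<^sup>2 / \<delta> + \<delta> * (norm (g x))\<^sup>2) / 2 \<partial>lebesgue_on S)"
    using integrable_inner_L2[OF f g] L2_onD(2)[OF f] L2_onD(2)[OF g]
    by (intro integral_mono pt) (auto intro!: integrable_abs)
  also have "\<dots> = ((\<integral>x. (norm (f x))\<^sup>2 \<partial>lebesgue_on S) / \<delta> + \<delta> * (\<integral>x. (norm (g x))\<^sup>2 \<partial>lebesgue_on S)) / 2"
    using L2_onD(2)[OF f] L2_onD(2)[OF g] by simp
  finally show ?thesis .
qed

lemma L2_converges_on_inner:
  assumes u: "L2_converges_on S u f" and w: "L2_on S w"
  shows "(\<lambda>k. \<integral>x. u k x \<bullet> w x \<partial>lebesgue_on S) \<longlonglongrightarrow> (\<integral>x. f x \<bullet> w x \<partial>lebesgue_on S)"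
proof -
  note u = L2_converges_onD[OF u]
  define A where "A k = (\<integral>x. (norm (u k x - f x))\<^sup>2 \<partial>lebesgue_on S)" for k
  define C where "C = (\<integral>x. (norm (w x))\<^sup>2 \<partial>lebesgue_on S)"
  have A: "A k \<ge> 0" for k by (simp add: A_def)
  \<comment> \<open>The weight \<open>sqrt (A k)\<close> makes the first term of Young's inequality
    of order \<open>sqrt (A k)\<close>; \<open>1 / Suc k\<close> keeps it positive when
    \<open>A k = 0\<close>.\<close>
  define \<delta> where "\<delta> k = sqrt (A k) + 1 / Suc k" for k
  have \<delta>: "\<delta> k > 0" "\<delta> k \<ge> sqrt (A k)" for k using A[of k] by (auto simp: \<delta>_def intro: add_nonneg_pos)
  have "\<bar>(\<integral>x. u k x \<bullet> w x \<partial>lebesgue_on S) - (\<integral>x. f x \<bullet> w x \<partial>lebesgue_on S)\<bar> \<le> (sqrt (A k) + \<delta> k * C) / 2" for k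
  proof -
    have "(\<integral>x. u k x \<bullet> w x \<partial>lebesgue_on S) - (\<integral>x. f x \<bullet> w x \<partial>lebesgue_on S) = (\<integral>x. (u k x - f x) \<bullet> w x \<partial>lebesgue_on S)"
      using u w by (simp add: inner_diff_left integrable_inner_L2)
    also have "\<bar>\<dots>\<bar> \<le> (A k / \<delta> k + \<delta> k * C) / 2"
      unfolding A_def C_def using u w \<delta> by (intro integral_inner_le_half_norms L2_on_minus)
    also have "A k / \<delta> k \<le> sqrt (A k)"
    proof -
      have "A k = sqrt (A k) * sqrt (A k)" using A by simp
      also have "\<dots> \<le> sqrt (A k) * \<delta> k" using \<delta> A by (intro mult_left_mono) auto
      finally show ?thesis using \<delta>(1)[of k] by (simp add: divide_le_eq)
    qed
    finally show ?thesis by simp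
  qed
  note le = this
  have "(\<lambda>k. (sqrt (A k) + \<delta> k * C) / 2) \<longlonglongrightarrow> (sqrt 0 + (sqrt 0 + 0) * C) / 2"
    unfolding \<delta>_def using u(3) unfolding A_def[symmetric]
    by (intro tendsto_intros LIMSEQ_Suc lim_1_over_n) auto
  then have lim: "(\<lambda>k. (sqrt (A k) + \<delta> k * C) / 2) \<longlonglongrightarrow> 0" by simp
  have "(\<lambda>k. (\<integral>x. u k x \<bullet> w x \<partial>lebesgue_on S) - (\<integral>x. f x \<bullet> w x \<partial>lebesgue_on S)) \<longlonglongrightarrow> 0"
    by (rule Lim_null_comparison[OF always_eventually lim]) (simp only: le real_norm_def simp_thms)
  then show ?thesis by (rule LIM_zero_cancel)
qed

section \<open>Gradients of differentiable functions\<close>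

lemma grad_eqI: "(f has_derivative (\<lambda>v. D \<bullet> v)) (at x) \<Longrightarrow> grad f x = D"
  unfolding grad_def gderiv_def
proof (rule the_equality)
  assume d: "(f has_derivative (\<lambda>v. D \<bullet> v)) (at x)"
  then show "(f has_derivative (\<lambda>h. h \<bullet> D)) (at x)" by (simp add: inner_commute)
  fix D' assume "(f has_derivative (\<lambda>h. h \<bullet> D')) (at x)"
  from has_derivative_unique[OF this d] have "\<forall>v. v \<bullet> D' = v \<bullet> D" by (metis inner_commute)
  then show "D' = D" by (simp only: vector_eq_ldot)
qed

lemma has_derivative_grad:
  assumes "f differentiable (at x)"
  shows "(f has_derivative (\<lambda>v. grad f x \<bullet> v)) (at x)" and "grad f x \<bullet> v = frechet_derivative f (at x) v"
proof -
  let ?f' = "frechet_derivative f (at x)"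
  have d: "(f has_derivative ?f') (at x)" using assms by (simp add: frechet_derivative_works)
  then interpret bounded_linear ?f' by (rule has_derivative_bounded_linear)
  define D where "D = (\<Sum>b\<in>Basis. ?f' b *\<^sub>R b)"
  have eq: "?f' v = D \<bullet> v" for v
  proof -
    have "?f' v = ?f' (\<Sum>b\<in>Basis. (v \<bullet> b) *\<^sub>R b)" by (simp add: euclidean_representation)
    also have "\<dots> = (\<Sum>b\<in>Basis. (v \<bullet> b) * ?f' b)" by (simp add: sum scaleR)
    also have "\<dots> = (\<Sum>b\<in>Basis. ?f' b * (b \<bullet> v))" by (intro sum.cong refl) (simp add: inner_commute)
    also have "\<dots> = D \<bullet> v" unfolding D_def by (simp add: inner_sum_left)
    finally show ?thesis .
  qed
  then have "?f' = (\<lambda>v. D \<bullet> v)" by auto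
  with d have d': "(f has_derivative (\<lambda>v. D \<bullet> v)) (at x)" by simp
  then have "grad f x = D" by (rule grad_eqI)
  then show "(f has_derivative (\<lambda>v. grad f x \<bullet> v)) (at x)" "grad f x \<bullet> v = ?f' v" using d' eq by auto
qed

definition C1 :: "('a::euclidean_space \<Rightarrow> real) \<Rightarrow> bool" where
  "C1 f \<longleftrightarrow> (\<forall>x. f differentiable (at x)) \<and> continuous_on UNIV (grad f)"

lemma C1D:
  assumes "C1 f"
  shows "(f has_derivative (\<lambda>v. grad f x \<bullet> v)) (at x)" "continuous_on UNIV f" "continuous_on UNIV (grad f)"
proof -
  show "(f has_derivative (\<lambda>v. grad f x \<bullet> v)) (at x)" using assms has_derivative_grad(1)[of f x] by (simp add: C1_def)
  show "continuous_on UNIV f"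
    using assms unfolding C1_def by (intro continuous_at_imp_continuous_on) (simp add: differentiable_imp_continuous_within)
  show "continuous_on UNIV (grad f)" using assms by (simp add: C1_def)
qed

text \<open>A directional derivative of a smooth function is again smooth, hence continuous, and the
  gradient is assembled from those along \<open>Basis\<close>.\<close>

lemma smooth_imp_C1: 
  assumes "smooth f"
  shows "C1 f"
proof -
  have d: "smooth f \<Longrightarrow> f differentiable (at x)" for x and f :: "'a \<Rightarrow> real"
    by (erule smooth.cases) simp
  have "smooth (\<lambda>x. frechet_derivative f (at x) v)" for v
    using assms by (rule smooth.cases) simp
  then have "continuous_on UNIV (\<lambda>x. frechet_derivative f (at x) v)" for v
    using d by (intro continuous_at_imp_continuous_on ballI differentiable_imp_continuous_within) auto
  then have "continuous_on UNIV (\<lambda>x. \<Sum>b\<in>Basis. (frechet_derivative f (at x) b) *\<^sub>R b)"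
    by (intro continuous_intros)
  moreover have "grad f x = (\<Sum>b\<in>Basis. (frechet_derivative f (at x) b) *\<^sub>R b)" for x
    using has_derivative_grad(2)[OF d[OF assms]] euclidean_representation[of "grad f x"] by simp
  ultimately show ?thesis using d[OF assms] by (simp add: C1_def)
qed

lemma C1_linear_combination:
  assumes "\<And>i. i \<in> I \<Longrightarrow> C1 (f i)"
  shows "C1 (\<lambda>x. \<Sum>i\<in>I. a i * f i x)" and "grad (\<lambda>x. \<Sum>i\<in>I. a i * f i x) = (\<lambda>x. \<Sum>i\<in>I. a i *\<^sub>R grad (f i) x)"
proof -
  have d: "((\<lambda>x. \<Sum>i\<in>I. a i * f i x) has_derivative (\<lambda>v. (\<Sum>i\<in>I. a i *\<^sub>R grad (f i) x) \<bullet> v)) (at x)" for x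
  proof -
    have "((\<lambda>x. \<Sum>i\<in>I. a i * f i x) has_derivative (\<lambda>v. \<Sum>i\<in>I. a i * (grad (f i) x \<bullet> v))) (at x)"
      using C1D(1)[OF assms] by (intro has_derivative_sum has_derivative_mult_right)
    then show ?thesis by (simp add: inner_sum_left)
  qed
  then show g: "grad (\<lambda>x. \<Sum>i\<in>I. a i * f i x) = (\<lambda>x. \<Sum>i\<in>I. a i *\<^sub>R grad (f i) x)"
    using grad_eqI by blast
  have "continuous_on UNIV (\<lambda>x. \<Sum>i\<in>I. a i *\<^sub>R grad (f i) x)"
    using C1D(3)[OF assms] by (intro continuous_intros)
  then show "C1 (\<lambda>x. \<Sum>i\<in>I. a i * f i x)"
    unfolding C1_def g using d by (auto simp: differentiable_def)
qed

lemma C1_directional_derivative: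
  assumes "C1 f"
  shows "((\<lambda>s. f (x + s *\<^sub>R e)) has_real_derivative grad f (x + s *\<^sub>R e) \<bullet> e) (at s)"
proof -
  have "((\<lambda>s. f (x + s *\<^sub>R e)) has_derivative (\<lambda>h. grad f (x + s *\<^sub>R e) \<bullet> (0 + h *\<^sub>R e))) (at s)"
    by (rule has_derivative_compose[OF _ C1D(1)[OF assms]]) (auto intro!: derivative_eq_intros)
  then show ?thesis by (simp add: has_field_derivative_def mult_commute_abs)
qed

section \<open>Domains with a free boundary\<close>

text \<open>A consequence of \<open>H1_dirichlet\<close> with \<open>C1\<close> approximants, in
  which \<open>g\<close> enters only as the limit of their gradients. In this form a combination of
  approximants visibly approximates the combination of the limits.\<close>

definition dirichlet_limit ::
  "('a::euclidean_space \<times> real) set \<Rightarrow> 'a set \<Rightarrow> ('a \<times> real) set \<Rightarrow>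
   ('a \<times> real \<Rightarrow> real) \<Rightarrow> ('a \<times> real \<Rightarrow> 'a \<times> real) \<Rightarrow> ('a \<Rightarrow> real) \<Rightarrow> bool" where
  "dirichlet_limit \<Omega> F B f g t \<longleftrightarrow>
     (\<exists>\<phi>. (\<forall>k. C1 (\<phi> k) \<and> (\<forall>x\<in>B. \<phi> k x = 0)) \<and>
          L2_converges_on \<Omega> \<phi> f \<and>
          L2_converges_on \<Omega> (\<lambda>k. grad (\<phi> k)) g \<and>
          L2_converges_on F (\<lambda>k x. \<phi> k (x, 0)) t)"

lemma H1_dirichlet_imp_dirichlet_limit:
  "H1_dirichlet \<Omega> F B f g t \<Longrightarrow> dirichlet_limit \<Omega> F B f g t"
  unfolding H1_dirichlet_def dirichlet_limit_def using smooth_imp_C1 by blast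

lemma dirichlet_limitE:
  assumes "dirichlet_limit \<Omega> F B f g t"
  obtains \<phi> where "\<And>k. C1 (\<phi> k)" "\<And>k x. x \<in> B \<Longrightarrow> \<phi> k x = 0" "L2_converges_on \<Omega> \<phi> f"
    "L2_converges_on \<Omega> (\<lambda>k. grad (\<phi> k)) g" "L2_converges_on F (\<lambda>k x. \<phi> k (x, 0)) t"
  using assms unfolding dirichlet_limit_def by blast

lemma dirichlet_limit_L2:
  assumes "dirichlet_limit \<Omega> F B f g t"
  shows "L2_on \<Omega> f" "L2_on \<Omega> g" "L2_on F t"
  using assms unfolding dirichlet_limit_def by (auto simp: L2_converges_on_def)

lemma dirichlet_limit_linear_combination:
  assumes "finite I" and d: "\<And>i. i \<in> I \<Longrightarrow> dirichlet_limit \<Omega> F B (f i) (g i) (t i)"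
  shows "dirichlet_limit \<Omega> F B (\<lambda>x. \<Sum>i\<in>I. a i * f i x) (\<lambda>x. \<Sum>i\<in>I. a i *\<^sub>R g i x) (\<lambda>x. \<Sum>i\<in>I. a i * t i x)"
proof -
  have "\<forall>i\<in>I. \<exists>\<phi>. (\<forall>k. C1 (\<phi> k) \<and> (\<forall>x\<in>B. \<phi> k x = 0)) \<and> L2_converges_on \<Omega> \<phi> (f i) \<and>
          L2_converges_on \<Omega> (\<lambda>k. grad (\<phi> k)) (g i) \<and> L2_converges_on F (\<lambda>k x. \<phi> k (x, 0)) (t i)"
    using d unfolding dirichlet_limit_def by blast
  from bchoice[OF this] obtain \<phi> where \<phi>: "\<And>i k. i \<in> I \<Longrightarrow> C1 (\<phi> i k)" "\<And>i k x. i \<in> I \<Longrightarrow> x \<in> B \<Longrightarrow> \<phi> i k x = 0"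
    "\<And>i. i \<in> I \<Longrightarrow> L2_converges_on \<Omega> (\<phi> i) (f i)" "\<And>i. i \<in> I \<Longrightarrow> L2_converges_on \<Omega> (\<lambda>k. grad (\<phi> i k)) (g i)"
    "\<And>i. i \<in> I \<Longrightarrow> L2_converges_on F (\<lambda>k x. \<phi> i k (x, 0)) (t i)" by blast
  have "L2_converges_on \<Omega> (\<lambda>k x. \<Sum>i\<in>I. a i *\<^sub>R \<phi> i k x) (\<lambda>x. \<Sum>i\<in>I. a i *\<^sub>R f i x)"
    by (rule L2_converges_on_sum[OF \<open>finite I\<close> L2_converges_on_scaleR]) (rule \<phi>(3))
  moreover have "L2_converges_on \<Omega> (\<lambda>k x. \<Sum>i\<in>I. a i *\<^sub>R grad (\<phi> i k) x) (\<lambda>x. \<Sum>i\<in>I. a i *\<^sub>R g i x)"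
    by (rule L2_converges_on_sum[OF \<open>finite I\<close> L2_converges_on_scaleR]) (rule \<phi>(4))
  moreover have "L2_converges_on F (\<lambda>k x. \<Sum>i\<in>I. a i *\<^sub>R \<phi> i k (x, 0)) (\<lambda>x. \<Sum>i\<in>I. a i *\<^sub>R t i x)"
    by (rule L2_converges_on_sum[OF \<open>finite I\<close> L2_converges_on_scaleR]) (rule \<phi>(5))
  moreover have "C1 (\<lambda>x. \<Sum>i\<in>I. a i * \<phi> i k x)" "grad (\<lambda>x. \<Sum>i\<in>I. a i * \<phi> i k x) = (\<lambda>x. \<Sum>i\<in>I. a i *\<^sub>R grad (\<phi> i k) x)" for k
    using C1_linear_combination[of I "\<lambda>i. \<phi> i k" a] \<phi>(1) by auto
  moreover have "(\<Sum>i\<in>I. a i * \<phi> i k x) = 0" if "x \<in> B" for k x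
    using \<phi>(2) that by simp
  ultimately show ?thesis unfolding dirichlet_limit_def
    by (intro exI[of _ "\<lambda>k x. \<Sum>i\<in>I. a i * \<phi> i k x"]) simp
qed

lemma sum_Basis_prod_real:
  "(\<Sum>e\<in>(Basis :: ('a::euclidean_space \<times> real) set). f e) = (\<Sum>b\<in>Basis. f (b, 0)) + f (0, 1)"
  unfolding Basis_prod_def by (subst sum.union_disjoint) (auto simp: sum.reindex inj_on_def)

locale free_boundary_domain =
  fixes \<Omega> :: "('a::euclidean_space \<times> real) set" and F :: "'a set" and B :: "('a \<times> real) set"
  assumes open_domain: "open \<Omega>" and bounded_domain: "bounded \<Omega>"
    and frontier_domain: "frontier \<Omega> = F \<times> {0} \<union> B"
    and below: "B \<subseteq> {x. snd x < 0}" and cylinder: "\<Omega> \<subseteq> F \<times> {..0}"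
begin

text \<open>By openness, a point of \<open>\<Omega>\<close> can be raised slightly inside
  \<open>\<Omega>\<close>, and the raised point still has height at most 0.\<close>

lemma domain_below: "\<Omega> \<subseteq> {x. snd x < 0}"
proof safe
  fix x s assume xs: "(x, s) \<in> \<Omega>"
  obtain \<delta> where \<delta>: "\<delta> > 0" "ball (x, s) \<delta> \<subseteq> \<Omega>" using open_domain xs open_contains_ball by blast
  then have "(x, s + \<delta> / 2) \<in> \<Omega>" by (auto simp: dist_Pair_Pair dist_real_def subset_eq)
  then show "snd (x, s) < 0" using cylinder \<delta>(1) by auto
qed

lemma in_F_iff: "x \<in> F \<longleftrightarrow> (x, 0) \<in> frontier \<Omega>"
  using frontier_domain below by auto

lemma in_B_iff: "p \<in> B \<longleftrightarrow> p \<in> frontier \<Omega> \<and> snd p < 0"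
  using frontier_domain below by auto

lemma closure_domain: "closure \<Omega> = \<Omega> \<union> F \<times> {0} \<union> B"
  using closure_Un_frontier[of \<Omega>] frontier_domain by auto

lemma compact_F: "compact F"
proof -
  have "F = fst ` (frontier \<Omega> \<inter> {p. snd p = 0})" using in_F_iff by (force simp: image_iff)
  moreover have "compact (frontier \<Omega> \<inter> {p. snd p = 0})"
    using bounded_domain by (intro compact_Int_closed compact_frontier_bounded closed_Collect_eq continuous_intros)
  then have "compact (fst ` (frontier \<Omega> \<inter> {p. snd p = 0}))"
    by (intro compact_continuous_image continuous_on_fst continuous_on_id)
  ultimately show ?thesis by simp
qed

lemma F_borel [measurable]: "F \<in> sets borel" and bounded_F: "bounded F"
  using compact_F by (auto simp: compact_imp_closed compact_imp_bounded)

lemma domain_borel [measurable]: "\<Omega> \<in> sets borel" 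
  using open_domain by simp

lemma half_ball:
  assumes "continuous_on UNIV \<phi>" "\<And>p. p \<in> B \<Longrightarrow> \<phi> p = 0" "x \<in> F" "\<phi> (x, 0) \<noteq> (0::real)"
  obtains \<delta> where "\<delta> > 0" "ball (x, 0) \<delta> \<inter> {y. snd y < 0} \<subseteq> \<Omega>"
  using half_ball_subset[OF domain_below _ assms(1), of x] assms in_B_iff closure_domain by blast

lemma integral_horizontal_derivative:
  assumes V: "continuous_on UNIV V" "continuous_on UNIV V'"
    and der: "\<And>x s. ((\<lambda>s. V (x + s *\<^sub>R (e, 0))) has_real_derivative V' (x + s *\<^sub>R (e, 0))) (at s)"
    and B: "\<And>p. p \<in> B \<Longrightarrow> V p = 0"
  shows "(\<integral>x. V' x \<partial>lebesgue_on \<Omega>) = 0"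
  by (rule integral_directional_derivative_eq_0[OF open_domain bounded_domain domain_below _ V der])
     (use B in_B_iff in auto)

text \<open>The field is \<open>\<phi> * G\<close>, and \<open>G' e\<close> is the derivative of its
  factor's \<open>e\<close>-component along \<open>e\<close>. Horizontal lines through
  \<open>\<Omega>\<close> stay below height 0, where the frontier is \<open>B\<close> and the field
  vanishes; only the vertical direction leaves a boundary term, on \<open>F\<close>.\<close>

lemma integral_divergence:
  fixes G :: "'a \<times> real \<Rightarrow> 'a \<times> real" and G' :: "'a \<times> real \<Rightarrow> 'a \<times> real \<Rightarrow> real"
  assumes \<phi>: "C1 \<phi>" "\<And>p. p \<in> B \<Longrightarrow> \<phi> p = 0"
    and G: "continuous_on UNIV G" "\<And>e. e \<in> Basis \<Longrightarrow> continuous_on UNIV (G' e)"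
    and der: "\<And>e x s. e \<in> Basis \<Longrightarrow> ((\<lambda>s. G (x + s *\<^sub>R e) \<bullet> e) has_real_derivative G' e (x + s *\<^sub>R e)) (at s)"
  shows "(\<integral>x. grad \<phi> x \<bullet> G x + \<phi> x * (\<Sum>e\<in>Basis. G' e x) \<partial>lebesgue_on \<Omega>)
    = (\<integral>x. \<phi> (x, 0) * snd (G (x, 0)) \<partial>lebesgue_on F)"
proof -
  note \<phi>' = C1D[OF \<phi>(1)]
  define V where "V e x = \<phi> x * (G x \<bullet> e)" for e x
  define V' where "V' e x = (grad \<phi> x \<bullet> e) * (G x \<bullet> e) + \<phi> x * G' e x" for e x
  have cV: "continuous_on UNIV (V e)" for e
    unfolding V_def[abs_def] by (intro continuous_intros \<phi>' G)
  have cV': "continuous_on UNIV (V' e)" if "e \<in> Basis" for e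
    unfolding V'_def[abs_def] by (intro continuous_intros \<phi>' G that)
  have dV: "((\<lambda>s. V e (x + s *\<^sub>R e)) has_real_derivative V' e (x + s *\<^sub>R e)) (at s)" if "e \<in> Basis" for e x s
    unfolding V_def V'_def using DERIV_mult[OF C1_directional_derivative[OF \<phi>(1)] der[OF that]]
    by (simp add: algebra_simps)
  have iV': "integrable (lebesgue_on \<Omega>) (V' e)" if "e \<in> Basis" for e
    using integrable_inner_L2[OF L2_on_continuous[OF cV'[OF that] bounded_domain domain_borel]
      L2_on_continuous[OF continuous_on_const[of _ 1] bounded_domain domain_borel]] by simp
  have hor: "(\<integral>x. V' (b, 0) x \<partial>lebesgue_on \<Omega>) = 0" if "b \<in> Basis" for b
    by (rule integral_horizontal_derivative[OF cV cV' dV]) (use that \<phi> in \<open>auto simp: Basis_prod_def V_def\<close>)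
  have e1: "(0, 1) \<in> (Basis :: ('a \<times> real) set)" by (simp add: Basis_prod_def)
  have ver: "(\<integral>x. V' (0, 1) x \<partial>lebesgue_on \<Omega>) = (\<integral>x. V (0, 1) (x, 0) \<partial>lebesgue_on F)"
  proof (rule integral_vertical_derivative[OF open_domain bounded_domain domain_below F_borel cV cV'[OF e1]])
    fix x s
    show "((\<lambda>s. V (0, 1) (x, s)) has_real_derivative V' (0, 1) (x, s)) (at s)"
      using dV[OF e1, of "(x, 0)" s] by simp
  next
    fix x assume "x \<in> F" "V (0, 1) (x, 0) \<noteq> 0"
    then show "\<exists>\<delta>>0. ball (x, 0) \<delta> \<inter> {y. snd y < 0} \<subseteq> \<Omega>"
      using half_ball[OF \<phi>'(2) \<phi>(2)] by (metis V_def mult_eq_0_iff)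
  qed (use closure_domain domain_below below in_B_iff \<phi>(2) in \<open>auto simp: V_def\<close>)
  have "grad \<phi> x \<bullet> G x + \<phi> x * (\<Sum>e\<in>Basis. G' e x) = (\<Sum>e\<in>Basis. V' e x)" for x
    unfolding V'_def sum.distrib sum_distrib_left[symmetric] by (simp only: euclidean_inner[of "grad \<phi> x" "G x"])
  then have "(\<integral>x. grad \<phi> x \<bullet> G x + \<phi> x * (\<Sum>e\<in>Basis. G' e x) \<partial>lebesgue_on \<Omega>) = (\<Sum>e\<in>Basis. \<integral>x. V' e x \<partial>lebesgue_on \<Omega>)"
    using iV' by simp
  also have "\<dots> = (\<Sum>b\<in>Basis. \<integral>x. V' (b, 0) x \<partial>lebesgue_on \<Omega>) + (\<integral>x. V' (0, 1) x \<partial>lebesgue_on \<Omega>)"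
    by (rule sum_Basis_prod_real)
  also have "\<dots> = (\<integral>x. \<phi> (x, 0) * snd (G (x, 0)) \<partial>lebesgue_on F)"
    unfolding ver using hor by (simp add: V_def inner_Pair_0)
  finally show ?thesis .
qed

text \<open>The horizontal derivative of \<open>(p \<bullet> e) * (\<phi> p)\<^sup>2\<close> has
  integral 0, and one of its terms is the square of \<open>\<phi>\<close>. A horizontal
  \<open>e\<close> is taken because that direction produces no boundary term on
  \<open>F\<close>.\<close>

lemma poincare:
  assumes \<phi>: "C1 \<phi>" "\<And>p. p \<in> B \<Longrightarrow> \<phi> p = 0" and r: "r \<ge> 0" "\<And>p. p \<in> \<Omega> \<Longrightarrow> norm p \<le> r"
  shows "(\<integral>x. (\<phi> x)\<^sup>2 \<partial>lebesgue_on \<Omega>) \<le> 4 * r\<^sup>2 * (\<integral>x. (norm (grad \<phi> x))\<^sup>2 \<partial>lebesgue_on \<Omega>)"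
proof -
  note \<phi>' = C1D[OF \<phi>(1)]
  obtain b :: 'a where b: "b \<in> Basis" using nonempty_Basis by blast
  define e :: "'a \<times> real" where "e = (b, 0)"
  have ne: "norm e = 1" "e \<bullet> e = 1" using b by (auto simp: e_def)
  define V where "V p = (p \<bullet> e) * (\<phi> p)\<^sup>2" for p
  define V' where "V' p = (\<phi> p)\<^sup>2 + (p \<bullet> e) * (2 * \<phi> p * (grad \<phi> p \<bullet> e))" for p
  have c: "continuous_on UNIV V" "continuous_on UNIV V'"
    unfolding V_def[abs_def] V'_def[abs_def] by (intro continuous_intros \<phi>')+
  have "(\<integral>x. V' x \<partial>lebesgue_on \<Omega>) = 0"
  proof (rule integral_horizontal_derivative[OF c, of b])
    fix x :: "'a \<times> real" and s :: real
    have 1: "((\<lambda>s. (x + s *\<^sub>R e) \<bullet> e) has_real_derivative 1) (at s)"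
      using ne by (auto intro!: derivative_eq_intros simp: inner_add_left)
    have "((\<lambda>s. ((x + s *\<^sub>R e) \<bullet> e) * (\<phi> (x + s *\<^sub>R e) * \<phi> (x + s *\<^sub>R e))) has_real_derivative V' (x + s *\<^sub>R e)) (at s)"
      using DERIV_mult[OF 1 DERIV_mult[OF C1_directional_derivative[OF \<phi>(1), of x e s] C1_directional_derivative[OF \<phi>(1), of x e s]]]
      by (rule back_subst) (simp add: V'_def power2_eq_square algebra_simps)
    then show "((\<lambda>s. V (x + s *\<^sub>R (b, 0))) has_real_derivative V' (x + s *\<^sub>R (b, 0))) (at s)"
      by (simp add: V_def e_def power2_eq_square)
  qed (simp add: V_def \<phi>)
  have i: "integrable (lebesgue_on \<Omega>) w" if "continuous_on UNIV w" for w :: "'a \<times> real \<Rightarrow> real"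
    using integrable_inner_L2[OF L2_on_continuous[OF that bounded_domain domain_borel]
      L2_on_continuous[OF continuous_on_const[of _ 1] bounded_domain domain_borel]] by simp
  have i1: "integrable (lebesgue_on \<Omega>) (\<lambda>x. (\<phi> x)\<^sup>2)" and i2: "integrable (lebesgue_on \<Omega>) (\<lambda>x. (norm (grad \<phi> x))\<^sup>2)"
    and i3: "integrable (lebesgue_on \<Omega>) V'"
    by (intro i c continuous_intros \<phi>')+
  \<comment> \<open>With q = \<open>(p \<bullet> e) * (grad \<phi> p \<bullet> e)\<close>, the
    square of \<open>\<phi> p + 2 * q\<close> being nonnegative bounds the mixed term
    \<open>2 * \<phi> p * q\<close> below by minus half the square of \<open>\<phi> p\<close> minus
    twice that of q. The first loss leaves half of the square of \<open>\<phi>\<close>, whence the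
    constant 4.\<close>
  have pt: "(\<phi> p)\<^sup>2 / 2 - 2 * r\<^sup>2 * (norm (grad \<phi> p))\<^sup>2 \<le> V' p" if "p \<in> \<Omega>" for p
  proof -
    have "\<bar>p \<bullet> e\<bar> \<le> r" using Cauchy_Schwarz_ineq2[of p e] ne r(2)[OF that] by simp
    moreover have "\<bar>grad \<phi> p \<bullet> e\<bar> \<le> norm (grad \<phi> p)" using Cauchy_Schwarz_ineq2[of "grad \<phi> p" e] ne by simp
    ultimately have "\<bar>(p \<bullet> e) * (grad \<phi> p \<bullet> e)\<bar> \<le> r * norm (grad \<phi> p)"
      unfolding abs_mult using r by (intro mult_mono) auto
    then have "((p \<bullet> e) * (grad \<phi> p \<bullet> e))\<^sup>2 \<le> (r * norm (grad \<phi> p))\<^sup>2" by (rule abs_le_square_iff[THEN iffD1, OF order_trans]) simp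
    moreover have "0 \<le> (\<phi> p + 2 * ((p \<bullet> e) * (grad \<phi> p \<bullet> e)))\<^sup>2" by simp
    then have "0 \<le> (\<phi> p)\<^sup>2 + 4 * \<phi> p * ((p \<bullet> e) * (grad \<phi> p \<bullet> e)) + 4 * ((p \<bullet> e) * (grad \<phi> p \<bullet> e))\<^sup>2"
      by (simp add: power2_eq_square algebra_simps)
    ultimately have "0 \<le> (\<phi> p)\<^sup>2 + 4 * \<phi> p * ((p \<bullet> e) * (grad \<phi> p \<bullet> e)) + 4 * (r * norm (grad \<phi> p))\<^sup>2" by linarith
    then show ?thesis by (simp add: V'_def power_mult_distrib algebra_simps)
  qed
  have "(\<integral>x. (\<phi> x)\<^sup>2 / 2 - 2 * r\<^sup>2 * (norm (grad \<phi> x))\<^sup>2 \<partial>lebesgue_on \<Omega>) \<le> (\<integral>x. V' x \<partial>lebesgue_on \<Omega>)"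
    using i1 i2 i3 pt by (intro integral_mono) auto
  then show ?thesis using i1 i2 \<open>(\<integral>x. V' x \<partial>lebesgue_on \<Omega>) = 0\<close> by simp
qed

text \<open>The Poincare inequality for the approximants, carried to the limit. It is what makes the
  trace form positive definite on an eigenspace.\<close>

lemma zero_gradient_imp_zero:
  assumes d: "dirichlet_limit \<Omega> F B f g t" and g: "(\<integral>x. (norm (g x))\<^sup>2 \<partial>lebesgue_on \<Omega>) = 0"
  shows "AE x in lebesgue_on \<Omega>. f x = 0"
proof -
  obtain \<phi> where \<phi>: "\<And>k. C1 (\<phi> k)" "\<And>k x. x \<in> B \<Longrightarrow> \<phi> k x = 0" "L2_converges_on \<Omega> \<phi> f"
    "L2_converges_on \<Omega> (\<lambda>k. grad (\<phi> k)) g"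
    using dirichlet_limitE[OF d] by metis
  note f = L2_converges_onD[OF \<phi>(3)] and gg = L2_converges_onD[OF \<phi>(4)]
  obtain r where r: "r > 0" "\<And>p. p \<in> \<Omega> \<Longrightarrow> norm p \<le> r" using bounded_domain bounded_pos by metis
  let ?A = "\<lambda>k. \<integral>x. (norm (\<phi> k x - f x))\<^sup>2 \<partial>lebesgue_on \<Omega>" and ?D = "\<lambda>k. \<integral>x. (norm (grad (\<phi> k) x - g x))\<^sup>2 \<partial>lebesgue_on \<Omega>"
  \<comment> \<open>The constant 16 is 2 * 4 * 2: two applications of the parallelogram bound and
    the Poincare constant between them.\<close>
  have bound: "(\<integral>x. (f x)\<^sup>2 \<partial>lebesgue_on \<Omega>) \<le> 2 * ?A k + 16 * r\<^sup>2 * ?D k" for k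
  proof -
    have i: "integrable (lebesgue_on \<Omega>) (\<lambda>x. (norm (\<phi> k x - f x))\<^sup>2)" "integrable (lebesgue_on \<Omega>) (\<lambda>x. (norm (grad (\<phi> k) x - g x))\<^sup>2)"
      "integrable (lebesgue_on \<Omega>) (\<lambda>x. (norm (\<phi> k x))\<^sup>2)" "integrable (lebesgue_on \<Omega>) (\<lambda>x. (norm (f x))\<^sup>2)"
      "integrable (lebesgue_on \<Omega>) (\<lambda>x. (norm (grad (\<phi> k) x))\<^sup>2)" "integrable (lebesgue_on \<Omega>) (\<lambda>x. (norm (g x))\<^sup>2)"
      using f gg by (intro L2_onD(2) L2_on_minus; blast)+
    have "(\<integral>x. (f x)\<^sup>2 \<partial>lebesgue_on \<Omega>) \<le> (\<integral>x. 2 * (norm (\<phi> k x - f x))\<^sup>2 + 2 * (norm (\<phi> k x))\<^sup>2 \<partial>lebesgue_on \<Omega>)"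
    proof (rule integral_mono)
      fix x show "(f x)\<^sup>2 \<le> 2 * (norm (\<phi> k x - f x))\<^sup>2 + 2 * (norm (\<phi> k x))\<^sup>2"
        using power2_norm_add_le[of "f x - \<phi> k x" "\<phi> k x"] by (simp add: power2_commute)
    qed (use i in auto)
    moreover have "(\<integral>x. (norm (grad (\<phi> k) x))\<^sup>2 \<partial>lebesgue_on \<Omega>)
        \<le> (\<integral>x. 2 * (norm (grad (\<phi> k) x - g x))\<^sup>2 + 2 * (norm (g x))\<^sup>2 \<partial>lebesgue_on \<Omega>)"
    proof (rule integral_mono)
      fix x show "(norm (grad (\<phi> k) x))\<^sup>2 \<le> 2 * (norm (grad (\<phi> k) x - g x))\<^sup>2 + 2 * (norm (g x))\<^sup>2"
        using power2_norm_add_le[of "grad (\<phi> k) x - g x" "g x"] by simp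
    qed (use i in auto)
    then have "(\<integral>x. (norm (grad (\<phi> k) x))\<^sup>2 \<partial>lebesgue_on \<Omega>) \<le> 2 * ?D k" using i g by simp
    then have "4 * r\<^sup>2 * (\<integral>x. (norm (grad (\<phi> k) x))\<^sup>2 \<partial>lebesgue_on \<Omega>) \<le> 4 * r\<^sup>2 * (2 * ?D k)"
      by (intro mult_left_mono) auto
    moreover have "(\<integral>x. (\<phi> k x)\<^sup>2 \<partial>lebesgue_on \<Omega>) \<le> 4 * r\<^sup>2 * (\<integral>x. (norm (grad (\<phi> k) x))\<^sup>2 \<partial>lebesgue_on \<Omega>)"
      using \<phi>(1,2) r by (intro poincare) auto
    ultimately show ?thesis using i by simp
  qed
  have "(\<lambda>k. 2 * ?A k + 16 * r\<^sup>2 * ?D k) \<longlonglongrightarrow> 2 * 0 + 16 * r\<^sup>2 * 0"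
    using f(3) gg(3) by (intro tendsto_intros)
  then have "(\<integral>x. (f x)\<^sup>2 \<partial>lebesgue_on \<Omega>) \<le> 2 * 0 + 16 * r\<^sup>2 * 0"
    by (rule LIMSEQ_le_const) (use bound in blast)
  then have "(\<integral>x. (f x)\<^sup>2 \<partial>lebesgue_on \<Omega>) = 0"
    by (simp add: order_antisym)
  moreover have "integrable (lebesgue_on \<Omega>) (\<lambda>x. (f x)\<^sup>2)" using L2_onD(2)[OF f(2)] by simp
  ultimately have "AE x in lebesgue_on \<Omega>. (f x)\<^sup>2 = 0"
    using integral_nonneg_eq_0_iff_AE[of "lebesgue_on \<Omega>" "\<lambda>x. (f x)\<^sup>2"] by simp
  then show ?thesis by simp
qed

text \<open>Where the trace is nonzero, a half ball below lies in \<open>\<Omega>\<close>, so by the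
  cylinder condition the nearby points of the hyperplane belong to \<open>F\<close>. Hence the trace
  vanishes outside the interior of \<open>F\<close>, and its extension by zero can be approximated
  uniformly on the cube.\<close>

lemma continuous_trace:
  assumes \<phi>: "continuous_on UNIV \<phi>" "\<And>p. p \<in> B \<Longrightarrow> \<phi> p = (0::real)"
  shows "continuous_on UNIV (\<lambda>x. if x \<in> F then \<phi> (x, 0) else 0)"
proof -
  have int: "x \<in> interior F" if x: "x \<in> F" "\<phi> (x, 0) \<noteq> 0" for x
  proof -
    obtain \<delta> where \<delta>: "\<delta> > 0" "ball (x, 0) \<delta> \<inter> {y. snd y < 0} \<subseteq> \<Omega>"
      using half_ball[OF \<phi> x] by metis
    have "ball x (\<delta> / 2) \<subseteq> F"
    proof
      fix y assume "y \<in> ball x (\<delta> / 2)"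
      then have "dist (x, 0) (y, - \<delta> / 4) < \<delta>" 
        using dist_triangle[of "(x, 0)" "(y, - \<delta> / 4)" "(y, 0::real)"] \<delta>(1)
        by (auto simp: dist_Pair_Pair dist_real_def)
      then have "(y, - \<delta> / 4) \<in> \<Omega>" using \<delta> by auto
      then show "y \<in> F" using cylinder by auto
    qed
    then show ?thesis using \<delta>(1) by (auto simp: mem_interior intro!: exI[of _ "\<delta> / 2"])
  qed
  have c: "continuous_on UNIV (\<lambda>x. \<phi> (x, 0))"
    by (rule continuous_on_compose2[OF \<phi>(1)]) (auto intro!: continuous_intros)
  have "continuous_on UNIV (\<lambda>x. if x \<in> interior F then \<phi> (x, 0) else 0)"
  proof (rule continuous_on_restrict_vanishing_frontier[OF open_interior c])
    fix x assume "x \<in> frontier (interior F) \<inter> UNIV"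
    then have "x \<in> closure (interior F)" "x \<notin> interior F" by (auto simp: frontier_def)
    moreover have "closure (interior F) \<subseteq> F"
      using compact_F by (simp add: closure_minimal interior_subset compact_imp_closed)
    ultimately show "\<phi> (x, 0) = 0" using int by blast
  qed
  moreover have "(if x \<in> interior F then \<phi> (x, 0) else 0) = (if x \<in> F then \<phi> (x, 0) else 0)" for x
    using int interior_subset[of F] by auto
  ultimately show ?thesis by simp
qed

end

section \<open>Fourier coefficients of traces\<close>

definition fourier_coeff :: "'a::euclidean_space set \<Rightarrow> ('a \<Rightarrow> real) \<Rightarrow> 'a \<Rightarrow> complex" where
  "fourier_coeff F t \<xi> = (\<integral>x. t x *\<^sub>R cis (\<xi> \<bullet> x) \<partial>lebesgue_on F)"

lemma integrable_fourier:
  assumes "L2_on F t" "bounded F" "F \<in> sets borel"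
  shows "integrable (lebesgue_on F) (\<lambda>x. t x *\<^sub>R cis (\<xi> \<bullet> x))"
proof -
  have i: "integrable (lebesgue_on F) (\<lambda>x. t x * w x)" if "continuous_on UNIV w" for w :: "'a \<Rightarrow> real"
    using integrable_inner_L2[OF assms(1) L2_on_continuous[OF that assms(2,3)]] by simp
  have "integrable (lebesgue_on F) (\<lambda>x. complex_of_real (t x * cos (\<xi> \<bullet> x)) + \<i> * complex_of_real (t x * sin (\<xi> \<bullet> x)))"
    by (intro Bochner_Integration.integrable_add integrable_mult_right integrable_of_real i continuous_intros)
  moreover have "complex_of_real (t x * cos (\<xi> \<bullet> x)) + \<i> * complex_of_real (t x * sin (\<xi> \<bullet> x)) = t x *\<^sub>R cis (\<xi> \<bullet> x)" for x
    by (simp add: complex_eq_iff)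
  ultimately show ?thesis by simp
qed

lemma integral_times_Re_cis:
  assumes "L2_on F t" "bounded F" "F \<in> sets borel"
  shows "(\<integral>x. t x * Re (c * cis (\<xi> \<bullet> x)) \<partial>lebesgue_on F) = Re (c * fourier_coeff F t \<xi>)"
proof -
  note i = integrable_fourier[OF assms, of \<xi>]
  have "Re (c * fourier_coeff F t \<xi>) = Re (\<integral>x. c * (t x *\<^sub>R cis (\<xi> \<bullet> x)) \<partial>lebesgue_on F)"
    unfolding fourier_coeff_def by (simp only: integral_mult_right_zero)
  also have "\<dots> = (\<integral>x. Re (c * (t x *\<^sub>R cis (\<xi> \<bullet> x))) \<partial>lebesgue_on F)"
    using i by (intro integral_Re[symmetric] integrable_mult_right)
  also have "\<dots> = (\<integral>x. t x * Re (c * cis (\<xi> \<bullet> x)) \<partial>lebesgue_on F)"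
    by (intro Bochner_Integration.integral_cong) (simp_all add: algebra_simps)
  finally show ?thesis ..
qed

text \<open>A trigonometric polynomial \<open>p\<close> close to \<open>t\<close> on
  \<open>F\<close> and small on the rest of the cube is found first. Its coefficients
  \<open>c\<close> are not the Fourier coefficients of \<open>t\<close>, but completing the square
  shows that the latter do at least as well; enlarging the frequency set only adds nonnegative
  terms.\<close>

lemma parseval_lower_bound:
  fixes F :: "'a::euclidean_space set"
  assumes F: "compact F" "F \<subseteq> box (- R *\<^sub>R One) (R *\<^sub>R One)" and "R > 0"
    and v: "L2_converges_on F v t" "\<And>k. continuous_on UNIV (\<lambda>x. if x \<in> F then v k x else 0)"
    and "e > 0"
  obtains K where "finite K" "K \<subseteq> lattice (pi / R)"
    "\<And>K'. finite K' \<Longrightarrow> K \<subseteq> K' \<Longrightarrow>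
      (\<integral>x. (t x)\<^sup>2 \<partial>lebesgue_on F) - e \<le> (\<Sum>\<xi>\<in>K'. (cmod (fourier_coeff F t \<xi>))\<^sup>2) / (2 * R) ^ DIM('a)"
proof -
  have Fb [measurable]: "F \<in> sets borel" and bF: "bounded F"
    using F by (auto simp: compact_imp_closed compact_imp_bounded)
  let ?Q = "cube R :: 'a set"
  let ?V = "(2 * R) ^ DIM('a)"
  have V: "?V > 0" using \<open>R > 0\<close> by simp
  have FQ: "F \<subseteq> ?Q" using F(2) box_subset_cbox by blast
  note t = L2_converges_onD[OF v(1)]
  obtain k where k: "(\<integral>x. (norm (v k x - t x))\<^sup>2 \<partial>lebesgue_on F) < e / 4"
  proof -
    have "eventually (\<lambda>k. (\<integral>x. (norm (v k x - t x))\<^sup>2 \<partial>lebesgue_on F) < e / 4) sequentially"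
      using t(3) \<open>e > 0\<close> by (intro order_tendstoD) auto
    then show thesis using that unfolding eventually_sequentially by blast
  qed
  define u where "u x = (if x \<in> F then v k x else 0)" for x
  define mF where "mF = (\<integral>x. indicator F x \<partial>lborel :: real)"
  define mQ where "mQ = (\<integral>x. indicator ?Q x \<partial>lborel :: real)"
  \<comment> \<open>The error budget: the uniform error \<open>\<delta>\<close> costs its square
    times \<open>2 * mF\<close> on \<open>F\<close> and times \<open>mQ\<close> on the cube. The
    summand 1 makes \<open>M\<close> positive. This uses \<open>e / 2\<close>; the choice of
    \<open>k\<close> uses the other half.\<close>
  define M where "M = 2 * mF + mQ + 1"
  have m: "mF \<ge> 0" "mQ \<ge> 0" by (auto simp: mF_def mQ_def)
  then have M: "M > 0" by (simp add: M_def)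
  define \<delta> where "\<delta> = sqrt (e / (2 * M))"
  have \<delta>: "\<delta> > 0" "\<delta>\<^sup>2 * M = e / 2" using M \<open>e > 0\<close> by (auto simp: \<delta>_def)
  have cu: "continuous_on UNIV u" using v(2)[of k] by (simp add: u_def[abs_def])
  obtain K c where K: "finite K" "K \<subseteq> lattice (pi / R)" "\<And>x. x \<in> ?Q \<Longrightarrow> cmod (u x - trig K c x) < \<delta>"
  proof (rule trig_polynomials_dense[OF \<open>R > 0\<close> cu _ \<delta>(1)])
    fix x :: 'a assume "x \<notin> box (- R *\<^sub>R One) (R *\<^sub>R One)"
    then show "u x = 0" using F(2) by (auto simp: u_def)
  qed blast
  define p where "p = trig K c"
  have cp: "continuous_on UNIV p" unfolding p_def by (rule continuous_trig)
  have pR: "continuous_on UNIV (\<lambda>x. Re (p x))" "continuous_on UNIV (\<lambda>x. (cmod (p x))\<^sup>2)"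
    by (intro continuous_intros cp)+
  have iF: "integrable (lebesgue_on F) w" if "continuous_on UNIV w" for w :: "'a \<Rightarrow> real"
    using integrable_inner_L2[OF L2_on_continuous[OF that bF Fb]
      L2_on_continuous[OF continuous_on_const[of _ 1] bF Fb]] by simp
  have it: "integrable (lebesgue_on F) (\<lambda>x. t x * Re (p x))"
    using integrable_inner_L2[OF t(2) L2_on_continuous[OF pR(1) bF Fb]] by simp
  have ivt: "integrable (lebesgue_on F) (\<lambda>x. (norm (v k x - t x))\<^sup>2)" 
    using t by (intro L2_onD(2) L2_on_minus)
  have itt: "integrable (lebesgue_on F) (\<lambda>x. (t x)\<^sup>2)" 
    using L2_onD(2)[OF t(2)] by simp
  have pt: "(t x)\<^sup>2 \<le> 2 * (norm (v k x - t x))\<^sup>2 + 2 * \<delta>\<^sup>2 + 2 * (t x * Re (p x)) - (cmod (p x))\<^sup>2" if "x \<in> F" for x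
  proof -
    have "(cmod (t x - p x))\<^sup>2 \<le> 2 * (cmod (t x - v k x))\<^sup>2 + 2 * (cmod (v k x - p x))\<^sup>2"
      using power2_norm_add_le[of "complex_of_real (t x) - v k x" "v k x - p x"] by simp
    moreover have "cmod (complex_of_real (t x) - v k x) = norm (v k x - t x)"
      by (metis norm_minus_commute norm_of_real of_real_diff real_norm_def)
    moreover have "cmod (v k x - p x) \<le> \<delta>" using K(3)[of x] that FQ by (auto simp: u_def p_def)
    then have "(cmod (v k x - p x))\<^sup>2 \<le> \<delta>\<^sup>2" by (intro power_mono) auto
    moreover have "(cmod (t x - p x))\<^sup>2 = (t x)\<^sup>2 - 2 * (t x * Re (p x)) + (cmod (p x))\<^sup>2"
      unfolding cmod_power2 by (simp add: power2_eq_square algebra_simps)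
    ultimately show ?thesis by simp
  qed
  have iconst: "(\<integral>x. w \<partial>lebesgue_on F) = w * mF" for w :: real
    by (subst integral_lebesgue_on_eq_lborel) (auto simp: mF_def)
  have "(\<integral>x. (t x)\<^sup>2 \<partial>lebesgue_on F)
      \<le> (\<integral>x. 2 * (norm (v k x - t x))\<^sup>2 + 2 * \<delta>\<^sup>2 + 2 * (t x * Re (p x)) - (cmod (p x))\<^sup>2 \<partial>lebesgue_on F)"
    using itt ivt it iF[OF pR(2)] iF[OF continuous_on_const, of "2 * \<delta>\<^sup>2"] pt
    by (intro integral_mono) auto
  also have "\<dots> = 2 * (\<integral>x. (norm (v k x - t x))\<^sup>2 \<partial>lebesgue_on F) + 2 * \<delta>\<^sup>2 * mF
      + 2 * (\<integral>x. t x * Re (p x) \<partial>lebesgue_on F) - (\<integral>x. (cmod (p x))\<^sup>2 \<partial>lebesgue_on F)"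
    using itt ivt it iF[OF pR(2)] iF[OF continuous_on_const, of "2 * \<delta>\<^sup>2"] iconst[of "2 * \<delta>\<^sup>2"] by simp
  finally have 1: "(\<integral>x. (t x)\<^sup>2 \<partial>lebesgue_on F) \<le> 2 * (\<integral>x. (norm (v k x - t x))\<^sup>2 \<partial>lebesgue_on F) + 2 * \<delta>\<^sup>2 * mF
      + 2 * (\<integral>x. t x * Re (p x) \<partial>lebesgue_on F) - (\<integral>x. (cmod (p x))\<^sup>2 \<partial>lebesgue_on F)" .
  \<comment> \<open>Orthogonality holds on the whole cube, the integrals of \<open>t\<close> live on
    \<open>F\<close>; off \<open>F\<close> the approximated function \<open>u\<close> is 0, so
    \<open>p\<close> is at most \<open>\<delta>\<close> there.\<close>
  have 2: "?V * (\<Sum>\<xi>\<in>K. (cmod (c \<xi>))\<^sup>2) \<le> (\<integral>x. (cmod (p x))\<^sup>2 \<partial>lebesgue_on F) + \<delta>\<^sup>2 * mQ"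
  proof -
    have pm: "(\<lambda>x. (cmod (p x))\<^sup>2) \<in> borel_measurable borel" using pR(2) by (rule borel_measurable_continuous_onI)
    have iF': "integrable lborel (\<lambda>x. indicator F x *\<^sub>R (cmod (p x))\<^sup>2)"
      using iF[OF pR(2)] pm by (subst (asm) integrable_lebesgue_on_iff_lborel) auto
    have iQ: "integrable lborel (\<lambda>x. indicator ?Q x *\<^sub>R (cmod (p x))\<^sup>2)" "integrable lborel (\<lambda>x. indicator ?Q x *\<^sub>R \<delta>\<^sup>2)"
      using integrable_cube_continuous[OF pR(2), of R] integrable_cube_continuous[OF continuous_on_const, of R "\<delta>\<^sup>2"] by auto
    have "?V * (\<Sum>\<xi>\<in>K. (cmod (c \<xi>))\<^sup>2) = (\<integral>x. indicator ?Q x *\<^sub>R (cmod (p x))\<^sup>2 \<partial>lborel)"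
      using integral_trig_cube[OF \<open>R > 0\<close> K(1,2), of c] by (simp add: p_def)
    also have "\<dots> \<le> (\<integral>x. indicator F x *\<^sub>R (cmod (p x))\<^sup>2 + indicator ?Q x *\<^sub>R \<delta>\<^sup>2 \<partial>lborel)"
    proof (rule integral_mono)
      fix x :: 'a
      show "indicator ?Q x *\<^sub>R (cmod (p x))\<^sup>2 \<le> indicator F x *\<^sub>R (cmod (p x))\<^sup>2 + indicator ?Q x *\<^sub>R \<delta>\<^sup>2"
      proof (cases "x \<in> ?Q \<and> x \<notin> F")
        case True
        then have "cmod (p x) \<le> \<delta>" using K(3)[of x] by (simp add: u_def p_def)
        then have "(cmod (p x))\<^sup>2 \<le> \<delta>\<^sup>2" by (intro power_mono) auto
        then show ?thesis using True by simp
      next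
        case False
        then show ?thesis by (auto simp: indicator_def)
      qed
    qed (use iF' iQ in \<open>auto intro: Bochner_Integration.integrable_add\<close>)
    also have "\<dots> = (\<integral>x. indicator F x *\<^sub>R (cmod (p x))\<^sup>2 \<partial>lborel) + (\<integral>x. indicator ?Q x *\<^sub>R \<delta>\<^sup>2 \<partial>lborel)"
      by (rule Bochner_Integration.integral_add[OF iF' iQ(2)])
    also have "\<dots> = (\<integral>x. (cmod (p x))\<^sup>2 \<partial>lebesgue_on F) + \<delta>\<^sup>2 * mQ"
      using pm by (subst integral_lebesgue_on_eq_lborel) (auto simp: mQ_def mult.commute)
    finally show ?thesis .
  qed
  have 3: "(\<integral>x. t x * Re (p x) \<partial>lebesgue_on F) = (\<Sum>\<xi>\<in>K. Re (c \<xi> * fourier_coeff F t \<xi>))"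
  proof -
    have i: "integrable (lebesgue_on F) (\<lambda>x. t x * Re (c \<xi> * cis (\<xi> \<bullet> x)))" for \<xi>
    proof -
      have "continuous_on UNIV (\<lambda>x. Re (c \<xi> * cis (\<xi> \<bullet> x)))" by (intro continuous_intros)
      from integrable_inner_L2[OF t(2) L2_on_continuous[OF this bF Fb]] show ?thesis by simp
    qed
    have "(\<integral>x. t x * Re (p x) \<partial>lebesgue_on F) = (\<integral>x. (\<Sum>\<xi>\<in>K. t x * Re (c \<xi> * cis (\<xi> \<bullet> x))) \<partial>lebesgue_on F)"
      by (simp only: p_def trig_def Re_sum sum_distrib_left)
    also have "\<dots> = (\<Sum>\<xi>\<in>K. \<integral>x. t x * Re (c \<xi> * cis (\<xi> \<bullet> x)) \<partial>lebesgue_on F)"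
      using i by (intro Bochner_Integration.integral_sum)
    also have "\<dots> = (\<Sum>\<xi>\<in>K. Re (c \<xi> * fourier_coeff F t \<xi>))"
      using integral_times_Re_cis[OF t(2) bF Fb] by simp
    finally show ?thesis .
  qed
  \<comment> \<open>Completing the square in \<open>cmod (c \<xi>)\<close>: the left side would be
    maximal for \<open>c \<xi>\<close> equal to the conjugate coefficient over \<open>?V\<close>,
    and the right side is that maximum.\<close>
  have 4: "2 * Re (c \<xi> * fourier_coeff F t \<xi>) - ?V * (cmod (c \<xi>))\<^sup>2 \<le> (cmod (fourier_coeff F t \<xi>))\<^sup>2 / ?V" for \<xi>
  proof -
    let ?a = "fourier_coeff F t \<xi>"
    have "Re (c \<xi> * ?a) \<le> cmod (c \<xi>) * cmod ?a" using complex_Re_le_cmod[of "c \<xi> * ?a"] by (simp add: norm_mult)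
    moreover have "0 \<le> (?V * cmod (c \<xi>) - cmod ?a)\<^sup>2" by simp
    then have "2 * (?V * (cmod (c \<xi>) * cmod ?a)) \<le> ?V * (?V * (cmod (c \<xi>))\<^sup>2) + (cmod ?a)\<^sup>2"
      by (simp add: power2_eq_square algebra_simps)
    ultimately have "2 * (?V * Re (c \<xi> * ?a)) \<le> ?V * (?V * (cmod (c \<xi>))\<^sup>2) + (cmod ?a)\<^sup>2"
      using V by (smt (verit) mult_left_mono)
    then have "?V * (2 * Re (c \<xi> * ?a) - ?V * (cmod (c \<xi>))\<^sup>2) \<le> (cmod ?a)\<^sup>2" by (simp only: algebra_simps)
    then show ?thesis using V by (simp only: pos_le_divide_eq mult.commute)
  qed
  have 5: "2 * (\<Sum>\<xi>\<in>K. Re (c \<xi> * fourier_coeff F t \<xi>)) - ?V * (\<Sum>\<xi>\<in>K. (cmod (c \<xi>))\<^sup>2)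
      \<le> (\<Sum>\<xi>\<in>K. (cmod (fourier_coeff F t \<xi>))\<^sup>2) / ?V"
    using sum_mono[of K, OF 4] by (simp only: sum_distrib_left sum_subtractf sum_divide_distrib)
  have "2 * \<delta>\<^sup>2 * mF + \<delta>\<^sup>2 * mQ \<le> e / 2"
  proof -
    have "2 * \<delta>\<^sup>2 * mF + \<delta>\<^sup>2 * mQ = \<delta>\<^sup>2 * M - \<delta>\<^sup>2" by (simp add: M_def algebra_simps)
    then show ?thesis using \<delta>(2) by (smt (verit) zero_le_power2)
  qed
  then have fin: "(\<integral>x. (t x)\<^sup>2 \<partial>lebesgue_on F) - e \<le> (\<Sum>\<xi>\<in>K. (cmod (fourier_coeff F t \<xi>))\<^sup>2) / ?V"
    using 1 2 3 5 k by linarith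
  show thesis
  proof (rule that[OF K(1,2)])
    fix K' assume K': "finite K'" "K \<subseteq> K'"
    have "(\<Sum>\<xi>\<in>K. (cmod (fourier_coeff F t \<xi>))\<^sup>2) \<le> (\<Sum>\<xi>\<in>K'. (cmod (fourier_coeff F t \<xi>))\<^sup>2)"
      using K' by (intro sum_mono2) auto
    then have "(\<Sum>\<xi>\<in>K. (cmod (fourier_coeff F t \<xi>))\<^sup>2) / ?V \<le> (\<Sum>\<xi>\<in>K'. (cmod (fourier_coeff F t \<xi>))\<^sup>2) / ?V"
      using V by (intro divide_right_mono) auto
    then show "(\<integral>x. (t x)\<^sup>2 \<partial>lebesgue_on F) - e \<le> (\<Sum>\<xi>\<in>K'. (cmod (fourier_coeff F t \<xi>))\<^sup>2) / ?V"
      using fin by linarith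
  qed
qed

text \<open>The gradient of \<open>Re (c * cis (\<xi> \<bullet> x)) * exp (norm \<xi> * s)\<close>,
  which is harmonic, bounded below height 0, and has normal derivative \<open>norm \<xi>\<close>
  times its own trace at height 0.\<close>

definition harmonic_gradient :: "'a::euclidean_space \<Rightarrow> complex \<Rightarrow> 'a \<times> real \<Rightarrow> 'a \<times> real" where
  "harmonic_gradient \<xi> c p = exp (norm \<xi> * snd p) *\<^sub>R
     ((Re (\<i> * c * cis (\<xi> \<bullet> fst p))) *\<^sub>R \<xi>, norm \<xi> * Re (c * cis (\<xi> \<bullet> fst p)))"

lemma continuous_harmonic_gradient: "continuous_on UNIV (harmonic_gradient \<xi> c)"
  unfolding harmonic_gradient_def[abs_def] by (intro continuous_intros)

lemma power2_norm_eq_sum_Basis: "(norm (x::'a::euclidean_space))\<^sup>2 = (\<Sum>b\<in>Basis. (x \<bullet> b)\<^sup>2)"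
  by (subst power2_norm_eq_inner, subst euclidean_inner) (simp add: power2_eq_square)

context free_boundary_domain begin

lemma integral_grad_harmonic_gradient:
  assumes \<phi>: "C1 \<phi>" "\<And>p. p \<in> B \<Longrightarrow> \<phi> p = 0"
  shows "(\<integral>p. grad \<phi> p \<bullet> harmonic_gradient \<xi> c p \<partial>lebesgue_on \<Omega>)
    = (\<integral>x. \<phi> (x, 0) * (norm \<xi> * Re (c * cis (\<xi> \<bullet> x))) \<partial>lebesgue_on F)"
proof -
  \<comment> \<open>One formula for both kinds of basis vector: \<open>(b, 0)\<close> gives minus
    the square of \<open>\<xi> \<bullet> b\<close>, and \<open>(0, 1)\<close> gives plus the square
    of \<open>norm \<xi>\<close>. Their sum is 0, which is harmonicity.\<close>
  define G' where "G' e p = ((snd e * norm \<xi>)\<^sup>2 - (\<xi> \<bullet> fst e)\<^sup>2) * (exp (norm \<xi> * snd p) * Re (c * cis (\<xi> \<bullet> fst p)))" for e p :: "'a \<times> real"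
  have zero: "(\<Sum>e\<in>Basis. G' e p) = 0" for p
  proof -
    have "(\<Sum>b\<in>Basis. (\<xi> \<bullet> b)\<^sup>2) = (norm \<xi>)\<^sup>2" by (rule power2_norm_eq_sum_Basis[symmetric])
    then show ?thesis unfolding sum_Basis_prod_real G'_def
      by (simp add: sum_distrib_right[symmetric] sum_negf)
  qed
  have "(\<integral>p. grad \<phi> p \<bullet> harmonic_gradient \<xi> c p + \<phi> p * (\<Sum>e\<in>Basis. G' e p) \<partial>lebesgue_on \<Omega>)
    = (\<integral>x. \<phi> (x, 0) * snd (harmonic_gradient \<xi> c (x, 0)) \<partial>lebesgue_on F)"
  proof (rule integral_divergence[OF \<phi> continuous_harmonic_gradient])
    show "continuous_on UNIV (G' e)" for e unfolding G'_def[abs_def] by (intro continuous_intros)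
    fix e p :: "'a \<times> real" and s :: real assume e: "e \<in> Basis"
    then consider b where "b \<in> Basis" "e = (b, 0)" | "e = (0, 1)" by (auto simp: Basis_prod_def)
    then show "((\<lambda>s. harmonic_gradient \<xi> c (p + s *\<^sub>R e) \<bullet> e) has_real_derivative G' e (p + s *\<^sub>R e)) (at s)"
    proof cases
      case 1
      have eq: "harmonic_gradient \<xi> c (p + s *\<^sub>R e) \<bullet> e
          = exp (norm \<xi> * snd p) * ((- Re c * sin (\<xi> \<bullet> fst p + s * (\<xi> \<bullet> b)) - Im c * cos (\<xi> \<bullet> fst p + s * (\<xi> \<bullet> b))) * (\<xi> \<bullet> b))" for s
        using 1 by (simp add: harmonic_gradient_def inner_add_right algebra_simps)
      show ?thesis unfolding eq
        using 1 by (auto intro!: derivative_eq_intros simp: G'_def inner_add_right power2_eq_square algebra_simps)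
    next
      case 2
      have eq: "harmonic_gradient \<xi> c (p + s *\<^sub>R e) \<bullet> e
          = exp (norm \<xi> * (snd p + s)) * (norm \<xi> * Re (c * cis (\<xi> \<bullet> fst p)))" for s
        using 2 by (simp add: harmonic_gradient_def)
      show ?thesis unfolding eq
        using 2 by (auto intro!: derivative_eq_intros simp: G'_def power2_eq_square algebra_simps)
    qed
  qed
  then show ?thesis by (simp add: zero harmonic_gradient_def)
qed

text \<open>Both sides of the identity for \<open>C1\<close> approximants are pairings with fixed
  square-integrable functions, so they pass to the limit.\<close>

lemma dirichlet_limit_harmonic_gradient:
  assumes d: "dirichlet_limit \<Omega> F B f g t"
  shows "(\<integral>p. g p \<bullet> harmonic_gradient \<xi> c p \<partial>lebesgue_on \<Omega>) = norm \<xi> * Re (c * fourier_coeff F t \<xi>)"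
proof -
  obtain \<phi> where \<phi>: "\<And>k. C1 (\<phi> k)" "\<And>k x. x \<in> B \<Longrightarrow> \<phi> k x = 0"
    "L2_converges_on \<Omega> (\<lambda>k. grad (\<phi> k)) g" "L2_converges_on F (\<lambda>k x. \<phi> k (x, 0)) t"
    using dirichlet_limitE[OF d] by metis
  have w: "continuous_on UNIV (\<lambda>x. norm \<xi> * Re (c * cis (\<xi> \<bullet> x)))" by (intro continuous_intros)
  have "(\<lambda>k. \<integral>p. grad (\<phi> k) p \<bullet> harmonic_gradient \<xi> c p \<partial>lebesgue_on \<Omega>)
      \<longlonglongrightarrow> (\<integral>p. g p \<bullet> harmonic_gradient \<xi> c p \<partial>lebesgue_on \<Omega>)"
    by (rule L2_converges_on_inner[OF \<phi>(3) L2_on_continuous[OF continuous_harmonic_gradient bounded_domain domain_borel]])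
  moreover have "(\<lambda>k. \<integral>x. \<phi> k (x, 0) \<bullet> (norm \<xi> * Re (c * cis (\<xi> \<bullet> x))) \<partial>lebesgue_on F)
      \<longlonglongrightarrow> (\<integral>x. t x \<bullet> (norm \<xi> * Re (c * cis (\<xi> \<bullet> x))) \<partial>lebesgue_on F)"
    by (rule L2_converges_on_inner[OF \<phi>(4) L2_on_continuous[OF w bounded_F F_borel]])
  ultimately have "(\<integral>p. g p \<bullet> harmonic_gradient \<xi> c p \<partial>lebesgue_on \<Omega>) = (\<integral>x. t x \<bullet> (norm \<xi> * Re (c * cis (\<xi> \<bullet> x))) \<partial>lebesgue_on F)"
    using integral_grad_harmonic_gradient[OF \<phi>(1,2)] LIMSEQ_unique by (simp only: inner_real_def)
  also have "\<dots> = (\<integral>x. norm \<xi> * (t x * Re (c * cis (\<xi> \<bullet> x))) \<partial>lebesgue_on F)"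
    by (simp only: inner_real_def mult.left_commute)
  also have "\<dots> = norm \<xi> * (\<integral>x. t x * Re (c * cis (\<xi> \<bullet> x)) \<partial>lebesgue_on F)" by simp
  also have "\<dots> = norm \<xi> * Re (c * fourier_coeff F t \<xi>)"
    using integral_times_Re_cis[OF dirichlet_limit_L2(3)[OF d] bounded_F F_borel] by simp
  finally show ?thesis .
qed

text \<open>\<open>\<Omega>\<close> is enlarged to the cube times \<open>{-r..0}\<close>, where the
  horizontal integral is explicit. Real parts are first replaced by moduli: in real parts the
  frequencies \<open>\<xi>\<close> and \<open>- \<xi>\<close> would interfere, while for moduli
  orthogonality applies.\<close>

lemma integral_power2_harmonic_gradient_le:
  assumes R: "R > 0" "\<And>p. p \<in> \<Omega> \<Longrightarrow> fst p \<in> cube R" and K: "finite K" "K \<subseteq> lattice (pi / R)"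
  shows "(\<integral>p. (norm (\<Sum>\<xi>\<in>K. harmonic_gradient \<xi> (c \<xi>) p))\<^sup>2 \<partial>lebesgue_on \<Omega>)
    \<le> (2 * R) ^ DIM('a) * (\<Sum>\<xi>\<in>K. norm \<xi> * (cmod (c \<xi>))\<^sup>2)"
proof -
  let ?V = "(2 * R) ^ DIM('a)" and ?Q = "cube R :: 'a set"
  define G where "G p = (\<Sum>\<xi>\<in>K. harmonic_gradient \<xi> (c \<xi>) p)" for p
  have cG: "continuous_on UNIV G" unfolding G_def[abs_def] by (intro continuous_intros continuous_harmonic_gradient)
  \<comment> \<open>The complex coefficients, at height \<open>s\<close>, of the horizontal
    component along \<open>b\<close> and, in \<open>cn\<close>, of the vertical component.\<close>
  define cb where "cb s b \<xi> = \<i> * c \<xi> * of_real (\<xi> \<bullet> b) * of_real (exp (norm \<xi> * s))" for s b \<xi>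
  define cn where "cn s \<xi> = c \<xi> * of_real (norm \<xi>) * of_real (exp (norm \<xi> * s))" for s \<xi>
  define H where "H x s = (\<Sum>b\<in>Basis. (cmod (trig K (cb s b) x))\<^sup>2) + (cmod (trig K (cn s) x))\<^sup>2" for x s
  have H0: "H x s \<ge> 0" for x s unfolding H_def by (intro add_nonneg_nonneg sum_nonneg) auto
  have GH: "(norm (G (x, s)))\<^sup>2 \<le> H x s" for x s
  proof -
    have "fst (G (x, s)) \<bullet> b = Re (trig K (cb s b) x)" for b
      unfolding G_def trig_def cb_def fst_sum inner_sum_left Re_sum
      by (intro sum.cong refl) (simp add: harmonic_gradient_def algebra_simps)
    moreover have "snd (G (x, s)) = Re (trig K (cn s) x)"
      unfolding G_def trig_def cn_def snd_sum Re_sum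
      by (intro sum.cong refl) (simp add: harmonic_gradient_def algebra_simps)
    ultimately have that: "(\<And>b. fst (G (x, s)) \<bullet> b = Re (trig K (cb s b) x))" "snd (G (x, s)) = Re (trig K (cn s) x)" by auto
    have "(norm (G (x, s)))\<^sup>2 = (\<Sum>b\<in>Basis. (Re (trig K (cb s b) x))\<^sup>2) + (Re (trig K (cn s) x))\<^sup>2"
    proof -
      have "(norm (G (x, s)))\<^sup>2 = (norm (fst (G (x, s))))\<^sup>2 + (norm (snd (G (x, s))))\<^sup>2" by (simp add: norm_prod_def)
      then show ?thesis using that by (simp add: power2_norm_eq_sum_Basis[of "fst (G (x, s))"])
    qed
    also have "\<dots> \<le> H x s" unfolding H_def
      by (intro add_mono sum_mono) (auto simp: cmod_power2)
    finally show ?thesis .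
  qed
  have cH: "continuous_on UNIV (\<lambda>x. H x s)" for s
    unfolding H_def by (intro continuous_intros continuous_trig)
  have cH2: "continuous_on UNIV (\<lambda>p. H (fst p) (snd p))"
    unfolding H_def trig_def cb_def cn_def by (intro continuous_intros)
  have Hm: "(\<lambda>p. H (fst p) (snd p)) \<in> borel_measurable (borel \<Otimes>\<^sub>M borel)"
    unfolding borel_prod by (rule borel_measurable_continuous_onI[OF cH2])
  \<comment> \<open>Horizontal and vertical components each contribute the square of
    \<open>norm \<xi>\<close>, hence the 2. Integrating \<open>exp (2 * norm \<xi> * s)\<close> over
    heights up to 0 cancels this 2 and one factor \<open>norm \<xi>\<close>; the term from the lower
    end is dropped by sign.\<close>
  define N where "N s = ?V * (\<Sum>\<xi>\<in>K. 2 * (norm \<xi>)\<^sup>2 * (cmod (c \<xi>))\<^sup>2 * exp (2 * norm \<xi> * s))" for s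
  have N0: "N s \<ge> 0" for s unfolding N_def using R by (intro mult_nonneg_nonneg sum_nonneg) auto
  have inner: "(\<integral>\<^sup>+x. ennreal (indicator ?Q x * H x s) \<partial>lborel) = ennreal (N s)" for s
  proof -
    have i: "integrable lborel (\<lambda>x. indicator ?Q x * (cmod (trig K d x))\<^sup>2)" for d
      using integrable_cube_continuous[of "\<lambda>x. (cmod (trig K d x))\<^sup>2" R]
      by (simp add: continuous_on_power continuous_on_norm continuous_trig)
    have i': "integrable lborel (\<lambda>x. indicator ?Q x * H x s)"
      using integrable_cube_continuous[OF cH, of R s] by simp
    have "(\<integral>x. indicator ?Q x * H x s \<partial>lborel)
        = (\<Sum>b\<in>Basis. \<integral>x. indicator ?Q x * (cmod (trig K (cb s b) x))\<^sup>2 \<partial>lborel) + (\<integral>x. indicator ?Q x * (cmod (trig K (cn s) x))\<^sup>2 \<partial>lborel)"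
      unfolding H_def distrib_left sum_distrib_left
      by (simp only: Bochner_Integration.integral_add Bochner_Integration.integral_sum Bochner_Integration.integrable_sum i)
    also have "\<dots> = (\<Sum>b\<in>Basis. ?V * (\<Sum>\<xi>\<in>K. (cmod (cb s b \<xi>))\<^sup>2)) + ?V * (\<Sum>\<xi>\<in>K. (cmod (cn s \<xi>))\<^sup>2)"
      by (simp only: integral_trig_cube[OF R(1) K])
    also have "\<dots> = ?V * (\<Sum>\<xi>\<in>K. (\<Sum>b\<in>Basis. (cmod (cb s b \<xi>))\<^sup>2) + (cmod (cn s \<xi>))\<^sup>2)"
      unfolding sum_distrib_left[symmetric] sum.distrib by (subst sum.swap) (simp add: algebra_simps)
    also have "\<dots> = N s"
    proof -
      have ex: "(exp (norm \<xi> * s))\<^sup>2 = exp (2 * norm \<xi> * s)" for \<xi> :: 'a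
        by (simp add: power2_eq_square exp_add[symmetric])
      have cb: "(cmod (cb s b \<xi>))\<^sup>2 = (cmod (c \<xi>))\<^sup>2 * (\<xi> \<bullet> b)\<^sup>2 * exp (2 * norm \<xi> * s)" for b \<xi>
      proof -
        have "cmod (cb s b \<xi>) = cmod (c \<xi>) * \<bar>\<xi> \<bullet> b\<bar> * exp (norm \<xi> * s)" by (simp add: cb_def norm_mult)
        then show ?thesis by (simp only: power_mult_distrib power2_abs ex)
      qed
      have "(\<Sum>b\<in>Basis. (cmod (cb s b \<xi>))\<^sup>2) = (cmod (c \<xi>))\<^sup>2 * exp (2 * norm \<xi> * s) * (norm \<xi>)\<^sup>2" for \<xi>
        unfolding power2_norm_eq_sum_Basis[of \<xi>] sum_distrib_left cb
        by (intro sum.cong refl) (simp only: mult_ac)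
      moreover have "(cmod (cn s \<xi>))\<^sup>2 = (cmod (c \<xi>))\<^sup>2 * exp (2 * norm \<xi> * s) * (norm \<xi>)\<^sup>2" for \<xi>
      proof -
        have "cmod (cn s \<xi>) = cmod (c \<xi>) * exp (norm \<xi> * s) * norm \<xi>" by (simp add: cn_def norm_mult)
        then show ?thesis by (simp only: power_mult_distrib ex)
      qed
      ultimately show ?thesis by (simp add: N_def mult_ac)
    qed
    finally have "(\<integral>x. indicator ?Q x * H x s \<partial>lborel) = N s" .
    then show ?thesis using nn_integral_eq_integral[OF i'] H0 by simp
  qed
  obtain r where r: "r > 0" "\<And>p. p \<in> \<Omega> \<Longrightarrow> norm p \<le> r" using bounded_domain bounded_pos by metis
  have low: "p \<in> \<Omega> \<Longrightarrow> snd p \<in> {-r..0}" for p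
    using r(2)[of p] norm_snd_le[of "snd p" "fst p"] domain_below by auto
  have GL: "L2_on \<Omega> G" by (rule L2_on_continuous[OF cG bounded_domain domain_borel])
  have [measurable]: "G \<in> borel_measurable borel" by (rule borel_measurable_continuous_onI[OF cG])
  have iG: "integrable lborel (\<lambda>p. indicator \<Omega> p *\<^sub>R (norm (G p))\<^sup>2)"
    using L2_onD(2)[OF GL] by (subst (asm) integrable_lebesgue_on_iff_lborel) auto
  define A where "A = ?V * (\<Sum>\<xi>\<in>K. norm \<xi> * (cmod (c \<xi>))\<^sup>2)"
  have A0: "A \<ge> 0" unfolding A_def using R by (intro mult_nonneg_nonneg sum_nonneg) auto
  have "ennreal (\<integral>p. (norm (G p))\<^sup>2 \<partial>lebesgue_on \<Omega>) = ennreal (\<integral>p. indicator \<Omega> p *\<^sub>R (norm (G p))\<^sup>2 \<partial>lborel)"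
    by (subst integral_lebesgue_on_eq_lborel) auto
  also have "\<dots> = (\<integral>\<^sup>+p. ennreal (indicator \<Omega> p *\<^sub>R (norm (G p))\<^sup>2) \<partial>lborel)"
    using iG by (intro nn_integral_eq_integral[symmetric]) auto
  also have "\<dots> \<le> (\<integral>\<^sup>+p. ennreal (indicator ?Q (fst p) * H (fst p) (snd p)) * indicator {-r..0} (snd p) \<partial>lborel)"
  proof (rule nn_integral_mono)
    fix p :: "'a \<times> real"
    show "ennreal (indicator \<Omega> p *\<^sub>R (norm (G p))\<^sup>2) \<le> ennreal (indicator ?Q (fst p) * H (fst p) (snd p)) * indicator {-r..0} (snd p)"
      using R(2)[of p] low[of p] GH[of "fst p" "snd p"] by (cases "p \<in> \<Omega>") (auto intro: ennreal_leI)
  qed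
  also have "\<dots> = (\<integral>\<^sup>+p. ennreal (indicator ?Q (fst p) * H (fst p) (snd p)) * indicator {-r..0} (snd p) \<partial>(lborel \<Otimes>\<^sub>M lborel))"
    by (simp add: lborel_prod)
  also have "\<dots> = (\<integral>\<^sup>+s. (\<integral>\<^sup>+x. ennreal (indicator ?Q x * H x s) * indicator {-r..0} s \<partial>lborel) \<partial>lborel)"
  proof (subst lborel_pair.nn_integral_snd[symmetric])
    note Hm [measurable]
    have "(\<lambda>p. ennreal (indicator ?Q (fst p) * H (fst p) (snd p)) * indicator {-r..0} (snd p)) \<in> borel_measurable (borel \<Otimes>\<^sub>M borel)"
      by measurable
    then show "(\<lambda>p. ennreal (indicator ?Q (fst p) * H (fst p) (snd p)) * indicator {-r..0} (snd p)) \<in> borel_measurable (lborel \<Otimes>\<^sub>M lborel)"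
      by (simp add: lborel_prod borel_prod)
  qed simp
  also have "\<dots> = (\<integral>\<^sup>+s. ennreal (N s) * indicator {-r..0} s \<partial>lborel)"
  proof (rule nn_integral_cong)
    fix s :: real
    have [measurable]: "(\<lambda>x. H x s) \<in> borel_measurable borel" by (rule borel_measurable_continuous_onI[OF cH])
    have m: "(\<lambda>x. ennreal (indicator ?Q x * H x s)) \<in> borel_measurable lborel" by measurable
    show "(\<integral>\<^sup>+x. ennreal (indicator ?Q x * H x s) * indicator {-r..0} s \<partial>lborel) = ennreal (N s) * indicator {-r..0} s"
      unfolding nn_integral_multc[OF m] inner ..
  qed
  also have "\<dots> = ennreal (\<Sum>\<xi>\<in>K. ?V * (norm \<xi> * (cmod (c \<xi>))\<^sup>2 * exp (2 * norm \<xi> * 0)) - ?V * (norm \<xi> * (cmod (c \<xi>))\<^sup>2 * exp (2 * norm \<xi> * (- r))))"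
  proof (rule nn_integral_has_integral_lebesgue'[OF N0])
    have "((\<lambda>s. \<Sum>\<xi>\<in>K. ?V * (2 * (norm \<xi>)\<^sup>2 * (cmod (c \<xi>))\<^sup>2 * exp (2 * norm \<xi> * s))) has_integral
      (\<Sum>\<xi>\<in>K. ?V * (norm \<xi> * (cmod (c \<xi>))\<^sup>2 * exp (2 * norm \<xi> * 0)) - ?V * (norm \<xi> * (cmod (c \<xi>))\<^sup>2 * exp (2 * norm \<xi> * (- r))))) {-r..0}"
    proof (rule has_integral_sum[OF K(1) fundamental_theorem_of_calculus])
      fix \<xi> s
      have "((\<lambda>s. ?V * (norm \<xi> * (cmod (c \<xi>))\<^sup>2 * exp (2 * norm \<xi> * s))) has_real_derivative ?V * (2 * (norm \<xi>)\<^sup>2 * (cmod (c \<xi>))\<^sup>2 * exp (2 * norm \<xi> * s))) (at s within {-r..0})"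
        by (auto intro!: derivative_eq_intros simp: power2_eq_square)
      then show "((\<lambda>s. ?V * (norm \<xi> * (cmod (c \<xi>))\<^sup>2 * exp (2 * norm \<xi> * s))) has_vector_derivative ?V * (2 * (norm \<xi>)\<^sup>2 * (cmod (c \<xi>))\<^sup>2 * exp (2 * norm \<xi> * s))) (at s within {-r..0})"
        by (simp only: has_real_derivative_iff_has_vector_derivative)
    qed (use r in auto)
    then show "(N has_integral (\<Sum>\<xi>\<in>K. ?V * (norm \<xi> * (cmod (c \<xi>))\<^sup>2 * exp (2 * norm \<xi> * 0)) - ?V * (norm \<xi> * (cmod (c \<xi>))\<^sup>2 * exp (2 * norm \<xi> * (- r))))) {-r..0}"
      by (simp only: N_def[abs_def] sum_distrib_left)
  qed
  also have "\<dots> \<le> ennreal A"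
  proof (rule ennreal_leI)
    have "0 \<le> ?V * (norm \<xi> * (cmod (c \<xi>))\<^sup>2 * exp (2 * norm \<xi> * (- r)))" for \<xi> using R by simp
    then show "(\<Sum>\<xi>\<in>K. ?V * (norm \<xi> * (cmod (c \<xi>))\<^sup>2 * exp (2 * norm \<xi> * 0)) - ?V * (norm \<xi> * (cmod (c \<xi>))\<^sup>2 * exp (2 * norm \<xi> * (- r)))) \<le> A"
      unfolding A_def sum_distrib_left by (intro sum_mono) simp
  qed
  finally show ?thesis using A0 by (simp add: G_def A_def)
qed

lemma energy_lower_bound:
  assumes d: "dirichlet_limit \<Omega> F B f g t"
    and R: "R > 0" "\<And>p. p \<in> \<Omega> \<Longrightarrow> fst p \<in> cube R" and K: "finite K" "K \<subseteq> lattice (pi / R)"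
  shows "(\<Sum>\<xi>\<in>K. norm \<xi> * (cmod (fourier_coeff F t \<xi>))\<^sup>2) / (2 * R) ^ DIM('a) \<le> (\<integral>p. (norm (g p))\<^sup>2 \<partial>lebesgue_on \<Omega>)"
proof -
  let ?V = "(2 * R) ^ DIM('a)" and ?a = "fourier_coeff F t"
  have V: "?V > 0" using R by simp
  \<comment> \<open>This choice maximises
    \<open>2 * Re (c \<xi> * ?a \<xi>) - ?V * (cmod (c \<xi>))\<^sup>2\<close> for each frequency,
    and it makes the pairing with \<open>g\<close> and the bound for the energy of \<open>G\<close>
    both equal to \<open>S\<close>.\<close>
  define c where "c \<xi> = cnj (?a \<xi>) / of_real ?V" for \<xi>
  define G where "G p = (\<Sum>\<xi>\<in>K. harmonic_gradient \<xi> (c \<xi>) p)" for p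
  define S where "S = (\<Sum>\<xi>\<in>K. norm \<xi> * (cmod (?a \<xi>))\<^sup>2) / ?V"
  have cG: "continuous_on UNIV G" unfolding G_def[abs_def] by (intro continuous_intros continuous_harmonic_gradient)
  have GL: "L2_on \<Omega> G" by (rule L2_on_continuous[OF cG bounded_domain domain_borel])
  have gL: "L2_on \<Omega> g" using dirichlet_limit_L2[OF d] by simp
  have i: "integrable (lebesgue_on \<Omega>) (\<lambda>p. g p \<bullet> harmonic_gradient \<xi> (c \<xi>) p)" for \<xi>
    by (rule integrable_inner_L2[OF gL L2_on_continuous[OF continuous_harmonic_gradient bounded_domain domain_borel]])
  have "(\<integral>p. g p \<bullet> G p \<partial>lebesgue_on \<Omega>) = (\<Sum>\<xi>\<in>K. \<integral>p. g p \<bullet> harmonic_gradient \<xi> (c \<xi>) p \<partial>lebesgue_on \<Omega>)"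
    unfolding G_def inner_sum_right using i by (intro Bochner_Integration.integral_sum)
  also have "\<dots> = (\<Sum>\<xi>\<in>K. norm \<xi> * Re (c \<xi> * ?a \<xi>))"
    by (simp only: dirichlet_limit_harmonic_gradient[OF d])
  also have "\<dots> = S"
  proof -
    have "Re (c \<xi> * ?a \<xi>) = (cmod (?a \<xi>))\<^sup>2 / ?V" for \<xi>
    proof -
      have "c \<xi> * ?a \<xi> = of_real ((cmod (?a \<xi>))\<^sup>2) / of_real ?V"
        unfolding c_def complex_norm_square by (simp add: mult.commute)
      then show ?thesis by (simp only: of_real_divide[symmetric] Re_complex_of_real)
    qed
    then show ?thesis by (simp add: S_def sum_divide_distrib)
  qed
  finally have 1: "(\<integral>p. g p \<bullet> G p \<partial>lebesgue_on \<Omega>) = S" .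
  have "(\<integral>p. (norm (G p))\<^sup>2 \<partial>lebesgue_on \<Omega>) \<le> ?V * (\<Sum>\<xi>\<in>K. norm \<xi> * (cmod (c \<xi>))\<^sup>2)"
    unfolding G_def by (rule integral_power2_harmonic_gradient_le[OF R K])
  also have "\<dots> = S"
  proof -
    have "cmod (c \<xi>) = cmod (?a \<xi>) / ?V" for \<xi>
      using V unfolding c_def norm_divide norm_of_real complex_mod_cnj by simp
    then have "?V * (norm \<xi> * (cmod (c \<xi>))\<^sup>2) = norm \<xi> * (cmod (?a \<xi>))\<^sup>2 / ?V" for \<xi>
      using V by (simp only: power_divide) (simp add: power2_eq_square)
    then show ?thesis by (simp only: sum_distrib_left S_def sum_divide_distrib)
  qed
  finally have "(\<integral>p. (norm (G p))\<^sup>2 \<partial>lebesgue_on \<Omega>) \<le> S" .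
  moreover have "\<bar>S\<bar> \<le> ((\<integral>p. (norm (g p))\<^sup>2 \<partial>lebesgue_on \<Omega>) + (\<integral>p. (norm (G p))\<^sup>2 \<partial>lebesgue_on \<Omega>)) / 2"
    using integral_inner_le_half_norms[OF gL GL, of 1] unfolding 1 by simp
  ultimately have "S \<le> (\<integral>p. (norm (g p))\<^sup>2 \<partial>lebesgue_on \<Omega>)" by (simp add: abs_le_iff)
  then show ?thesis by (simp only: S_def)
qed

end

section \<open>Orthonormal traces of eigenfunctions\<close>

text \<open>Formulated for a bilinear form on coefficient sequences, so that functions agreeing
  almost everywhere need not be identified; definiteness is required only on sequences supported
  below \<open>M\<close>.\<close>

lemma gram_schmidt:
  fixes b :: "(nat \<Rightarrow> real) \<Rightarrow> (nat \<Rightarrow> real) \<Rightarrow> real"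
  assumes lin: "\<And>x y c d e. b (\<lambda>p. x * c p + y * d p) e = x * b c e + y * b d e"
    and sym: "\<And>c d. b c d = b d c"
    and pos: "\<And>c p. c p \<noteq> 0 \<Longrightarrow> \<forall>p\<ge>M. c p = 0 \<Longrightarrow> b c c > 0"
    and "m \<le> M"
  shows "\<exists>A. (\<forall>i<m. \<forall>p\<ge>m. A i p = 0) \<and> (\<forall>i<m. \<forall>j<m. b (A i) (A j) = (if i = j then 1 else 0))"
  using \<open>m \<le> M\<close>
proof (induction m)
  case (Suc m)
  then obtain A where "\<forall>i<m. \<forall>p\<ge>m. A i p = 0" "\<forall>i<m. \<forall>j<m. b (A i) (A j) = (if i = j then 1 else 0)"
    using Suc_leD by blast
  note A = this[rule_format]
  have zero: "b (\<lambda>p. 0) d = 0" for d using lin[of 0 d 0 d d] by simp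
  have lin_sum: "b (\<lambda>p. \<Sum>i\<in>I. x i * c i p) d = (\<Sum>i\<in>I. x i * b (c i) d)" for I x c d
  proof (induction I rule: infinite_finite_induct)
    case (insert i I)
    then show ?case using lin[of "x i" "c i" 1 "\<lambda>p. \<Sum>i\<in>I. x i * c i p" d] by simp
  qed (simp_all add: zero)
  define e where "e p = (if p = m then 1 else 0 :: real)" for p
  define r where "r p = 1 * e p + (-1) * (\<Sum>i<m. b (A i) e * A i p)" for p
  have rd: "b r d = b e d - (\<Sum>i<m. b (A i) e * b (A i) d)" for d
    unfolding r_def by (simp only: lin lin_sum)
  have rA: "b r (A j) = 0" if "j < m" for j
  proof -
    have "(\<Sum>i<m. b (A i) e * b (A i) (A j)) = (\<Sum>i<m. if i = j then b (A j) e else 0)"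
      using that A(2) by (intro sum.cong) auto
    then show ?thesis using that by (simp add: rd sym)
  qed
  have "(\<Sum>i<m. b (A i) e * A i m) = 0" using A(1) by (intro sum.neutral) auto
  then have "r m = 1" by (simp add: r_def e_def)
  moreover have r0: "\<forall>p\<ge>Suc m. r p = 0" using A(1) by (auto simp: r_def e_def intro!: sum.neutral)
  ultimately have rr: "b r r > 0" using Suc.prems by (intro pos[of r m]) auto
  define k where "k = 1 / sqrt (b r r)"
  have scale: "b (\<lambda>p. k * r p) d = k * b r d" for d using lin[of k r 0 r d] by simp
  define A' where "A' i = (if i = m then (\<lambda>p. k * r p) else A i)" for i
  have "k * (k * b r r) = 1" using rr by (simp add: k_def field_simps)
  then have "b (A' i) (A' j) = (if i = j then 1 else 0)" if "i < Suc m" "j < Suc m" for i j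
    using that A(2)[of i j] rA[of i] rA[of j] scale sym[of r "\<lambda>p. k * r p"] sym[of "A i" "\<lambda>p. k * r p"]
    by (auto simp: A'_def less_Suc_eq)
  moreover have "A' i p = 0" if "i < Suc m" "p \<ge> Suc m" for i p
    using that A(1)[of i p] r0 by (auto simp: A'_def less_Suc_eq)
  ultimately show ?case by blast
qed simp

section \<open>Weak solutions and test functions for them\<close>

definition weak_solution where
  "weak_solution \<Omega> F B l g t \<longleftrightarrow> L2_on \<Omega> g \<and> L2_on F t \<and>
    (\<forall>u v s. H1_dirichlet \<Omega> F B u v s \<longrightarrow>
      (\<integral>x. g x \<bullet> v x \<partial>lebesgue_on \<Omega>) = l * (\<integral>x. t x * s x \<partial>lebesgue_on F))"

text \<open>Defined by duality: the pair may be inserted as a test function into every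
  \<open>weak_solution\<close>. Pairs from \<open>H1_dirichlet\<close> qualify at once, and
  combinations can be used for testing without a return to smooth approximants.\<close>

definition test_pair where
  "test_pair \<Omega> F B v s \<longleftrightarrow> L2_on \<Omega> v \<and> L2_on F s \<and>
    (\<forall>l g t. weak_solution \<Omega> F B l g t \<longrightarrow>
      (\<integral>x. g x \<bullet> v x \<partial>lebesgue_on \<Omega>) = l * (\<integral>x. t x * s x \<partial>lebesgue_on F))"

text \<open>The last conjunct makes two eigenfunctions admissible as test functions for each other; in
  this form the notion is visibly stable under linear combinations.\<close>

definition eigentriple where
  "eigentriple \<Omega> F B l f g t \<longleftrightarrow> dirichlet_limit \<Omega> F B f g t \<and> weak_solution \<Omega> F B l g t \<and> test_pair \<Omega> F B g t"

lemma H1_dirichlet_L2: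
  assumes "H1_dirichlet \<Omega> F B u v s"
  shows "L2_on \<Omega> v" "L2_on F s"
  using dirichlet_limit_L2(2,3)[OF H1_dirichlet_imp_dirichlet_limit[OF assms]] by simp_all

lemma eigenspace_imp_eigentriple:
  assumes "f \<in> steklov_dirichlet_eigenspace \<Omega> F B l"
  shows "\<exists>g t. eigentriple \<Omega> F B l f g t"
proof -
  obtain g t where gt: "H1_dirichlet \<Omega> F B f g t" "\<And>u v s. H1_dirichlet \<Omega> F B u v s \<Longrightarrow>
      (\<integral>x. g x \<bullet> v x \<partial>lebesgue_on \<Omega>) = l * (\<integral>x. t x * s x \<partial>lebesgue_on F)"
    using assms unfolding steklov_dirichlet_eigenspace_def by blast
  have "weak_solution \<Omega> F B l g t" unfolding weak_solution_def using gt H1_dirichlet_L2 by blast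
  moreover have "test_pair \<Omega> F B g t" unfolding test_pair_def weak_solution_def using gt(1) H1_dirichlet_L2 by blast
  ultimately show ?thesis using H1_dirichlet_imp_dirichlet_limit[OF gt(1)] unfolding eigentriple_def by blast
qed

lemma integral_sum_inner:
  fixes g :: "'i \<Rightarrow> 'a::euclidean_space \<Rightarrow> 'b::euclidean_space"
  assumes "\<And>i. i \<in> I \<Longrightarrow> L2_on S (g i)" "L2_on S v"
  shows "(\<integral>x. (\<Sum>i\<in>I. a i *\<^sub>R g i x) \<bullet> v x \<partial>lebesgue_on S) = (\<Sum>i\<in>I. a i * (\<integral>x. g i x \<bullet> v x \<partial>lebesgue_on S))"
proof -
  have "(\<integral>x. (\<Sum>i\<in>I. a i *\<^sub>R g i x) \<bullet> v x \<partial>lebesgue_on S) = (\<integral>x. (\<Sum>i\<in>I. a i * (g i x \<bullet> v x)) \<partial>lebesgue_on S)"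
    by (simp add: inner_sum_left)
  also have "\<dots> = (\<Sum>i\<in>I. \<integral>x. a i * (g i x \<bullet> v x) \<partial>lebesgue_on S)"
    using integrable_inner_L2 assms by (intro Bochner_Integration.integral_sum integrable_mult_right) blast
  finally show ?thesis by simp
qed

lemma eigentriple_linear_combination:
  fixes \<Omega> :: "((real ^ 'm) \<times> real) set"
  assumes "finite I" and E: "\<And>i. i \<in> I \<Longrightarrow> eigentriple \<Omega> F B l (f i) (g i) (t i)"
  shows "eigentriple \<Omega> F B l (\<lambda>x. \<Sum>i\<in>I. a i * f i x) (\<lambda>x. \<Sum>i\<in>I. a i *\<^sub>R g i x) (\<lambda>x. \<Sum>i\<in>I. a i * t i x)"
proof -
  have w: "\<And>i. i \<in> I \<Longrightarrow> weak_solution \<Omega> F B l (g i) (t i)" and tp: "\<And>i. i \<in> I \<Longrightarrow> test_pair \<Omega> F B (g i) (t i)"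
    and d: "\<And>i. i \<in> I \<Longrightarrow> dirichlet_limit \<Omega> F B (f i) (g i) (t i)"
    using E by (auto simp: eigentriple_def)
  have L: "\<And>i. i \<in> I \<Longrightarrow> L2_on \<Omega> (g i)" "\<And>i. i \<in> I \<Longrightarrow> L2_on F (t i)"
    using dirichlet_limit_L2[OF d] by auto
  note d' = dirichlet_limit_linear_combination[OF \<open>finite I\<close> d, where a = a]
  note L' = dirichlet_limit_L2(2,3)[OF d']
  have tsum: "(\<integral>x. (\<Sum>i\<in>I. a i * t i x) * s x \<partial>lebesgue_on F) = (\<Sum>i\<in>I. a i * (\<integral>x. t i x * s x \<partial>lebesgue_on F))"
    if "L2_on F s" for s
    using integral_sum_inner[of I F t s a] L(2) that by simp
  have "weak_solution \<Omega> F B l (\<lambda>x. \<Sum>i\<in>I. a i *\<^sub>R g i x) (\<lambda>x. \<Sum>i\<in>I. a i * t i x)"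
    unfolding weak_solution_def
  proof (intro conjI L' allI impI)
    fix u v s assume h: "H1_dirichlet \<Omega> F B u v s"
    note vs = H1_dirichlet_L2[OF h]
    have "(\<integral>x. (\<Sum>i\<in>I. a i *\<^sub>R g i x) \<bullet> v x \<partial>lebesgue_on \<Omega>) = (\<Sum>i\<in>I. a i * (\<integral>x. g i x \<bullet> v x \<partial>lebesgue_on \<Omega>))"
      by (rule integral_sum_inner[OF L(1) vs(1)])
    also have "\<dots> = (\<Sum>i\<in>I. a i * (l * (\<integral>x. t i x * s x \<partial>lebesgue_on F)))"
      using w h by (intro sum.cong refl) (auto simp: weak_solution_def)
    also have "\<dots> = l * (\<integral>x. (\<Sum>i\<in>I. a i * t i x) * s x \<partial>lebesgue_on F)"
      unfolding tsum[OF vs(2)] by (simp add: sum_distrib_left mult_ac)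
    finally show "(\<integral>x. (\<Sum>i\<in>I. a i *\<^sub>R g i x) \<bullet> v x \<partial>lebesgue_on \<Omega>) = l * (\<integral>x. (\<Sum>i\<in>I. a i * t i x) * s x \<partial>lebesgue_on F)" .
  qed
  moreover have "test_pair \<Omega> F B (\<lambda>x. \<Sum>i\<in>I. a i *\<^sub>R g i x) (\<lambda>x. \<Sum>i\<in>I. a i * t i x)"
    unfolding test_pair_def
  proof (intro conjI L' allI impI)
    fix k v s assume h: "weak_solution \<Omega> F B k v s"
    then have vs: "L2_on \<Omega> v" "L2_on F s" by (auto simp: weak_solution_def)
    have "(\<integral>x. v x \<bullet> (\<Sum>i\<in>I. a i *\<^sub>R g i x) \<partial>lebesgue_on \<Omega>) = (\<integral>x. (\<Sum>i\<in>I. a i *\<^sub>R g i x) \<bullet> v x \<partial>lebesgue_on \<Omega>)"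
      by (simp only: inner_commute)
    also have "\<dots> = (\<Sum>i\<in>I. a i * (\<integral>x. g i x \<bullet> v x \<partial>lebesgue_on \<Omega>))"
      by (rule integral_sum_inner[OF L(1) vs(1)])
    also have "\<dots> = (\<Sum>i\<in>I. a i * (k * (\<integral>x. t i x * s x \<partial>lebesgue_on F)))"
    proof (intro sum.cong refl)
      fix i assume "i \<in> I"
      then have "(\<integral>x. v x \<bullet> g i x \<partial>lebesgue_on \<Omega>) = k * (\<integral>x. s x * t i x \<partial>lebesgue_on F)"
        using tp h unfolding test_pair_def by blast
      then show "a i * (\<integral>x. g i x \<bullet> v x \<partial>lebesgue_on \<Omega>) = a i * (k * (\<integral>x. t i x * s x \<partial>lebesgue_on F))"
        by (simp only: inner_commute mult.commute)
    qed
    also have "\<dots> = k * (\<integral>x. (\<Sum>i\<in>I. a i * t i x) * s x \<partial>lebesgue_on F)"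
      unfolding tsum[OF vs(2)] by (simp add: sum_distrib_left mult_ac)
    finally show "(\<integral>x. v x \<bullet> (\<Sum>i\<in>I. a i *\<^sub>R g i x) \<partial>lebesgue_on \<Omega>) = k * (\<integral>x. s x * (\<Sum>i\<in>I. a i * t i x) \<partial>lebesgue_on F)"
      by (simp only: mult.commute)
  qed
  ultimately show ?thesis using d' by (simp add: eigentriple_def)
qed

lemma eigentriple_inner:
  assumes "eigentriple \<Omega> F B l f g t" "eigentriple \<Omega> F B k u v s"
  shows "(\<integral>x. g x \<bullet> v x \<partial>lebesgue_on \<Omega>) = l * (\<integral>x. t x * s x \<partial>lebesgue_on F)"
  using assms unfolding eigentriple_def test_pair_def by blast

lemma eigentriple_orthogonal:
  assumes "eigentriple \<Omega> F B l f g t" "eigentriple \<Omega> F B k u v s" "l \<noteq> k"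
  shows "(\<integral>x. t x * s x \<partial>lebesgue_on F) = 0"
proof -
  have "l * (\<integral>x. t x * s x \<partial>lebesgue_on F) = (\<integral>x. g x \<bullet> v x \<partial>lebesgue_on \<Omega>)"
    using eigentriple_inner[OF assms(1,2)] by simp
  also have "\<dots> = (\<integral>x. v x \<bullet> g x \<partial>lebesgue_on \<Omega>)" by (simp only: inner_commute)
  also have "\<dots> = k * (\<integral>x. s x * t x \<partial>lebesgue_on F)" by (rule eigentriple_inner[OF assms(2,1)])
  also have "\<dots> = k * (\<integral>x. t x * s x \<partial>lebesgue_on F)" by (simp only: mult.commute)
  finally show ?thesis using assms(3) by simp
qed

text \<open>The energy is \<open>l\<close> times the squared norm of the trace, so a vanishing trace
  forces a vanishing gradient.\<close>

lemma eigentriple_trace_zero: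
  assumes dom: "free_boundary_domain \<Omega> F B" and E: "eigentriple \<Omega> F B l f g t" and t: "(\<integral>x. (t x)\<^sup>2 \<partial>lebesgue_on F) = 0"
  shows "AE x in lebesgue_on \<Omega>. f x = 0"
proof (rule free_boundary_domain.zero_gradient_imp_zero[OF dom])
  show "dirichlet_limit \<Omega> F B f g t" using E by (simp add: eigentriple_def)
  show "(\<integral>x. (norm (g x))\<^sup>2 \<partial>lebesgue_on \<Omega>) = 0"
    unfolding power2_norm_eq_inner eigentriple_inner[OF E E] using t by (simp add: power2_eq_square)
qed

text \<open>Gram--Schmidt for the form given by traces on coefficient sequences. If a combination
  had trace norm 0, the combination itself would vanish almost everywhere in
  \<open>\<Omega>\<close>, against independence.\<close>

lemma orthonormal_traces_of_eigenspace:
  fixes \<Omega> :: "((real ^ 'm) \<times> real) set"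
  assumes dom: "free_boundary_domain \<Omega> F B"
    and f: "\<And>i. i < m \<Longrightarrow> f i \<in> steklov_dirichlet_eigenspace \<Omega> F B l" and ind: "independent_ae \<Omega> m f"
  shows "\<exists>f' g t. \<forall>i<m. eigentriple \<Omega> F B l (f' i) (g i) (t i) \<and>
    (\<forall>j<m. (\<integral>x. t i x * t j x \<partial>lebesgue_on F) = (if i = j then 1 else 0))"
proof -
  interpret free_boundary_domain \<Omega> F B by fact
  have "\<forall>i\<in>{..<m}. \<exists>gt. eigentriple \<Omega> F B l (f i) (fst gt) (snd gt)"
    using eigenspace_imp_eigentriple f by force
  from bchoice[OF this] obtain gt where gt: "\<And>i. i < m \<Longrightarrow> eigentriple \<Omega> F B l (f i) (fst (gt i)) (snd (gt i))"
    by auto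
  define g t where "g i = fst (gt i)" and "t i = snd (gt i)" for i
  have E: "eigentriple \<Omega> F B l (\<lambda>x. \<Sum>i<m. a i * f i x) (\<lambda>x. \<Sum>i<m. a i *\<^sub>R g i x) (\<lambda>x. \<Sum>i<m. a i * t i x)" for a
    by (rule eigentriple_linear_combination) (auto simp: g_def t_def gt)
  have L: "L2_on F (\<lambda>x. \<Sum>i<m. a i * t i x)" for a
    using E[of a] dirichlet_limit_L2 unfolding eigentriple_def by blast
  define b where "b c d = (\<integral>x. (\<Sum>i<m. c i * t i x) * (\<Sum>i<m. d i * t i x) \<partial>lebesgue_on F)" for c d
  have "\<exists>A. (\<forall>i<m. \<forall>p\<ge>m. A i p = 0) \<and> (\<forall>i<m. \<forall>j<m. b (A i) (A j) = (if i = j then 1 else 0))"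
  proof (rule gram_schmidt)
    fix x y :: real and c d e :: "nat \<Rightarrow> real"
    have i: "integrable (lebesgue_on F) (\<lambda>z. (\<Sum>i<m. c i * t i z) * (\<Sum>i<m. e i * t i z))" for c e
      using integrable_inner_L2[OF L[of c] L[of e]] by simp
    have "(\<Sum>i<m. (x * c i + y * d i) * t i z) * (\<Sum>i<m. e i * t i z)
        = x * ((\<Sum>i<m. c i * t i z) * (\<Sum>i<m. e i * t i z)) + y * ((\<Sum>i<m. d i * t i z) * (\<Sum>i<m. e i * t i z))" for z
      unfolding mult.assoc[symmetric] distrib_right[symmetric]
      by (simp add: sum_distrib_left sum.distrib[symmetric] algebra_simps)
    then show "b (\<lambda>p. x * c p + y * d p) e = x * b c e + y * b d e"
      unfolding b_def by (simp add: i)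
  next
    show "b c d = b d c" for c d unfolding b_def by (simp only: mult.commute)
  next
    fix c :: "nat \<Rightarrow> real" and p assume c: "c p \<noteq> 0" "\<forall>p\<ge>m. c p = 0"
    have "b c c \<ge> 0" unfolding b_def by simp
    moreover have "b c c \<noteq> 0"
    proof
      assume "b c c = 0"
      then have "AE x in lebesgue_on \<Omega>. (\<Sum>i<m. c i * f i x) = 0"
        by (intro eigentriple_trace_zero[OF dom E]) (simp add: b_def power2_eq_square)
      then have "\<forall>i<m. c i = 0" using ind by (simp add: independent_ae_def)
      then show False using c by (metis not_le)
    qed
    ultimately show "b c c > 0" by simp
  qed simp
  then obtain A where "\<And>i j. i < m \<Longrightarrow> j < m \<Longrightarrow> b (A i) (A j) = (if i = j then 1 else 0)" by blast
  then show ?thesis using E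
    by (intro exI[of _ "\<lambda>i x. \<Sum>p<m. A i p * f p x"] exI[of _ "\<lambda>i x. \<Sum>p<m. A i p *\<^sub>R g p x"] exI[of _ "\<lambda>i x. \<Sum>p<m. A i p * t p x"])
       (auto simp: b_def)
qed

text \<open>Orthonormal families for the single eigenvalues are distributed over the indices of the
  list; different eigenvalues are orthogonal by symmetry of the weak form.\<close>

lemma orthonormal_eigentriples:
  fixes \<Omega> :: "((real ^ 'm) \<times> real) set"
  assumes dom: "free_boundary_domain \<Omega> F B" and \<eta>: "steklov_dirichlet_eigenvalues \<Omega> F B \<eta>"
  obtains f g t where "\<And>j. eigentriple \<Omega> F B (\<eta> j) (f j) (g j) (t j)"
    "\<And>i j. (\<integral>x. t i x * t j x \<partial>lebesgue_on F) = (if i = j then 1 else 0)"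
proof -
  define S where "S l = {j. \<eta> j = l}" for l
  have S: "finite (S l)" "enat (card (S l)) = steklov_dirichlet_multiplicity \<Omega> F B l" for l
    using \<eta> by (auto simp: steklov_dirichlet_eigenvalues_def S_def)
  define P where "P l q \<longleftrightarrow> (\<forall>i<card (S l). eigentriple \<Omega> F B l (fst q i) (fst (snd q) i) (snd (snd q) i) \<and>
    (\<forall>j<card (S l). (\<integral>x. snd (snd q) i x * snd (snd q) j x \<partial>lebesgue_on F) = (if i = j then 1 else 0)))" for l q
  have "\<exists>q. P l q" for l
  proof -
    define X where "X = {k. \<exists>f. (\<forall>i<k. f i \<in> steklov_dirichlet_eigenspace \<Omega> F B l) \<and> independent_ae \<Omega> k f}"
    have eq: "Sup (enat ` X) = enat (card (S l))" unfolding S(2) steklov_dirichlet_multiplicity_def X_def by simp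
    have "0 \<in> X" by (auto simp: X_def independent_ae_def)
    then have ne: "enat ` X \<noteq> {}" by auto
    \<comment> \<open>A nonempty infinite set of \<open>enat\<close> has infinite supremum. Here the
      supremum is \<open>card (S l)\<close>, so the set is finite and an independent family of this
      size exists.\<close>
    have "finite (enat ` X)" using eq ne by (auto simp: Sup_enat_def split: if_splits)
    then have "Sup (enat ` X) \<in> enat ` X" using ne Max_in[of "enat ` X"] by (simp add: Sup_enat_def)
    then have "card (S l) \<in> X" using eq by auto
    then obtain f where "\<And>i. i < card (S l) \<Longrightarrow> f i \<in> steklov_dirichlet_eigenspace \<Omega> F B l" "independent_ae \<Omega> (card (S l)) f"
      unfolding X_def by blast
    from orthonormal_traces_of_eigenspace[OF dom this] obtain f' g t where
      "\<forall>i<card (S l). eigentriple \<Omega> F B l (f' i) (g i) (t i) \<and>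
        (\<forall>j<card (S l). (\<integral>x. t i x * t j x \<partial>lebesgue_on F) = (if i = j then 1 else 0))" by blast
    then show ?thesis unfolding P_def by (intro exI[of _ "(f', g, t)"]) simp
  qed
  then obtain q where "\<And>l. P l (q l)" by metis
  then have q: "\<And>l i. i < card (S l) \<Longrightarrow> eigentriple \<Omega> F B l (fst (q l) i) (fst (snd (q l)) i) (snd (snd (q l)) i)"
      "\<And>l i j. i < card (S l) \<Longrightarrow> j < card (S l) \<Longrightarrow> (\<integral>x. snd (snd (q l)) i x * snd (snd (q l)) j x \<partial>lebesgue_on F) = (if i = j then 1 else 0)"
    by (simp_all add: P_def)
  \<comment> \<open>Each level set of \<open>\<eta>\<close> has as many indices as there are
    eigenfunctions for its value, so numbering it gives every index an eigenfunction of its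
    own.\<close>
  have "\<exists>h. bij_betw h (S l) {0..<card (S l)}" for l by (rule ex_bij_betw_finite_nat[OF S(1)])
  then obtain h where h: "\<And>l. bij_betw (h l) (S l) {0..<card (S l)}" by metis
  define k where "k j = h (\<eta> j) j" for j
  have k: "k j < card (S (\<eta> j))" for j
    using bij_betwE[OF h[of "\<eta> j"]] by (auto simp: S_def k_def)
  have kinj: "i = j" if "\<eta> i = \<eta> j" "k i = k j" for i j
    using that bij_betw_imp_inj_on[OF h[of "\<eta> j"]] by (auto simp: S_def k_def inj_on_def)
  show thesis
  proof (rule that)
    show E: "eigentriple \<Omega> F B (\<eta> j) (fst (q (\<eta> j)) (k j)) (fst (snd (q (\<eta> j))) (k j)) (snd (snd (q (\<eta> j))) (k j))" for j
      by (rule q(1)[OF k])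
    show "(\<integral>x. snd (snd (q (\<eta> i))) (k i) x * snd (snd (q (\<eta> j))) (k j) x \<partial>lebesgue_on F) = (if i = j then 1 else 0)" for i j
    proof (cases "\<eta> i = \<eta> j")
      case True
      then show ?thesis using q(2)[of "k i" "\<eta> j" "k j"] k[of i] k[of j] kinj by auto
    next
      case False
      then show ?thesis using eigentriple_orthogonal[OF E[of i] E[of j]] by auto
    qed
  qed
qed

lemma bessel:
  fixes t :: "nat \<Rightarrow> 'a::euclidean_space \<Rightarrow> real"
  assumes t: "\<And>j. L2_on S (t j)" and w: "L2_on S w"
    and o: "\<And>i j. (\<integral>x. t i x * t j x \<partial>lebesgue_on S) = (if i = j then 1 else 0)"
  shows "(\<Sum>j<N. (\<integral>x. t j x * w x \<partial>lebesgue_on S)\<^sup>2) \<le> (\<integral>x. (w x)\<^sup>2 \<partial>lebesgue_on S)"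
proof -
  define a where "a j = (\<integral>x. t j x * w x \<partial>lebesgue_on S)" for j
  define p where "p x = (\<Sum>j<N. a j * t j x)" for x
  have p: "L2_on S p" unfolding p_def using L2_on_sum[of "{..<N}" S "\<lambda>j x. a j *\<^sub>R t j x"] L2_on_scaleR[OF t] by simp
  have pw: "(\<integral>x. p x * v x \<partial>lebesgue_on S) = (\<Sum>j<N. a j * (\<integral>x. t j x * v x \<partial>lebesgue_on S))" if "L2_on S v" for v
    using integral_sum_inner[of "{..<N}" S t v a] t that by (simp add: p_def)
  have tp: "(\<integral>x. t j x * p x \<partial>lebesgue_on S) = a j" if "j < N" for j
  proof -
    have "(\<integral>x. t j x * p x \<partial>lebesgue_on S) = (\<integral>x. p x * t j x \<partial>lebesgue_on S)" by (simp only: mult.commute)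
    also have "\<dots> = (\<Sum>i<N. if i = j then a j else 0)" unfolding pw[OF t] o by (intro sum.cong) auto
    finally show ?thesis using that by simp
  qed
  have i: "integrable (lebesgue_on S) (\<lambda>x. (w x)\<^sup>2)" "integrable (lebesgue_on S) (\<lambda>x. p x * w x)" "integrable (lebesgue_on S) (\<lambda>x. p x * p x)"
    using L2_onD(2)[OF w] integrable_inner_L2[OF p w] integrable_inner_L2[OF p p] by simp_all
  have "0 \<le> (\<integral>x. (w x - p x)\<^sup>2 \<partial>lebesgue_on S)" by simp
  also have "\<dots> = (\<integral>x. (w x)\<^sup>2 - 2 * (p x * w x) + p x * p x \<partial>lebesgue_on S)"
    by (simp add: power2_eq_square algebra_simps)
  also have "\<dots> = (\<integral>x. (w x)\<^sup>2 \<partial>lebesgue_on S) - 2 * (\<integral>x. p x * w x \<partial>lebesgue_on S) + (\<integral>x. p x * p x \<partial>lebesgue_on S)"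
    using i by simp
  also have "(\<integral>x. p x * w x \<partial>lebesgue_on S) = (\<Sum>j<N. (a j)\<^sup>2)"
    unfolding pw[OF w] by (simp add: a_def power2_eq_square)
  also have "(\<integral>x. p x * p x \<partial>lebesgue_on S) = (\<Sum>j<N. (a j)\<^sup>2)"
    unfolding pw[OF p] using tp by (simp add: power2_eq_square)
  finally show ?thesis by (simp add: a_def)
qed

section \<open>The Riesz mean bound\<close>

text \<open>The tangent at \<open>a\<close>, by scaling from Bernoulli's inequality. The sign of the
  slope matters: with \<open>c \<ge> 0\<close> the correction \<open>c * (s - a)\<close> is
  controlled by an upper bound on the mean of \<open>s\<close>.\<close>

lemma riesz_supporting_line:
  fixes \<gamma> z a :: real
  assumes "\<gamma> \<ge> 1"
  obtains c where "c \<ge> 0" "\<And>s. max 0 (z - a) powr \<gamma> \<le> max 0 (z - s) powr \<gamma> + c * (s - a)"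
proof (cases "a < z")
  case False
  then show thesis by (intro that[of 0]) auto
next
  case True
  define w where "w = z - a"
  have w: "w > 0" using True by (simp add: w_def)
  \<comment> \<open>The tangent of \<open>r powr \<gamma>\<close> at 1. For \<open>r \<le> 0\<close>
    the tangent is at most 0 because \<open>\<gamma> \<ge> 1\<close>.\<close>
  have bern: "1 + \<gamma> * (r - 1) \<le> max 0 r powr \<gamma>" for r :: real
  proof (cases "r > 0")
    case False
    have "1 * (1 - r) \<le> \<gamma> * (1 - r)" using False assms by (intro mult_right_mono) auto
    then have "1 + \<gamma> * (r - 1) \<le> 0" using False by (simp add: algebra_simps)
    then show ?thesis using False assms by simp
  next
    case r: True
    have "1 + \<gamma> * (r - 1) \<le> r powr \<gamma>"
    proof -
      have d: "((\<lambda>x. x powr \<gamma>) has_real_derivative \<gamma>) (at (1::real) within {0<..})"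
        by (auto intro!: derivative_eq_intros)
      have "(1::real) \<in> interior {0<..}" by (simp add: interior_open)
      from convex_on_imp_above_tangent[OF powr_convex[OF assms] _ this _ d, of r]
      show ?thesis using r by (simp add: connected_Ioi)
    qed
    then show ?thesis using r by simp
  qed
  show thesis
  proof (rule that)
    show "\<gamma> * w powr (\<gamma> - 1) \<ge> 0" using assms by simp
    fix s
    have "w powr \<gamma> * (1 + \<gamma> * ((z - s) / w - 1)) \<le> w powr \<gamma> * max 0 ((z - s) / w) powr \<gamma>"
      using bern by (intro mult_left_mono) auto
    also have "\<dots> = max 0 (z - s) powr \<gamma>"
    proof -
      have "max 0 (z - s) = w * max 0 ((z - s) / w)" using w by (auto simp: max_def field_simps)
      then show ?thesis using w by (simp add: powr_mult)
    qed
    also have "w powr \<gamma> * (1 + \<gamma> * ((z - s) / w - 1)) = w powr \<gamma> - \<gamma> * w powr (\<gamma> - 1) * (s - a)"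
    proof -
      have "w powr \<gamma> = w powr (\<gamma> - 1) * w" using w powr_add[of w "\<gamma> - 1" 1] by simp
      then have "w powr \<gamma> * (\<gamma> * ((z - s) / w - 1)) = w powr (\<gamma> - 1) * (\<gamma> * ((z - s) - w))"
        using w by (simp add: field_simps)
      then show ?thesis by (simp add: w_def algebra_simps)
    qed
    finally show "max 0 (z - a) powr \<gamma> \<le> max 0 (z - s) powr \<gamma> + \<gamma> * w powr (\<gamma> - 1) * (s - a)"
      using True by (simp add: w_def)
  qed
qed

lemma admissible_imp_free_boundary_domain:
  assumes "admissible_domain \<Omega> F B" "\<Omega> \<subseteq> F \<times> {..0}"
  shows "free_boundary_domain \<Omega> F B"
  using assms by (simp add: admissible_domain_def free_boundary_domain_def)

text \<open>Bessel's inequality is applied to the cosine and the sine of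
  \<open>\<xi> \<bullet> x\<close> separately; their squares add up to 1, whose integral is the
  measure of \<open>F\<close>.\<close>

lemma bessel_fourier:
  fixes F :: "'a::euclidean_space set" and t :: "nat \<Rightarrow> 'a \<Rightarrow> real"
  assumes F: "compact F" and t: "\<And>j. L2_on F (t j)"
    and o: "\<And>i j. (\<integral>x. t i x * t j x \<partial>lebesgue_on F) = (if i = j then 1 else 0)"
  shows "(\<Sum>j<N. (cmod (fourier_coeff F (t j) \<xi>))\<^sup>2) \<le> measure lebesgue F"
proof -
  have Fb: "F \<in> sets borel" and bF: "bounded F"
    using F by (auto simp: compact_imp_closed compact_imp_bounded)
  let ?w = "\<lambda>c x. Re (c * cis (\<xi> \<bullet> x))"
  have cw: "continuous_on UNIV (?w c)" for c by (intro continuous_intros)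
  have w: "L2_on F (?w c)" for c by (rule L2_on_continuous[OF cw bF Fb])
  have i: "integrable (lebesgue_on F) (\<lambda>x. (?w c x)\<^sup>2)" for c
    using L2_onD(2)[OF w[of c]] by (simp only: real_norm_def power2_abs)
  \<comment> \<open>The multipliers 1 and \<open>-\<i>\<close> extract the real and the imaginary
    part of the coefficient.\<close>
  have a: "(cmod (fourier_coeff F (t j) \<xi>))\<^sup>2
      = (\<integral>x. t j x * ?w 1 x \<partial>lebesgue_on F)\<^sup>2 + (\<integral>x. t j x * ?w (-\<i>) x \<partial>lebesgue_on F)\<^sup>2" for j
    unfolding integral_times_Re_cis[OF t bF Fb] by (simp add: cmod_power2)
  have "(\<Sum>j<N. (cmod (fourier_coeff F (t j) \<xi>))\<^sup>2)
      \<le> (\<integral>x. (?w 1 x)\<^sup>2 \<partial>lebesgue_on F) + (\<integral>x. (?w (-\<i>) x)\<^sup>2 \<partial>lebesgue_on F)"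
    unfolding a sum.distrib by (intro add_mono bessel t w o)
  also have "\<dots> = (\<integral>x. (?w 1 x)\<^sup>2 + (?w (-\<i>) x)\<^sup>2 \<partial>lebesgue_on F)"
    by (rule Bochner_Integration.integral_add[OF i i, symmetric])
  also have "\<dots> = (\<integral>x. 1 \<partial>lebesgue_on F)" by simp
  also have "\<dots> = measure lebesgue F"
    using lmeasurable_compact[OF F] by (simp add: measure_restrict_space fmeasurableD)
  finally show ?thesis .
qed

text \<open>The lattice \<open>(\<pi>/R) \<int>\<^sup>d\<close> is the dual lattice of the cube of side \<open>2 R\<close>, so the squared
  Fourier coefficients of a trace, divided by the volume, are weights of total mass one with mean
  frequency at most \<open>\<eta> j\<close>; Jensen's inequality is applied in the form of a supporting line.\<close>

lemma riesz_sum_le_lattice_sum: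
  fixes \<Omega> :: "((real ^ 'm) \<times> real) set" and \<eta> :: "nat \<Rightarrow> real"
  assumes dom: "free_boundary_domain \<Omega> F B"
    and E: "\<And>j. eigentriple \<Omega> F B (\<eta> j) (f j) (g j) (t j)"
    and o: "\<And>i j. (\<integral>x. t i x * t j x \<partial>lebesgue_on F) = (if i = j then 1 else 0)"
    and R: "R > 0" "\<And>p. p \<in> \<Omega> \<Longrightarrow> fst p \<in> cube R" "F \<subseteq> box (- R *\<^sub>R One) (R *\<^sub>R One)"
    and "\<gamma> \<ge> 1" and "\<epsilon> > 0"
  obtains K :: "(real ^ 'm) set" where "finite K" "K \<subseteq> lattice (pi / R)"
    "(\<Sum>j<N. max 0 (z - \<eta> j) powr \<gamma>)
      \<le> (\<Sum>\<xi>\<in>K. max 0 (z - norm \<xi>) powr \<gamma>) * measure lebesgue F / (2 * R) ^ CARD('m) + \<epsilon>"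
proof -
  interpret free_boundary_domain \<Omega> F B by fact
  let ?V = "(2 * R) ^ CARD('m)"
  have V: "?V > 0" using R by simp
  have d: "dirichlet_limit \<Omega> F B (f j) (g j) (t j)" for j using E by (simp add: eigentriple_def)
  have tL: "L2_on F (t j)" for j using dirichlet_limit_L2[OF d] by simp
  define \<mu> where "\<mu> j \<xi> = (cmod (fourier_coeff F (t j) \<xi>))\<^sup>2 / ?V" for j \<xi>
  have \<mu>0: "\<mu> j \<xi> \<ge> 0" for j \<xi> using V by (simp add: \<mu>_def)
  define \<phi> where "\<phi> s = max 0 (z - s) powr \<gamma>" for s
  have \<phi>0: "\<phi> s \<ge> 0" for s by (simp add: \<phi>_def)
  have "\<forall>j. \<exists>c\<ge>0. \<forall>s. \<phi> (\<eta> j) \<le> \<phi> s + c * (s - \<eta> j)"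
    using riesz_supporting_line[OF \<open>\<gamma> \<ge> 1\<close>] unfolding \<phi>_def by metis
  then obtain c where c: "\<And>j. c j \<ge> 0" "\<And>j s. \<phi> (\<eta> j) \<le> \<phi> s + c j * (s - \<eta> j)" by metis
  have energy: "(\<integral>p. (norm (g j p))\<^sup>2 \<partial>lebesgue_on \<Omega>) = \<eta> j" for j
    unfolding power2_norm_eq_inner eigentriple_inner[OF E E] o by simp
  then have \<eta>0: "\<eta> j \<ge> 0" for j by (metis Bochner_Integration.integral_nonneg zero_le_power2)
  \<comment> \<open>Index \<open>j\<close> will lose
    \<open>\<epsilon> / C * (\<phi> (\<eta> j) + c j * \<eta> j)\<close>, so the total loss is
    \<open>\<epsilon> / C * (C - 1)\<close>, less than \<open>\<epsilon>\<close>. The summand 1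
    keeps \<open>C\<close> positive.\<close>
  define C where "C = (\<Sum>j<N. \<phi> (\<eta> j) + c j * \<eta> j) + 1"
  have C: "C > 0" unfolding C_def using c(1) \<phi>0 \<eta>0 by (intro add_nonneg_pos sum_nonneg) auto
  have "\<exists>K. finite K \<and> K \<subseteq> lattice (pi / R) \<and> (\<forall>K'. finite K' \<longrightarrow> K \<subseteq> K' \<longrightarrow> 1 - \<epsilon> / C \<le> (\<Sum>\<xi>\<in>K'. \<mu> j \<xi>))" for j
  proof -
    obtain \<phi>k where \<phi>k: "\<And>k. C1 (\<phi>k k)" "\<And>k x. x \<in> B \<Longrightarrow> \<phi>k k x = 0" "L2_converges_on F (\<lambda>k x. \<phi>k k (x, 0)) (t j)"
      using dirichlet_limitE[OF d[of j]] by metis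
    have "\<epsilon> / C > 0" using C \<open>\<epsilon> > 0\<close> by simp
    moreover have "continuous_on UNIV (\<lambda>x. if x \<in> F then \<phi>k k (x, 0) else 0)" for k
      by (rule continuous_trace[OF C1D(2)[OF \<phi>k(1)] \<phi>k(2)])
    ultimately obtain K where "finite K" "K \<subseteq> lattice (pi / R)"
      "\<And>K'. finite K' \<Longrightarrow> K \<subseteq> K' \<Longrightarrow>
      (\<integral>x. (t j x)\<^sup>2 \<partial>lebesgue_on F) - \<epsilon> / C \<le> (\<Sum>\<xi>\<in>K'. (cmod (fourier_coeff F (t j) \<xi>))\<^sup>2) / (2 * R) ^ DIM(real ^ 'm)"
      using parseval_lower_bound[OF compact_F R(3,1) \<phi>k(3), of "\<epsilon> / C"] by blast
    moreover have "(\<integral>x. (t j x)\<^sup>2 \<partial>lebesgue_on F) = 1" using o[of j j] by (simp add: power2_eq_square)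
    ultimately show ?thesis
      by (intro exI[of _ K]) (simp add: \<mu>_def sum_divide_distrib)
  qed
  then obtain K0 where K0: "\<And>j. finite (K0 j)" "\<And>j. K0 j \<subseteq> lattice (pi / R)"
    "\<And>j K'. finite K' \<Longrightarrow> K0 j \<subseteq> K' \<Longrightarrow> 1 - \<epsilon> / C \<le> (\<Sum>\<xi>\<in>K'. \<mu> j \<xi>)" by metis
  \<comment> \<open>One frequency set for all \<open>j < N\<close>, so that the two sums can be
    interchanged; the mass bounds persist for larger finite sets.\<close>
  define K where "K = (\<Union>j<N. K0 j)"
  have K: "finite K" "K \<subseteq> lattice (pi / R)" using K0 by (auto simp: K_def)
  have mass: "1 - \<epsilon> / C \<le> (\<Sum>\<xi>\<in>K. \<mu> j \<xi>)" if "j < N" for j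
    using that K by (intro K0(3)) (auto simp: K_def)
  have mean: "(\<Sum>\<xi>\<in>K. norm \<xi> * \<mu> j \<xi>) \<le> \<eta> j" for j
    using energy_lower_bound[OF d R(1,2) K, of j] energy[of j] by (simp add: \<mu>_def sum_divide_distrib)
  have one: "\<phi> (\<eta> j) \<le> (\<Sum>\<xi>\<in>K. \<phi> (norm \<xi>) * \<mu> j \<xi>) + \<epsilon> / C * (\<phi> (\<eta> j) + c j * \<eta> j)" if "j < N" for j
  proof -
    let ?m = "\<Sum>\<xi>\<in>K. \<mu> j \<xi>"
    have "(\<Sum>\<xi>\<in>K. \<phi> (\<eta> j) * \<mu> j \<xi>) \<le> (\<Sum>\<xi>\<in>K. (\<phi> (norm \<xi>) + c j * (norm \<xi> - \<eta> j)) * \<mu> j \<xi>)"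
      using c(2) \<mu>0 by (intro sum_mono mult_right_mono) auto
    also have "\<dots> = (\<Sum>\<xi>\<in>K. \<phi> (norm \<xi>) * \<mu> j \<xi>) + c j * ((\<Sum>\<xi>\<in>K. norm \<xi> * \<mu> j \<xi>) - \<eta> j * ?m)"
      by (simp add: sum_distrib_left sum.distrib[symmetric] sum_subtractf[symmetric] algebra_simps)
    finally have 1: "\<phi> (\<eta> j) * ?m \<le> (\<Sum>\<xi>\<in>K. \<phi> (norm \<xi>) * \<mu> j \<xi>) + c j * ((\<Sum>\<xi>\<in>K. norm \<xi> * \<mu> j \<xi>) - \<eta> j * ?m)"
      by (simp only: sum_distrib_left)
    have m: "1 - ?m \<le> \<epsilon> / C" using mass[OF that] by simp
    have "(\<Sum>\<xi>\<in>K. norm \<xi> * \<mu> j \<xi>) - \<eta> j * ?m \<le> \<eta> j * (1 - ?m)" using mean[of j] by (simp add: algebra_simps)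
    also have "\<dots> \<le> \<eta> j * (\<epsilon> / C)" using m \<eta>0 by (intro mult_left_mono)
    finally have 2: "c j * ((\<Sum>\<xi>\<in>K. norm \<xi> * \<mu> j \<xi>) - \<eta> j * ?m) \<le> c j * (\<eta> j * (\<epsilon> / C))"
      using c(1) by (intro mult_left_mono)
    have 3: "\<phi> (\<eta> j) * (1 - ?m) \<le> \<phi> (\<eta> j) * (\<epsilon> / C)" using m \<phi>0 by (intro mult_left_mono)
    have "\<phi> (\<eta> j) = \<phi> (\<eta> j) * ?m + \<phi> (\<eta> j) * (1 - ?m)" by (simp add: algebra_simps)
    also have "\<dots> \<le> (\<Sum>\<xi>\<in>K. \<phi> (norm \<xi>) * \<mu> j \<xi>) + c j * (\<eta> j * (\<epsilon> / C)) + \<phi> (\<eta> j) * (\<epsilon> / C)"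
      using 1 2 3 by linarith
    also have "\<dots> = (\<Sum>\<xi>\<in>K. \<phi> (norm \<xi>) * \<mu> j \<xi>) + \<epsilon> / C * (\<phi> (\<eta> j) + c j * \<eta> j)" by (simp add: algebra_simps)
    finally show ?thesis .
  qed
  have "(\<Sum>j<N. \<phi> (\<eta> j)) \<le> (\<Sum>j<N. (\<Sum>\<xi>\<in>K. \<phi> (norm \<xi>) * \<mu> j \<xi>) + \<epsilon> / C * (\<phi> (\<eta> j) + c j * \<eta> j))"
    using one by (intro sum_mono) auto
  also have "\<dots> = (\<Sum>\<xi>\<in>K. \<phi> (norm \<xi>) * (\<Sum>j<N. \<mu> j \<xi>)) + \<epsilon> / C * (C - 1)"
    unfolding sum.distrib C_def by (subst sum.swap) (simp add: sum_distrib_left sum.distrib distrib_left)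
  also have "\<dots> \<le> (\<Sum>\<xi>\<in>K. \<phi> (norm \<xi>) * (measure lebesgue F / ?V)) + \<epsilon>"
  proof (intro add_mono sum_mono mult_left_mono \<phi>0)
    fix \<xi>
    show "(\<Sum>j<N. \<mu> j \<xi>) \<le> measure lebesgue F / ?V"
      unfolding \<mu>_def sum_divide_distrib[symmetric]
      using V by (intro divide_right_mono bessel_fourier[OF compact_F tL o]) auto
    show "\<epsilon> / C * (C - 1) \<le> \<epsilon>" using C \<open>\<epsilon> > 0\<close> by (simp add: field_simps)
  qed
  also have "(\<Sum>\<xi>\<in>K. \<phi> (norm \<xi>) * (measure lebesgue F / ?V)) = (\<Sum>\<xi>\<in>K. \<phi> (norm \<xi>)) * measure lebesgue F / ?V"
    by (simp add: sum_distrib_right sum_divide_distrib)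
  finally show thesis using that K by (simp add: \<phi>_def)
qed

text \<open>For fixed \<open>R\<close> the integral bounds the lattice sum over every finite
  \<open>K\<close>, so \<open>\<epsilon>\<close> can be removed; the remaining error is the shift
  \<open>pi / R * CARD('m)\<close> of \<open>z\<close>, which vanishes as \<open>R\<close>
  grows.\<close>

lemma riesz_sum_le:
  fixes \<Omega> :: "((real ^ 'm) \<times> real) set" and \<eta> :: "nat \<Rightarrow> real"
  assumes dom: "free_boundary_domain \<Omega> F B"
    and E: "\<And>j. eigentriple \<Omega> F B (\<eta> j) (f j) (g j) (t j)"
    and o: "\<And>i j. (\<integral>x. t i x * t j x \<partial>lebesgue_on F) = (if i = j then 1 else 0)"
    and "\<gamma> \<ge> 1" "z > 0"
  shows "(\<Sum>j<N. max 0 (z - \<eta> j) powr \<gamma>)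
    \<le> riesz_const (CARD('m) + 1) \<gamma> * measure lebesgue F * z powr (\<gamma> + CARD('m))"
proof -
  interpret free_boundary_domain \<Omega> F B by fact
  let ?d = "CARD('m)"
  let ?S = "\<Sum>j<N. max 0 (z - \<eta> j) powr \<gamma>" and ?m = "measure lebesgue F"
  define A where "A = unit_ball_vol ?d * \<gamma> * Beta \<gamma> (?d + 1)"
  have A: "A = riesz_const (?d + 1) \<gamma> * (2 * pi) ^ ?d"
    unfolding A_def using riesz_const_eq[of \<gamma> ?d] assms by simp
  have A0: "A \<ge> 0" unfolding A_def Beta_def using assms by (intro mult_nonneg_nonneg divide_nonneg_nonneg less_imp_le[OF Gamma_real_pos]) auto
  obtain r0 where r0: "r0 > 0" "\<And>p. p \<in> \<Omega> \<Longrightarrow> norm p \<le> r0" using bounded_domain bounded_pos by metis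
  obtain r1 where r1: "r1 > 0" "\<And>x. x \<in> F \<Longrightarrow> norm x \<le> r1" using bounded_F bounded_pos by metis
  define r where "r = r0 + r1 + 1"
  have r: "r > 0" using r0 r1 by (simp add: r_def)
  have bound: "?S \<le> A * (z + pi / R * ?d) powr (\<gamma> + ?d) * ?m / (2 * pi) ^ ?d" if "R \<ge> r" for R
  proof (rule field_le_epsilon)
    fix \<epsilon> :: real assume "\<epsilon> > 0"
    have R: "R > 0" using that r by simp
    have "fst p \<in> cube R" if "p \<in> \<Omega>" for p
    proof -
      have "\<bar>fst p \<bullet> b\<bar> \<le> R" if "b \<in> Basis" for b
      proof -
        have "\<bar>fst p \<bullet> b\<bar> \<le> norm (fst p)" using that by (rule Basis_le_norm)
        also have "\<dots> \<le> norm p" by (metis norm_fst_le prod.collapse)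
        finally show ?thesis using r0(2)[OF \<open>p \<in> \<Omega>\<close>] \<open>R \<ge> r\<close> r1(1) by (simp add: r_def)
      qed
      then show ?thesis by (simp add: mem_box abs_le_iff) (smt (verit))
    qed
    moreover have "F \<subseteq> box (- R *\<^sub>R One) (R *\<^sub>R One)"
    proof
      fix x assume "x \<in> F"
      have "\<bar>x \<bullet> b\<bar> < R" if "b \<in> Basis" for b
        using Basis_le_norm[OF that, of x] r1(2)[OF \<open>x \<in> F\<close>] \<open>R \<ge> r\<close> r0(1) by (simp add: r_def)
      then show "x \<in> box (- R *\<^sub>R One) (R *\<^sub>R One)" by (simp add: mem_box abs_less_iff) (smt (verit))
    qed
    ultimately obtain K :: "(real ^ 'm) set" where K: "finite K" "K \<subseteq> lattice (pi / R)"
      "?S \<le> (\<Sum>\<xi>\<in>K. max 0 (z - norm \<xi>) powr \<gamma>) * ?m / (2 * R) ^ ?d + \<epsilon>"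
      using riesz_sum_le_lattice_sum[OF dom E o R _ _ \<open>\<gamma> \<ge> 1\<close> \<open>\<epsilon> > 0\<close>] by metis
    let ?h = "pi / R"
    have h: "?h > 0" using R by simp
    have pos: "z + ?h * ?d > 0" using h \<open>z > 0\<close> by (intro add_pos_nonneg mult_nonneg_nonneg) (simp_all only: less_imp_le of_nat_0_le_iff)
    have "ennreal (\<Sum>\<xi>\<in>K. ?h ^ ?d * max 0 (z - norm \<xi>) powr \<gamma>) = (\<Sum>\<xi>\<in>K. ennreal (?h ^ ?d * max 0 (z - norm \<xi>) powr \<gamma>))"
      using h by (intro sum_ennreal[symmetric]) simp
    also have "\<dots> \<le> (\<integral>\<^sup>+x. ennreal (max 0 (z + ?h * ?d - norm (x::real ^ 'm)) powr \<gamma>) \<partial>lborel)"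
      using lattice_sum_le_nn_integral[OF h K(1,2), of \<gamma> z] \<open>\<gamma> \<ge> 1\<close> by simp
    also have "\<dots> = ennreal (A * (z + ?h * ?d) powr (\<gamma> + ?d))"
      using nn_integral_radial_power[where 'a="real ^ 'm", of "z + ?h * ?d" \<gamma>] pos \<open>\<gamma> \<ge> 1\<close>
      by (simp add: A_def)
    finally have "(\<Sum>\<xi>\<in>K. ?h ^ ?d * max 0 (z - norm \<xi>) powr \<gamma>) \<le> A * (z + ?h * ?d) powr (\<gamma> + ?d)"
      using A0 by (simp add: ennreal_le_iff)
    then have "?h ^ ?d * (\<Sum>\<xi>\<in>K. max 0 (z - norm \<xi>) powr \<gamma>) * ?m / (2 * pi) ^ ?d \<le> A * (z + ?h * ?d) powr (\<gamma> + ?d) * ?m / (2 * pi) ^ ?d"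
      by (intro divide_right_mono mult_right_mono) (simp_all add: sum_distrib_left)
    \<comment> \<open>The lattice cell has volume \<open>(pi / R) ^ ?d\<close> and the cube
      \<open>(2 * R) ^ ?d\<close>; their product \<open>(2 * pi) ^ ?d\<close> does not depend on
      \<open>R\<close>.\<close>
    moreover have "?h ^ ?d * X * ?m / (2 * pi) ^ ?d = X * ?m / (2 * R) ^ ?d" for X
      using R by (simp add: power_divide power_mult_distrib)
    ultimately show "?S \<le> A * (z + pi / R * ?d) powr (\<gamma> + ?d) * ?m / (2 * pi) ^ ?d + \<epsilon>"
      using K(3) by simp
  qed
  have "((\<lambda>R. pi / R) \<longlongrightarrow> 0) at_top"
    by (rule real_tendsto_divide_at_top[OF tendsto_const filterlim_ident])
  then have "((\<lambda>R. A * (z + pi / R * ?d) powr (\<gamma> + ?d) * ?m / (2 * pi) ^ ?d)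
      \<longlongrightarrow> A * (z + 0 * real ?d) powr (\<gamma> + ?d) * ?m / (2 * pi) ^ ?d) at_top"
    using \<open>z > 0\<close>
    by (intro tendsto_divide[OF _ tendsto_const] tendsto_mult tendsto_powr tendsto_add tendsto_const) auto
  then have "?S \<le> A * (z + 0 * real ?d) powr (\<gamma> + ?d) * ?m / (2 * pi) ^ ?d"
    by (rule tendsto_lowerbound[OF _ eventually_mono[OF eventually_ge_at_top bound]]) simp_all
  then show ?thesis by (simp add: A mult_ac)
qed

theorem theorem1p5:
  fixes \<Omega> B :: "((real ^ 'm) \<times> real) set" and F :: "(real ^ 'm) set"
    and \<eta> :: "nat \<Rightarrow> real" and \<gamma> z :: real and n :: nat
  assumes "n = CARD('m) + 1"
    and "admissible_domain \<Omega> F B"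
    and "\<Omega> \<subseteq> F \<times> {..0}"
    and "steklov_dirichlet_eigenvalues \<Omega> F B \<eta>"
    and "\<gamma> \<ge> 1" and "z > 0"
  shows "riesz_mean \<gamma> z \<eta>
    \<le> ennreal (riesz_const n \<gamma> * measure lebesgue F * z powr (real n + \<gamma> - 1))"
proof -
  have dom: "free_boundary_domain \<Omega> F B"
    using assms(2,3) by (rule admissible_imp_free_boundary_domain)
  obtain f g t where E: "\<And>j. eigentriple \<Omega> F B (\<eta> j) (f j) (g j) (t j)"
    and o: "\<And>i j. (\<integral>x. t i x * t j x \<partial>lebesgue_on F) = (if i = j then 1 else 0)"
    using orthonormal_eigentriples[OF dom assms(4)] by blast
  have e: "real n + \<gamma> - 1 = \<gamma> + CARD('m)" using assms(1) by simp
  have "(\<Sum>j<N. ennreal (max 0 (z - \<eta> j) powr \<gamma>))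
      \<le> ennreal (riesz_const n \<gamma> * measure lebesgue F * z powr (real n + \<gamma> - 1))" for N
  proof -
    have "(\<Sum>j<N. ennreal (max 0 (z - \<eta> j) powr \<gamma>)) = ennreal (\<Sum>j<N. max 0 (z - \<eta> j) powr \<gamma>)"
      by (intro sum_ennreal) simp
    also have "\<dots> \<le> ennreal (riesz_const n \<gamma> * measure lebesgue F * z powr (real n + \<gamma> - 1))"
      unfolding e using riesz_sum_le[OF dom E o assms(5,6)] assms(1) by (intro ennreal_leI) simp
    finally show ?thesis .
  qed
  then show ?thesis
    unfolding riesz_mean_def by (intro suminf_le_const summableI)
qed

end
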